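(* Let $q$ be a prime power, $n\geq 1$, $t\geq 1$, and let $\ell\in\mathbb{F}_{q^n}[x]$ be a $t$-normalized $q$-linearized polynomial of linearized degree $r$; let $d\coloneqq\max\{r,t\}$. Let $s$ be transcendental over $\mathbb{F}_q$, let $M$ be the splitting field of $\ell-sx^{q^t}$ over $\mathbb{F}_{q^n}(s)$, and let $C$ be the uniformizing constant of $M/\mathbb{F}_{q^n}(s)$. Let $m\geq 1$ satisfy $q^{mn}>C$. With $M_m, k_m, G^{\mathrm{arith}}_m, G^{\mathrm{geom}}_m,\varphi_m, V$ as in the context, the following are equivalent: (1) $\ell$ is $(q,n,m,t)$-scattered; (2) for every $\gamma\in G^{\mathrm{arith}}_m$ such that $\varphi_m(\gamma G^{\mathrm{geom}}_m)$ is the Frobenius $u\mapsto u^{q^{nm}}$ of $k_m/\mathbb{F}_{q^{nm}}$ and every $h\in G^{\mathrm{geom}}_m$, one has $\mathrm{rk}(h\gamma-\mathrm{Id})\geq d-1$, where $h\gamma-\mathrm{Id}$ is viewed as an $\mathbb{F}_q$-linear endomorphism of $V$. Moreover, $\ell$ is exceptional $t$-scattered if and only if there exists $m\geq 1$ with $q^{nm}>C$ such that $\ell$ is $(q,n,m,t)$-scattered.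
   Context: A $q$-linearized polynomial is one of the form $\sum_{i=0}^r a_i x^{q^i}$; if $a_r\neq0$ its linearized degree is $r$. $\ell$ is $(q,n,m,t)$-scattered if for every $s_0\in\mathbb{F}_{q^{nm}}$ the polynomial $\ell-s_0x^{q^t}$ has at most $q$ roots in $\mathbb{F}_{q^{nm}}$; it is exceptional $t$-scattered if it is $(q,n,m,t)$-scattered for infinitely many $m$. It is $t$-normalized if it is monic, its coefficient of $x^{q^t}$ is zero, and (as $t>0$) its coefficient of $x$ is non-zero. Setup: $M_m\coloneqq M\cdot\mathbb{F}_{q^{nm}}$, $k_m\coloneqq\overline{\mathbb{F}}_q\cap M_m$ its constant field, $G^{\mathrm{arith}}_m\coloneqq\mathrm{Gal}(M_m/\mathbb{F}_{q^{nm}}(s))$, $G^{\mathrm{geom}}_m\coloneqq\mathrm{Gal}(M_m/k_m(s))$ (a normal subgroup), and $\varphi_m\colon G^{\mathrm{arith}}_m/G^{\mathrm{geom}}_m\to\mathrm{Gal}(k_m/\mathbb{F}_{q^{nm}})$ the natural isomorphism (restriction to constants). $V$ is the set of roots of $\ell-sx^{q^t}$ in $M$; it is a $d$-dimensional $\mathbb{F}_q$-vector space on which $G^{\mathrm{arith}}_m$ acts $\mathbb{F}_q$-linearly. The uniformizing constant of $M/\mathbb{F}_{q^n}(s)$ is the smallest real $C>0$ (such constants exist by the Chebotarev density theorem) with the property: for every $m$ with $q^{nm}>C$, every $\gamma\in G^{\mathrm{arith}}_m$ such that $\varphi_m(\gamma G^{\mathrm{geom}}_m)$ is the Frobenius of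 $k_m/\mathbb{F}_{q^{nm}}$ is a Frobenius element (for some place $R$ of $M_m$ above $P$) of some finite, unramified place $P$ of degree $1$ of $\mathbb{F}_{q^{nm}}(s)$. *)

theory Defs
  imports
    "HOL-Algebra.Algebraic_Closure_Type"
    "HOL-Algebra.Finite_Extensions"
    "HOL-Algebra.Ideal_Product"
    "HOL-Algebra.QuotRing"
    "HOL-Algebra.Coset"
    "HOL-Algebra.Generated_Fields"
begin

text \<open>
  All fields occurring here are subfields, represented as sets, of one ambient algebraically
  closed field, given by a type of class \<^class>\<open>alg_closed_field\<close>. It is regarded as a ring in
  the sense of HOL-Algebra through \<^const>\<open>ring_of_type_algebra\<close>.
\<close>

abbreviation ambient :: "'a::field ring" (\<open>\<Omega>\<close>)
  where "\<Omega> \<equiv> ring_of_type_algebra"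

abbreviation subring_of :: "'a::field set \<Rightarrow> 'a ring" (\<open>\<Omega>|'(_')\<close>)
  where "\<Omega>|(A) \<equiv> \<Omega>\<lparr>carrier := A\<rparr>"

text \<open>If \<open>N > 1\<close> is a power of the characteristic, this is the unique subfield with \<open>N\<close> elements.\<close>

definition GF :: "nat \<Rightarrow> 'a::field set"
  where "GF N = {x. x ^ N = x}"

definition rational_function_field :: "nat \<Rightarrow> 'a::field \<Rightarrow> 'a set"
  where "rational_function_field N s = generate_field \<Omega> (insert s (GF N))"

text \<open>As the ambient field is algebraically closed, \<open>f\<close> splits in it.\<close>

definition splitting_field :: "'a::alg_closed_field set \<Rightarrow> 'a poly \<Rightarrow> 'a set"
  where "splitting_field K f = generate_field \<Omega> (K \<union> {x. poly f x = 0})"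


section \<open>Linearized and scattered polynomials\<close>

definition linearized_of_degree :: "nat \<Rightarrow> nat \<Rightarrow> 'a::field poly \<Rightarrow> bool"
  where "linearized_of_degree q r l \<longleftrightarrow>
    (\<exists>a. a r \<noteq> 0 \<and> l = (\<Sum>i\<le>r. Polynomial.monom (a i) (q ^ i)))"

text \<open>Only meaningful for \<open>t > 0\<close>.\<close>

definition t_normalized :: "nat \<Rightarrow> nat \<Rightarrow> 'a::field poly \<Rightarrow> bool"
  where "t_normalized q t l \<longleftrightarrow>
    Polynomial.lead_coeff l = 1 \<and> Polynomial.coeff l (q ^ t) = 0 \<and> Polynomial.coeff l 1 \<noteq> 0"

definition pencil :: "nat \<Rightarrow> nat \<Rightarrow> 'a::field poly \<Rightarrow> 'a \<Rightarrow> 'a poly"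
  where "pencil q t l s = l - Polynomial.monom s (q ^ t)"

definition scattered :: "nat \<Rightarrow> nat \<Rightarrow> nat \<Rightarrow> nat \<Rightarrow> 'a::field poly \<Rightarrow> bool"
  where "scattered q n m t l \<longleftrightarrow>
    (\<forall>s\<^sub>0 \<in> GF (q ^ (n * m)). card {x \<in> GF (q ^ (n * m)). poly (pencil q t l s\<^sub>0) x = 0} \<le> q)"

definition exceptional_scattered :: "nat \<Rightarrow> nat \<Rightarrow> nat \<Rightarrow> 'a::field poly \<Rightarrow> bool"
  where "exceptional_scattered q n t l \<longleftrightarrow> infinite {m. m \<ge> 1 \<and> scattered q n m t l}"


section \<open>Arithmetic and geometric Galois groups\<close>

text \<open>Automorphisms of \<open>L\<close> are extended by the identity outside \<open>L\<close>.\<close>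

definition Gal :: "'a::field set \<Rightarrow> 'a set \<Rightarrow> ('a \<Rightarrow> 'a) monoid"
  where "Gal L K =
    \<lparr>carrier = {\<sigma> \<in> ring_iso (\<Omega>|(L)) (\<Omega>|(L)). (\<forall>x\<in>K. \<sigma> x = x) \<and> (\<forall>x. x \<notin> L \<longrightarrow> \<sigma> x = x)},
     monoid.mult = (\<circ>), one = id\<rparr>"

text \<open>
  In the following, \<open>M\<close> is an extension of \<open>rational_function_field (q ^ n) s\<close>, and
  \<open>M_ext q n m M\<close> is the compositum of \<open>M\<close> and the field with \<open>q ^ (n * m)\<close> elements.
\<close>

definition M_ext :: "nat \<Rightarrow> nat \<Rightarrow> nat \<Rightarrow> 'a::field set \<Rightarrow> 'a set"
  where "M_ext q n m M = generate_field \<Omega> (M \<union> GF (q ^ (n * m)))"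

definition const_field :: "nat \<Rightarrow> nat \<Rightarrow> nat \<Rightarrow> 'a::field set \<Rightarrow> 'a set"
  where "const_field q n m M = {x. ring.algebraic \<Omega> (GF q) x} \<inter> M_ext q n m M"

definition G_arith :: "nat \<Rightarrow> nat \<Rightarrow> nat \<Rightarrow> 'a::field \<Rightarrow> 'a set \<Rightarrow> ('a \<Rightarrow> 'a) monoid"
  where "G_arith q n m s M = Gal (M_ext q n m M) (rational_function_field (q ^ (n * m)) s)"

definition G_geom :: "nat \<Rightarrow> nat \<Rightarrow> nat \<Rightarrow> 'a::field \<Rightarrow> 'a set \<Rightarrow> ('a \<Rightarrow> 'a) monoid"
  where "G_geom q n m s M =
    Gal (M_ext q n m M) (generate_field \<Omega> (insert s (const_field q n m M)))"

text \<open>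
  The isomorphism from \<open>G_arith / G_geom\<close> to the Galois group of the constant field: a coset is
  sent to the restriction of any of its representatives (all of them agree on the constants).
\<close>

definition const_restriction ::
    "nat \<Rightarrow> nat \<Rightarrow> nat \<Rightarrow> 'a::field set \<Rightarrow> ('a \<Rightarrow> 'a) set \<Rightarrow> ('a \<Rightarrow> 'a)"
  where "const_restriction q n m M S =
    (\<lambda>u. if u \<in> const_field q n m M then (SOME \<gamma>. \<gamma> \<in> S) u else u)"

definition const_Frobenius :: "nat \<Rightarrow> nat \<Rightarrow> nat \<Rightarrow> 'a::field set \<Rightarrow> ('a \<Rightarrow> 'a)"
  where "const_Frobenius q n m M = (\<lambda>u. if u \<in> const_field q n m M then u ^ (q ^ (n * m)) else u)"

definition induces_Frobenius ::
    "nat \<Rightarrow> nat \<Rightarrow> nat \<Rightarrow> 'a::field \<Rightarrow> 'a set \<Rightarrow> ('a \<Rightarrow> 'a) \<Rightarrow> bool"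
  where "induces_Frobenius q n m s M \<gamma> \<longleftrightarrow>
    const_restriction q n m M
      (\<gamma> <#\<^bsub>G_arith q n m s M\<^esub> carrier (G_geom q n m s M))
    = const_Frobenius q n m M"

definition rk :: "nat \<Rightarrow> 'a::field set \<Rightarrow> ('a \<Rightarrow> 'a) \<Rightarrow> nat"
  where "rk q V f = ring.dim \<Omega> (GF q) (f ` V)"


section \<open>Places and Frobenius elements\<close>

text \<open>
  \<open>K\<close> is a field of constants of the function field \<open>F\<close>. A place is the maximal ideal \<open>P\<close> of a
  valuation ring \<open>A\<close> of \<open>F\<close> over \<open>K\<close>; the ring \<open>A\<close>, which \<open>P\<close> determines, is carried along.
\<close>

definition valuation_ring :: "'a::field set \<Rightarrow> 'a set \<Rightarrow> 'a set \<Rightarrow> bool"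
  where "valuation_ring K F A \<longleftrightarrow>
    subring A \<Omega> \<and> K \<subset> A \<and> A \<subset> F \<and> (\<forall>z\<in>F. z \<in> A \<or> inverse z \<in> A)"

definition place :: "'a::field set \<Rightarrow> 'a set \<Rightarrow> 'a set \<Rightarrow> 'a set \<Rightarrow> bool"
  where "place K F A P \<longleftrightarrow> valuation_ring K F A \<and> maximalideal P (\<Omega>|(A))"

definition residue_field :: "'a::field set \<Rightarrow> 'a set \<Rightarrow> 'a set ring"
  where "residue_field A P = \<Omega>|(A) Quot P"

definition place_has_degree :: "'a::field set \<Rightarrow> 'a set \<Rightarrow> 'a set \<Rightarrow> nat \<Rightarrow> bool"
  where "place_has_degree K A P k \<longleftrightarrow>
    ring.dimension (residue_field A P) k ((\<lambda>x. P +>\<^bsub>\<Omega>|(A)\<^esub> x) ` K) (carrier (residue_field A P))"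

text \<open>The place \<open>R\<close>, with valuation ring \<open>B\<close>, lies above \<open>P\<close>, and \<open>P B = R ^ e\<close>.\<close>

definition has_ramification_index :: "'a::field set \<Rightarrow> 'a set \<Rightarrow> 'a set \<Rightarrow> nat \<Rightarrow> bool"
  where "has_ramification_index P B R e \<longleftrightarrow>
    P \<subseteq> R \<and> Idl\<^bsub>\<Omega>|(B)\<^esub> P = R [^]\<^bsub>ideals_set (\<Omega>|(B))\<^esub> e"

text \<open>
  \<open>K'\<close> is a field of constants of the extension \<open>L\<close>. Separability of the residue field
  extensions is automatic here, as all residue fields are finite.
\<close>

definition unramified :: "'a::field set \<Rightarrow> 'a set \<Rightarrow> 'a set \<Rightarrow> bool"
  where "unramified P K' L \<longleftrightarrow>
    (\<forall>B R. place K' L B R \<and> P \<subseteq> R \<longrightarrow> has_ramification_index P B R 1)"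

definition Frobenius_element ::
    "'a::field set \<Rightarrow> 'a set \<Rightarrow> 'a set \<Rightarrow> 'a set \<Rightarrow> ('a \<Rightarrow> 'a) \<Rightarrow> bool"
  where "Frobenius_element A P B R \<gamma> \<longleftrightarrow>
    \<gamma> ` R = R \<and> (\<forall>x\<in>B. \<gamma> x - x ^ card (carrier (residue_field A P)) \<in> R)"

text \<open>A place is finite if it is not a pole of \<open>s\<close>.\<close>

definition Frobenius_of_rational_place ::
    "nat \<Rightarrow> nat \<Rightarrow> nat \<Rightarrow> 'a::field \<Rightarrow> 'a set \<Rightarrow> ('a \<Rightarrow> 'a) \<Rightarrow> bool"
  where "Frobenius_of_rational_place q n m s M \<gamma> \<longleftrightarrow>
    (\<exists>A P. place (GF (q ^ (n * m))) (rational_function_field (q ^ (n * m)) s) A P \<and>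
       s \<in> A \<and>
       place_has_degree (GF (q ^ (n * m))) A P 1 \<and>
       unramified P (const_field q n m M) (M_ext q n m M) \<and>
       (\<exists>B R. place (const_field q n m M) (M_ext q n m M) B R \<and> P \<subseteq> R \<and>
          Frobenius_element A P B R \<gamma>))"


section \<open>The uniformizing constant\<close>

definition admissible_constant :: "nat \<Rightarrow> nat \<Rightarrow> 'a::field \<Rightarrow> 'a set \<Rightarrow> real \<Rightarrow> bool"
  where "admissible_constant q n s M C \<longleftrightarrow> C > 0 \<and>
    (\<forall>m\<ge>1. real (q ^ (n * m)) > C \<longrightarrow>
      (\<forall>\<gamma> \<in> carrier (G_arith q n m s M).
         induces_Frobenius q n m s M \<gamma> \<longrightarrow> Frobenius_of_rational_place q n m s M \<gamma>))"

text \<open>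
  The smallest admissible constant, except that the infimum replaces the minimum: if the defining
  property holds for every \<open>m\<close>, then all positive reals are admissible and there is no smallest
  one. Whenever there is a smallest one, the infimum is the same number.
\<close>

definition is_uniformizing_constant :: "nat \<Rightarrow> nat \<Rightarrow> 'a::field \<Rightarrow> 'a set \<Rightarrow> real \<Rightarrow> bool"
  where "is_uniformizing_constant q n s M C \<longleftrightarrow>
    (\<exists>C'. admissible_constant q n s M C') \<and> C = Inf {C'. admissible_constant q n s M C'}"

lemma is_uniformizing_constant_minimum:
  assumes "admissible_constant q n s M C"
    and "\<And>C'. admissible_constant q n s M C' \<Longrightarrow> C \<le> C'"
  shows "is_uniformizing_constant q n s M C"
proof -
  have "Inf {C'. admissible_constant q n s M C'} = C"
    by (rule cInf_eq_minimum) (use assms in auto)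
  then show ?thesis
    using assms(1) by (auto simp: is_uniformizing_constant_def)
qed

end

theory Submission
  imports Defs
begin

text \<open>
  Put \<open>N = q ^ (n * m)\<close>. At a rational place \<open>s = c\<close> a Frobenius element acts on the roots \<open>V\<close> of the
  pencil as \<open>x \<mapsto> x ^ N\<close> acts on the roots of the specialised polynomial, because the derivative of the
  pencil is a non-zero constant and so \<open>V\<close> reduces injectively. Hence the roots in the field with
  \<open>N\<close> elements correspond to the fixed vectors of a Frobenius element, and having at most \<open>q\<close> of them
  means that the rank of \<open>\<gamma> - Id\<close> is at least \<open>d - 1\<close>. The admissibility of the constant turns every
  element of the Frobenius coset into such a Frobenius element; the only place where \<open>V\<close> has poles,
  \<open>s = 0\<close> for \<open>r < t\<close>, is ramified unless \<open>d = 1\<close>. In the opposite direction one needs, for every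
  \<open>c\<close>, some Frobenius element over \<open>s = c\<close>, which is obtained from a valuation ring of the splitting
  field. Finally, the action of the Frobenius coset on \<open>V\<close> depends on \<open>m\<close> only modulo the degree of
  the constant field of \<open>M\<close>, which gives infinitely many \<open>m\<close> from one.
\<close>

section \<open>Subrings, subfields and homomorphisms in a field type\<close>

text \<open>Condition (2) constrains the whole Frobenius coset, while scatteredness only sees
  Frobenius elements over the points \<open>s = c\<close>. The constant supplies a good place for
  every element of the coset, but it says nothing about a given \<open>c\<close>; for the converse
  every \<open>c\<close> has to be reached, including points that ramify. Residue fields of the
  splitting field are avoided: congruences are taken modulo the non-units of a valuation ring, and
  the only residues needed are elements of the field with \<open>N\<close> elements, whose non-zero
  elements are units. The integral closure is replaced by the ring of elements all of whose
  conjugates are integral; it is stable under the Galois group, so a Frobenius can be lifted there.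
  The case \<open>r < t\<close> shapes the proof. The pencil then has leading coefficient
  \<open>- s\<close>, and roots escape to infinity at \<open>s = 0\<close>. From scattered to rank
  this point is excluded by unramifiedness. In the converse it cannot be excluded, and one works
  with the inverses \<open>1 / v\<close> of the roots, which are integral over every
  \<open>c\<close>.\<close>

lemma ambient_simps [simp]:
  "carrier \<Omega> = UNIV" "x \<otimes>\<^bsub>\<Omega>\<^esub> y = x * y" "\<one>\<^bsub>\<Omega>\<^esub> = 1" "\<zero>\<^bsub>\<Omega>\<^esub> = 0" "x \<oplus>\<^bsub>\<Omega>\<^esub> y = x + y"
  by (simp_all add: ring_of_type_algebra_def)

lemma field_ambient: "field (\<Omega> :: 'a::field ring)"
  by (rule field_from_type_algebra)

lemma ring_ambient: "ring (\<Omega> :: 'a::field ring)"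
  by (rule ring_from_type_algebra)

lemma a_inv_ambient [simp]: "\<ominus>\<^bsub>\<Omega>\<^esub> (x :: 'a::field) = - x"
  by (rule abelian_group.minus_equality[OF ring.is_abelian_group[OF ring_ambient]]) auto

lemma m_inv_ambient [simp]: "(x :: 'a::field) \<noteq> 0 \<Longrightarrow> inv\<^bsub>\<Omega>\<^esub> x = inverse x"
  using monoid.inv_unique'[OF ring.is_monoid[OF ring_ambient], of x "inverse x"] by simp

lemma subringI_type:
  fixes A :: "'a::field set"
  assumes "1 \<in> A" "\<And>x. x \<in> A \<Longrightarrow> - x \<in> A"
    "\<And>x y. x \<in> A \<Longrightarrow> y \<in> A \<Longrightarrow> x * y \<in> A" "\<And>x y. x \<in> A \<Longrightarrow> y \<in> A \<Longrightarrow> x + y \<in> A"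
  shows "subring A \<Omega>"
  by (rule ring.subringI[OF ring_ambient]) (use assms in auto)

lemma subring_UNIV: "subring (UNIV :: 'a::field set) \<Omega>"
  by (rule subringI_type) auto

lemma subringD:
  fixes A :: "'a::field set"
  assumes "subring A \<Omega>"
  shows subring_zero: "0 \<in> A" and subring_one: "1 \<in> A"
    and subring_uminus: "x \<in> A \<Longrightarrow> - x \<in> A"
    and subring_mult: "x \<in> A \<Longrightarrow> y \<in> A \<Longrightarrow> x * y \<in> A"
    and subring_add: "x \<in> A \<Longrightarrow> y \<in> A \<Longrightarrow> x + y \<in> A"
  using subringE[OF assms] by auto

lemma subring_diff:
  fixes A :: "'a::field set"
  assumes "subring A \<Omega>" "x \<in> A" "y \<in> A" shows "x - y \<in> A"
  using subringD[OF assms(1)] assms(2,3) by (metis diff_conv_add_uminus)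

lemma subring_power:
  fixes A :: "'a::field set"
  assumes "subring A \<Omega>" "x \<in> A" shows "x ^ k \<in> A"
  by (induction k) (use subringD[OF assms(1)] assms(2) in auto)

lemma subring_sum:
  fixes A :: "'a::field set"
  assumes "subring A \<Omega>" "\<And>i. i \<in> I \<Longrightarrow> g i \<in> A" shows "sum g I \<in> A"
  using assms(2) by (induction I rule: infinite_finite_induct) (use subringD[OF assms(1)] in auto)

lemma subring_prod:
  fixes A :: "'a::field set"
  assumes "subring A \<Omega>" "\<And>i. i \<in> I \<Longrightarrow> g i \<in> A" shows "prod g I \<in> A"
  using assms(2) by (induction I rule: infinite_finite_induct) (use subringD[OF assms(1)] in auto)

lemmas subring_closed = subring_zero subring_one subring_uminus subring_mult subring_add
  subring_diff subring_power subring_sum subring_prod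

lemma subfieldI_type:
  fixes A :: "'a::field set"
  assumes "1 \<in> A" "\<And>x. x \<in> A \<Longrightarrow> - x \<in> A"
    "\<And>x y. x \<in> A \<Longrightarrow> y \<in> A \<Longrightarrow> x * y \<in> A" "\<And>x y. x \<in> A \<Longrightarrow> y \<in> A \<Longrightarrow> x + y \<in> A"
    "\<And>x. x \<in> A \<Longrightarrow> x \<noteq> 0 \<Longrightarrow> inverse x \<in> A"
  shows "subfield A \<Omega>"
  by (rule field.subfieldI'[OF field_ambient]) (use assms in \<open>auto intro: subringI_type\<close>)

lemma subfield_subring: "subfield A \<Omega> \<Longrightarrow> subring A (\<Omega> :: 'a::field ring)"
  by (rule subfieldE(1))

lemma subfield_inverse:
  fixes A :: "'a::field set"
  assumes "subfield A \<Omega>" "x \<in> A" shows "inverse x \<in> A"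
proof (cases "x = 0")
  case False
  then show ?thesis
    using ring.subfield_m_inv(1)[OF ring_ambient assms(1), of x] assms(2) by auto
qed (use assms in auto)

lemma subfield_generate_field: "subfield (generate_field \<Omega> S) (\<Omega> :: 'a::field ring)"
  by (rule field.generate_field_is_subfield[OF field_ambient]) auto

lemma generate_field_superset: "S \<subseteq> generate_field \<Omega> (S :: 'a::field set)"
  by (auto intro: generate_field.incl)

lemma generate_field_least:
  "subfield E \<Omega> \<Longrightarrow> S \<subseteq> E \<Longrightarrow> generate_field \<Omega> S \<subseteq> (E :: 'a::field set)"
  by (rule field.generate_field_min_subfield1[OF field_ambient]) auto

text \<open>The target is the whole ambient field, so a homomorphism can be extended root by root
  before its image is known.\<close>

abbreviation hom_on :: "'a::field set \<Rightarrow> ('a \<Rightarrow> 'a) \<Rightarrow> bool"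
  where "hom_on E \<sigma> \<equiv> \<sigma> \<in> ring_hom (\<Omega>|(E)) \<Omega>"

lemma hom_on_iff:
  "hom_on E \<sigma> \<longleftrightarrow> \<sigma> 1 = 1 \<and> (\<forall>x\<in>E. \<forall>y\<in>E. \<sigma> (x + y) = \<sigma> x + \<sigma> y \<and> \<sigma> (x * y) = \<sigma> x * \<sigma> y)"
  by (auto simp: ring_hom_def)

lemma hom_on_subset: "hom_on E \<sigma> \<Longrightarrow> E' \<subseteq> E \<Longrightarrow> hom_on E' \<sigma>"
  unfolding hom_on_iff by blast

lemma
  assumes "hom_on E \<sigma>"
  shows hom_on_one: "\<sigma> 1 = 1"
    and hom_on_add: "x \<in> E \<Longrightarrow> y \<in> E \<Longrightarrow> \<sigma> (x + y) = \<sigma> x + \<sigma> y"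
    and hom_on_mult: "x \<in> E \<Longrightarrow> y \<in> E \<Longrightarrow> \<sigma> (x * y) = \<sigma> x * \<sigma> y"
  using assms unfolding hom_on_iff by blast+

context
  fixes E :: "'a::field set" and \<sigma>
  assumes hom: "hom_on E \<sigma>" and E: "subring E \<Omega>"
begin

lemma hom_on_zero: "\<sigma> 0 = 0"
proof -
  have "\<sigma> 0 + \<sigma> 0 = \<sigma> 0 + 0"
    using hom_on_add[OF hom, of 0 0] subring_zero[OF E] by (simp del: mult_2 mult_2_right)
  then show ?thesis by (simp only: add_left_cancel)
qed

lemma hom_on_uminus: "x \<in> E \<Longrightarrow> \<sigma> (- x) = - \<sigma> x"
  using hom_on_add[OF hom, of x "- x"] subring_uminus[OF E, of x] hom_on_zero
  by (simp add: eq_neg_iff_add_eq_0 add.commute)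

lemma hom_on_diff: "x \<in> E \<Longrightarrow> y \<in> E \<Longrightarrow> \<sigma> (x - y) = \<sigma> x - \<sigma> y"
  using hom_on_add[OF hom, of x "- y"] hom_on_uminus subring_uminus[OF E, of y] by simp

lemma hom_on_power: "x \<in> E \<Longrightarrow> \<sigma> (x ^ k) = \<sigma> x ^ k"
  by (induction k) (auto simp: hom_on_one[OF hom] hom_on_mult[OF hom] subring_power[OF E])

lemma hom_on_sum: "(\<And>i. i \<in> I \<Longrightarrow> g i \<in> E) \<Longrightarrow> \<sigma> (sum g I) = (\<Sum>i\<in>I. \<sigma> (g i))"
  by (induction I rule: infinite_finite_induct)
     (auto simp: hom_on_zero hom_on_add[OF hom] subring_sum[OF E])

end

lemma hom_on_inverse:
  assumes hom: "hom_on E \<sigma>" and E: "subfield E \<Omega>" and x: "x \<in> E"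
  shows "\<sigma> (inverse x) = inverse (\<sigma> x)"
proof (cases "x = 0")
  case False
  have "\<sigma> x * \<sigma> (inverse x) = 1"
    using hom_on_mult[OF hom x subfield_inverse[OF E x]] False hom_on_one[OF hom] by simp
  then show ?thesis by (metis inverse_unique)
qed (simp add: hom_on_zero[OF hom subfield_subring[OF E]])

lemma hom_on_inj:
  assumes hom: "hom_on E \<sigma>" and E: "subfield E \<Omega>"
  shows "inj_on \<sigma> E"
proof (rule inj_onI)
  fix x y assume xy: "x \<in> E" "y \<in> E" "\<sigma> x = \<sigma> y"
  note E' = subfield_subring[OF E]
  have d: "x - y \<in> E" using xy E' by (simp add: subring_diff)
  have z: "\<sigma> (x - y) = 0" using hom_on_diff[OF hom E'] xy by simp
  show "x = y"
  proof (rule ccontr)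
    assume "x \<noteq> y"
    then have "\<sigma> (x - y) * \<sigma> (inverse (x - y)) = 1"
      using hom_on_mult[OF hom d subfield_inverse[OF E d]] hom_on_one[OF hom] by simp
    with z show False by simp
  qed
qed

lemma hom_on_eq_generate_field:
  assumes \<sigma>: "hom_on (generate_field \<Omega> S) \<sigma>" and \<tau>: "hom_on (generate_field \<Omega> S) \<tau>"
    and eq: "\<And>x. x \<in> S \<Longrightarrow> \<sigma> x = \<tau> x" and x: "x \<in> generate_field \<Omega> S"
  shows "\<sigma> x = \<tau> x"
proof -
  let ?F = "generate_field \<Omega> S"
  note F = subfield_generate_field[of S] and R = subfield_subring[OF subfield_generate_field[of S]]
  have "subfield {x \<in> ?F. \<sigma> x = \<tau> x} \<Omega>"
    by (rule subfieldI_type)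
       (auto simp: hom_on_one[OF \<sigma>] hom_on_one[OF \<tau>] hom_on_add[OF \<sigma>] hom_on_add[OF \<tau>]
         hom_on_mult[OF \<sigma>] hom_on_mult[OF \<tau>] hom_on_uminus[OF \<sigma> R] hom_on_uminus[OF \<tau> R]
         hom_on_inverse[OF \<sigma> F] hom_on_inverse[OF \<tau> F] subring_closed[OF R] subfield_inverse[OF F])
  from generate_field_least[OF this, of S] x eq generate_field_superset[of S] show ?thesis by auto
qed

lemma hom_on_image_generate_field:
  assumes \<sigma>: "hom_on (generate_field \<Omega> S) \<sigma>" and E: "subfield E \<Omega>"
    and S: "\<And>x. x \<in> S \<Longrightarrow> \<sigma> x \<in> E" and x: "x \<in> generate_field \<Omega> S"
  shows "\<sigma> x \<in> E"
proof -
  let ?F = "generate_field \<Omega> S"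
  note F = subfield_generate_field[of S] and R = subfield_subring[OF subfield_generate_field[of S]]
  have "subfield {x \<in> ?F. \<sigma> x \<in> E} \<Omega>"
    by (rule subfieldI_type)
       (auto simp: hom_on_one[OF \<sigma>] hom_on_add[OF \<sigma>] hom_on_mult[OF \<sigma>] hom_on_uminus[OF \<sigma> R]
         hom_on_inverse[OF \<sigma> F] subring_closed[OF R] subfield_inverse[OF F]
         subring_closed[OF subfield_subring[OF E]] subfield_inverse[OF E])
  from generate_field_least[OF this, of S] x S generate_field_superset[of S] show ?thesis by auto
qed

lemma subfield_image_hom:
  assumes \<sigma>: "hom_on E \<sigma>" and E: "subfield E \<Omega>"
  shows "subfield (\<sigma> ` E) \<Omega>"
proof -
  note R = subfield_subring[OF E]
  show ?thesis
  proof (rule subfieldI_type)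
    show "1 \<in> \<sigma> ` E"
      by (rule image_eqI[OF _ subring_one[OF R]]) (simp add: hom_on_one[OF \<sigma>])
    show "- x \<in> \<sigma> ` E" if x: "x \<in> \<sigma> ` E" for x
    proof -
      obtain a where "x = \<sigma> a" "a \<in> E" using x by blast
      then have "- x = \<sigma> (- a)" "- a \<in> E"
        by (simp_all add: hom_on_uminus[OF \<sigma> R] subring_uminus[OF R])
      then show ?thesis by (rule image_eqI)
    qed
    show "inverse x \<in> \<sigma> ` E" if x: "x \<in> \<sigma> ` E" for x
    proof -
      obtain a where "x = \<sigma> a" "a \<in> E" using x by blast
      then have "inverse x = \<sigma> (inverse a)" "inverse a \<in> E"
        by (simp_all add: hom_on_inverse[OF \<sigma> E] subfield_inverse[OF E])
      then show ?thesis by (rule image_eqI)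
    qed
    fix x y assume "x \<in> \<sigma> ` E" "y \<in> \<sigma> ` E"
    then obtain a b where ab: "x = \<sigma> a" "y = \<sigma> b" "a \<in> E" "b \<in> E" by blast
    then have "x * y = \<sigma> (a * b)" "a * b \<in> E"
      by (simp_all add: hom_on_mult[OF \<sigma>] subring_mult[OF R])
    then show "x * y \<in> \<sigma> ` E" by (rule image_eqI)
    have "x + y = \<sigma> (a + b)" "a + b \<in> E"
      using ab by (simp_all add: hom_on_add[OF \<sigma>] subring_add[OF R])
    then show "x + y \<in> \<sigma> ` E" by (rule image_eqI)
  qed
qed


section \<open>Polynomials with coefficients in a subring\<close>

text \<open>Polynomials keep the type of the ambient field and only their coefficients are confined.
  The set may also be an ideal; membership then says that the polynomial vanishes modulo it.\<close>

definition polys_over :: "'a::zero set \<Rightarrow> 'a poly set"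
  where "polys_over A = {f. \<forall>i. coeff f i \<in> A}"

lemma polys_overI: "(\<And>i. coeff f i \<in> A) \<Longrightarrow> f \<in> polys_over A"
  and polys_overD: "f \<in> polys_over A \<Longrightarrow> coeff f i \<in> A"
  by (auto simp: polys_over_def)

context
  fixes A :: "'a::field set"
  assumes A: "subring A \<Omega>"
begin

lemma polys_over_zero: "0 \<in> polys_over A"
  and polys_over_one: "1 \<in> polys_over A"
  and polys_over_uminus: "f \<in> polys_over A \<Longrightarrow> - f \<in> polys_over A"
  and polys_over_add: "f \<in> polys_over A \<Longrightarrow> g \<in> polys_over A \<Longrightarrow> f + g \<in> polys_over A"
  and polys_over_diff: "f \<in> polys_over A \<Longrightarrow> g \<in> polys_over A \<Longrightarrow> f - g \<in> polys_over A"
  and polys_over_mult: "f \<in> polys_over A \<Longrightarrow> g \<in> polys_over A \<Longrightarrow> f * g \<in> polys_over A"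
  and polys_over_monom: "c \<in> A \<Longrightarrow> monom c k \<in> polys_over A"
  and polys_over_smult: "c \<in> A \<Longrightarrow> f \<in> polys_over A \<Longrightarrow> Polynomial.smult c f \<in> polys_over A"
  and polys_over_const: "c \<in> A \<Longrightarrow> [:c:] \<in> polys_over A"
  and polys_over_linear: "c \<in> A \<Longrightarrow> [:c, 1:] \<in> polys_over A"
  by (auto simp: polys_over_def coeff_mult coeff_1 coeff_pCons subring_closed[OF A] split: nat.split)

lemma polys_over_sum: "(\<And>i. i \<in> I \<Longrightarrow> g i \<in> polys_over A) \<Longrightarrow> sum g I \<in> polys_over A"
  by (induction I rule: infinite_finite_induct) (auto simp: polys_over_zero polys_over_add)

lemma polys_over_prod: "(\<And>i. i \<in> I \<Longrightarrow> g i \<in> polys_over A) \<Longrightarrow> prod g I \<in> polys_over A"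
  by (induction I rule: infinite_finite_induct) (auto simp: polys_over_one polys_over_mult)

lemma polys_over_power: "f \<in> polys_over A \<Longrightarrow> f ^ k \<in> polys_over A"
  by (induction k) (auto simp: polys_over_one polys_over_mult)

lemma poly_in_subring: "f \<in> polys_over A \<Longrightarrow> x \<in> A \<Longrightarrow> poly f x \<in> A"
  unfolding poly_altdef by (intro subring_closed[OF A]) (auto dest: polys_overD)

section \<open>The ring \<open>A[y]\<close> as the set of polynomial values\<close>

lemma subring_poly_values: "subring ((\<lambda>g. poly g y) ` polys_over A) \<Omega>" (is "subring ?S \<Omega>")
proof (rule subringI_type)
  show "1 \<in> ?S" by (rule image_eqI[of _ _ 1]) (auto simp: polys_over_one)
  show "- x \<in> ?S" if x: "x \<in> ?S" for x
  proof -
    obtain g where "x = poly g y" "g \<in> polys_over A" using x by blast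
    then show ?thesis by (intro image_eqI[of _ _ "- g"]) (auto simp: polys_over_uminus)
  qed
  fix x z assume "x \<in> ?S" "z \<in> ?S"
  then obtain g h where gh: "x = poly g y" "g \<in> polys_over A" "z = poly h y" "h \<in> polys_over A"
    by blast
  show "x * z \<in> ?S"
    by (rule image_eqI[of _ _ "g * h"]) (use gh in \<open>auto simp: polys_over_mult\<close>)
  show "x + z \<in> ?S"
    by (rule image_eqI[of _ _ "g + h"]) (use gh in \<open>auto simp: polys_over_add\<close>)
qed

lemma poly_values_superset: "insert y A \<subseteq> (\<lambda>g. poly g y) ` polys_over A"
proof
  fix x assume "x \<in> insert y A"
  moreover have "y \<in> (\<lambda>g. poly g y) ` polys_over A"
    by (rule image_eqI[of _ _ "monom 1 1"])
       (auto simp: poly_monom intro!: polys_over_monom subring_one[OF A])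
  moreover have "x \<in> (\<lambda>g. poly g y) ` polys_over A" if "x \<in> A"
    by (rule image_eqI[of _ _ "[:x:]"]) (use that in \<open>auto simp: polys_over_const\<close>)
  ultimately show "x \<in> (\<lambda>g. poly g y) ` polys_over A" by blast
qed

lemma poly_values_least:
  assumes "subring B \<Omega>" "insert y A \<subseteq> B"
  shows "(\<lambda>g. poly g y) ` polys_over A \<subseteq> B"
proof
  fix x assume "x \<in> (\<lambda>g. poly g y) ` polys_over A"
  then obtain g where g: "x = poly g y" "g \<in> polys_over A" by blast
  have "g \<in> polys_over B" using g(2) assms(2) by (auto simp: polys_over_def)
  then show "x \<in> B"
    unfolding g(1) poly_altdef using assms(2) by (intro subring_closed[OF assms(1)] polys_overD) auto
qed

text \<open>A monic divisor never forces a division of coefficients, so quotient and remainder stay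
  over the subring. The zero remainder is listed apart because 0 has degree 0.\<close>

lemma monic_division:
  assumes "g \<in> polys_over A" "lead_coeff g = 1" "f \<in> polys_over A"
  shows "\<exists>a\<in>polys_over A. \<exists>b\<in>polys_over A. f = a * g + b \<and> (b = 0 \<or> degree b < degree g)"
  using assms(3)
proof (induction "degree f" arbitrary: f rule: less_induct)
  case less
  show ?case
  proof (cases "f = 0 \<or> degree f < degree g")
    case True
    with less.prems show ?thesis
      by (intro bexI[of _ 0] bexI[of _ f]) (auto simp: polys_over_zero)
  next
    case False
    define h where "h = monom (lead_coeff f) (degree f - degree g)"
    define f' where "f' = f - h * g"
    have h: "h \<in> polys_over A"
      unfolding h_def by (intro polys_over_monom polys_overD[OF less.prems])
    have f': "f' \<in> polys_over A"
      unfolding f'_def by (intro polys_over_diff polys_over_mult less.prems h assms(1))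
    have g0: "g \<noteq> 0" using assms(2) by auto
    have hd: "degree (h * g) = degree f" "coeff (h * g) (degree f) = lead_coeff f"
    proof -
      have h0: "h \<noteq> 0" "degree h = degree f - degree g"
        using False by (auto simp: h_def degree_monom_eq)
      then show d: "degree (h * g) = degree f" using False g0 by (simp add: degree_mult_eq)
      have "lead_coeff h = lead_coeff f" unfolding h0(2) by (simp add: h_def)
      then show "coeff (h * g) (degree f) = lead_coeff f"
        using lead_coeff_mult[of h g] d assms(2) by simp
    qed
    have "f' = 0 \<or> degree f' < degree f"
    \<comment> \<open>For constants the degree cannot drop further; there the difference
      \<open>f'\<close> is zero.\<close>
    proof (cases "degree f = 0")
      case True
      have "degree f' = 0" using True hd(1) degree_diff_le[of f 0 "h * g"] by (simp add: f'_def)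
      moreover have "coeff f' 0 = 0" using True hd(2) by (simp add: f'_def)
      ultimately show ?thesis by (metis leading_coeff_0_iff)
    next
      case False
      then have "degree f' < degree f"
        using hd degree_diff_le[of f "degree f" "h * g"] eq_zero_or_degree_less[of f' "degree f"]
        by (auto simp: f'_def)
      then show ?thesis ..
    qed
    then obtain a b where ab: "a \<in> polys_over A" "b \<in> polys_over A" "f' = a * g + b"
      "b = 0 \<or> degree b < degree g"
      using less.hyps[OF _ f'] polys_over_zero by (metis add.right_neutral mult_zero_left)
    show ?thesis
      by (intro bexI[of _ "a + h"] bexI[of _ b])
         (use ab h in \<open>auto simp: f'_def algebra_simps polys_over_add\<close>)
  qed
qed

end

lemma map_poly_polys_over:
  assumes "\<sigma> 0 = 0" "\<And>x. x \<in> A \<Longrightarrow> \<sigma> x \<in> B" "f \<in> polys_over A"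
  shows "map_poly \<sigma> f \<in> polys_over B"
  using assms by (auto simp: polys_over_def coeff_map_poly)

context
  fixes A :: "'a::field set" and \<sigma>
  assumes A: "subring A \<Omega>" and \<sigma>: "hom_on A \<sigma>"
begin

lemma map_poly_one: "map_poly \<sigma> 1 = 1"
  by (rule poly_eqI) (auto simp: coeff_map_poly hom_on_zero[OF \<sigma> A] hom_on_one[OF \<sigma>] coeff_1)

lemma map_poly_add:
  "f \<in> polys_over A \<Longrightarrow> g \<in> polys_over A \<Longrightarrow> map_poly \<sigma> (f + g) = map_poly \<sigma> f + map_poly \<sigma> g"
  by (rule poly_eqI)
     (auto simp: coeff_map_poly hom_on_zero[OF \<sigma> A] polys_overD hom_on_add[OF \<sigma>])

lemma map_poly_uminus: "f \<in> polys_over A \<Longrightarrow> map_poly \<sigma> (- f) = - map_poly \<sigma> f"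
  by (rule poly_eqI)
     (auto simp: coeff_map_poly hom_on_zero[OF \<sigma> A] polys_overD hom_on_uminus[OF \<sigma> A])

lemma map_poly_mult:
  assumes "f \<in> polys_over A" "g \<in> polys_over A"
  shows "map_poly \<sigma> (f * g) = map_poly \<sigma> f * map_poly \<sigma> g"
proof (rule poly_eqI)
  fix k
  have "\<sigma> (\<Sum>i\<le>k. coeff f i * coeff g (k - i)) = (\<Sum>i\<le>k. \<sigma> (coeff f i * coeff g (k - i)))"
    by (intro hom_on_sum[OF \<sigma> A] subring_mult[OF A] polys_overD assms)
  then show "coeff (map_poly \<sigma> (f * g)) k = coeff (map_poly \<sigma> f * map_poly \<sigma> g) k"
    by (simp add: coeff_map_poly hom_on_zero[OF \<sigma> A] coeff_mult hom_on_mult[OF \<sigma>] polys_overD assms)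
qed

lemma map_poly_sum:
  "(\<And>i. i \<in> I \<Longrightarrow> g i \<in> polys_over A) \<Longrightarrow> map_poly \<sigma> (sum g I) = (\<Sum>i\<in>I. map_poly \<sigma> (g i))"
  by (induction I rule: infinite_finite_induct)
     (auto simp: map_poly_add polys_over_sum[OF A])

lemma map_poly_prod:
  "(\<And>i. i \<in> I \<Longrightarrow> g i \<in> polys_over A) \<Longrightarrow> map_poly \<sigma> (prod g I) = (\<Prod>i\<in>I. map_poly \<sigma> (g i))"
  by (induction I rule: infinite_finite_induct)
     (auto simp: map_poly_one map_poly_mult polys_over_prod[OF A])

lemma poly_map_poly:
  assumes f: "f \<in> polys_over A" and x: "x \<in> A"
  shows "\<sigma> (poly f x) = poly (map_poly \<sigma> f) (\<sigma> x)"
proof -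
  have "\<sigma> (poly f x) = (\<Sum>i\<le>degree f. \<sigma> (coeff f i) * \<sigma> x ^ i)"
    unfolding poly_altdef
    by (subst hom_on_sum[OF \<sigma> A])
       (auto simp: f x polys_overD hom_on_mult[OF \<sigma>] hom_on_power[OF \<sigma> A] subring_closed[OF A])
  also have "\<dots> = (\<Sum>i\<le>degree f. coeff (map_poly \<sigma> f) i * \<sigma> x ^ i)"
    by (simp add: coeff_map_poly hom_on_zero[OF \<sigma> A])
  also have "\<dots> = poly (map_poly \<sigma> f) (\<sigma> x)"
    unfolding poly_altdef
    by (rule sum.mono_neutral_right) (auto simp: coeff_eq_0 map_poly_degree_leq)
  finally show ?thesis .
qed

lemma map_poly_id:
  assumes "\<And>x. x \<in> A \<Longrightarrow> \<sigma> x = x" "f \<in> polys_over A" shows "map_poly \<sigma> f = f"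
  by (rule poly_eqI) (use assms in \<open>auto simp: coeff_map_poly hom_on_zero[OF \<sigma> A] polys_overD\<close>)

end

text \<open>A root of multiplicity at least two is also a root of the derivative, so the multiset of
  roots is a set.\<close>

lemma simple_roots_factorization:
  fixes f :: "'a::alg_closed_field poly"
  assumes "f \<noteq> 0" and simple: "\<And>x. poly f x = 0 \<Longrightarrow> poly (pderiv f) x \<noteq> 0"
  shows "card {x. poly f x = 0} = degree f"
    and "f = Polynomial.smult (lead_coeff f) (\<Prod>a | poly f a = 0. [:- a, 1:])"
proof -
  obtain A where A: "size A = degree f"
    "f = Polynomial.smult (lead_coeff f) (\<Prod>x\<in>#A. [:- x, 1:])"
    using alg_closed_imp_factorization[OF assms(1)] by auto
  have lc: "lead_coeff f \<noteq> 0" using assms(1) by simp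
  have roots: "{x. poly f x = 0} = set_mset A"
    by (subst A(2)) (use lc in \<open>auto simp: poly_prod_mset image_iff\<close>)
  have cnt: "count A x = 1" if x: "x \<in># A" for x
  proof (rule ccontr)
    assume "count A x \<noteq> 1"
    moreover have "count A x > 0" using x by (simp only: count_greater_zero_iff)
    ultimately have "count A x > 1" by linarith
    then have "x \<in># A - {#x#}" by (simp add: in_diff_count)
    then obtain A' where "A = add_mset x (add_mset x A')"
      using x by (metis insert_DiffM)
    then have "f = [:- x, 1:] * ([:- x, 1:] *
        Polynomial.smult (lead_coeff f) (\<Prod>x\<in>#A'. [:- x, 1:]))"
      by (subst A(2)) (simp only: prod_mset.add_mset image_mset_add_mset mult_smult_right)
    then obtain g where g: "f = [:- x, 1:] * ([:- x, 1:] * g)" by blast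
    then have "poly f x = 0" "poly (pderiv f) x = 0"
      by (simp_all only: pderiv_mult) (simp_all add: pderiv_pCons)
    with simple show False by blast
  qed
  have A_set: "A = mset_set (set_mset A)"
  proof (rule multiset_eqI)
    show "count A x = count (mset_set (set_mset A)) x" for x
      using cnt[of x] by (cases "x \<in># A") (simp_all add: count_eq_zero_iff)
  qed
  show "card {x. poly f x = 0} = degree f"
    unfolding roots A(1)[symmetric] by (subst (2) A_set) simp
  show "f = Polynomial.smult (lead_coeff f) (\<Prod>a | poly f a = 0. [:- a, 1:])"
    unfolding roots prod_unfold_prod_mset A_set[symmetric] by (rule A(2))
qed

section \<open>Powers of the characteristic and finite fields\<close>

text \<open>The type argument carries the characteristic. The positive exponent makes
  \<open>N\<close> greater than 1 and zero in the field.\<close>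

definition char_power :: "'a::alg_closed_field itself \<Rightarrow> nat \<Rightarrow> bool"
  where "char_power _ N \<longleftrightarrow> prime CHAR('a) \<and> (\<exists>k\<ge>1. N = CHAR('a) ^ k)"

lemma iterated_power_fixed:
  fixes x :: "'a::monoid_mult"
  assumes "x ^ N = x" shows "x ^ (N ^ j) = x"
  by (induction j) (auto simp: power_mult assms mult.commute)

lemma char_power_power: "char_power TYPE('a::alg_closed_field) N \<Longrightarrow> j \<ge> 1 \<Longrightarrow> char_power TYPE('a) (N ^ j)"
  unfolding char_power_def
  by (metis One_nat_def Suc_leI mult_pos_pos power_mult less_le_trans zero_less_one)

context
  fixes N :: nat
  assumes N: "char_power TYPE('a::alg_closed_field) N"
begin

lemma char_power_gt_1: "N > 1"
  using N unfolding char_power_def by (metis One_nat_def Suc_le_lessD one_less_power prime_gt_1_nat)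

lemma of_nat_char_power: "of_nat N = (0 :: 'a)"
  using N unfolding char_power_def by auto

lemma char_power_add: "(x + y :: 'a) ^ N = x ^ N + y ^ N"
  using N unfolding char_power_def by (auto intro: freshmans_dream')

lemma hom_on_char_power: "hom_on A (\<lambda>x :: 'a. x ^ N)"
  by (auto simp: hom_on_iff char_power_add power_mult_distrib)

lemma char_power_uminus: "(- x :: 'a) ^ N = - (x ^ N)"
proof -
  have "(- x) ^ N + x ^ N = 0"
    using char_power_add[of "- x" x] char_power_gt_1 by (simp add: zero_power)
  then show ?thesis by (simp add: eq_neg_iff_add_eq_0)
qed

lemma char_power_diff: "(x - y :: 'a) ^ N = x ^ N - y ^ N"
  using char_power_add[of x "- y"] char_power_uminus[of y] by simp

lemma char_power_inj: "(x :: 'a) ^ N = y ^ N \<Longrightarrow> x = y"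
  using char_power_diff[of x y] by simp

lemma subfield_GF: "subfield (GF N :: 'a set) \<Omega>"
  by (rule subfieldI_type)
     (auto simp: GF_def char_power_add char_power_uminus power_mult_distrib power_inverse)

lemma subring_GF: "subring (GF N :: 'a set) \<Omega>"
  by (rule subfield_subring[OF subfield_GF])

lemma GF_poly:
  defines "g \<equiv> monom 1 N - monom 1 1 :: 'a poly"
  shows "degree g = N" "lead_coeff g = 1" "poly g x = x ^ N - x" "pderiv g = - 1"
proof -
  note N1 = char_power_gt_1
  have "degree g \<le> N"
    unfolding g_def by (rule degree_diff_le) (use N1 in \<open>auto simp: degree_monom_eq\<close>)
  moreover have c: "coeff g N = 1" using N1 by (simp add: g_def)
  ultimately show d: "degree g = N" by (metis le_antisym le_degree one_neq_zero)
  show "lead_coeff g = 1" using c d by simp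
  show "poly g x = x ^ N - x" by (simp add: g_def poly_monom)
  show "pderiv g = - 1"
    by (simp add: g_def pderiv_diff pderiv_monom of_nat_char_power flip: one_pCons)
qed

text \<open>The polynomial \<open>X ^ N - X\<close> has derivative \<open>-1\<close>, so it has
  \<open>N\<close> distinct roots; all three claims are read off from this.\<close>

lemma GF_factorization: "(x :: 'a) ^ N - x = (\<Prod>c\<in>GF N. x - c)"
  and card_GF: "card (GF N :: 'a set) = N"
  and finite_GF: "finite (GF N :: 'a set)"
proof -
  define g where "g = (monom 1 N - monom 1 1 :: 'a poly)"
  note gp = GF_poly[folded g_def]
  have g0: "g \<noteq> 0" using gp(2) by auto
  have roots: "{x. poly g x = 0} = GF N" using gp(3) by (auto simp: GF_def)
  have fac: "card {x. poly g x = 0} = degree g"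
    "g = Polynomial.smult (lead_coeff g) (\<Prod>a | poly g a = 0. [:- a, 1:])"
    by (rule simple_roots_factorization[OF g0]; simp add: gp(4))+
  show c: "card (GF N :: 'a set) = N" using fac(1) gp(1) roots by simp
  show "finite (GF N :: 'a set)"
    using c char_power_gt_1 by (metis card.infinite not_one_less_zero)
  have "poly g x = (\<Prod>c\<in>GF N. x - c)"
    by (subst fac(2), subst gp(2)) (simp add: roots poly_prod)
  then show "x ^ N - x = (\<Prod>c\<in>GF N. x - c)" using gp(3) by simp
qed

lemma GF_power_mono: "GF N \<subseteq> (GF (N ^ j) :: 'a set)"
  by (auto simp: GF_def iterated_power_fixed)

end


section \<open>Simple extensions and extension of homomorphisms\<close>

text \<open>Least degree takes the place of irreducibility: divisibility and inverses in the simple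
  extension follow from it by division with remainder.\<close>

definition is_minpoly :: "'a::field set \<Rightarrow> 'a \<Rightarrow> 'a poly \<Rightarrow> bool"
  where "is_minpoly E v f \<longleftrightarrow> f \<in> polys_over E \<and> lead_coeff f = 1 \<and> poly f v = 0 \<and>
    (\<forall>g\<in>polys_over E. g \<noteq> 0 \<longrightarrow> poly g v = 0 \<longrightarrow> degree f \<le> degree g)"

lemma ex_minpoly:
  fixes E :: "'a::field set"
  assumes E: "subfield E \<Omega>" and g: "g \<in> polys_over E" "g \<noteq> 0" "poly g v = 0"
  obtains f where "is_minpoly E v f"
proof -
  let ?P = "\<lambda>g. g \<in> polys_over E \<and> g \<noteq> 0 \<and> poly g v = 0"
  obtain h where h: "?P h" "\<And>g. ?P g \<Longrightarrow> degree h \<le> degree g"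
    using ex_has_least_nat[of ?P g degree] g by blast
  define f where "f = Polynomial.smult (inverse (lead_coeff h)) h"
  have "is_minpoly E v f"
    unfolding is_minpoly_def f_def using h
    by (auto intro!: polys_over_smult[OF subfield_subring[OF E]] subfield_inverse[OF E] polys_overD)
  then show ?thesis ..
qed

context
  fixes E :: "'a::field set" and v f
  assumes E: "subfield E \<Omega>" and f: "is_minpoly E v f"
begin

lemma minpolyD:
  "f \<in> polys_over E" "lead_coeff f = 1" "poly f v = 0" "f \<noteq> 0"
  "g \<in> polys_over E \<Longrightarrow> poly g v = 0 \<Longrightarrow> g \<noteq> 0 \<Longrightarrow> degree f \<le> degree g"
  using f unfolding is_minpoly_def by auto

lemma degree_minpoly_pos: "degree f > 0"
proof (rule ccontr)
  assume "\<not> degree f > 0"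
  then have "degree f = 0" by simp
  then obtain c where "f = [:c:]" by (metis degree_eq_zeroE)
  then show False using minpolyD(2,3) by auto
qed

lemma minpoly_dvd:
  assumes "g \<in> polys_over E" "poly g v = 0"
  obtains h where "h \<in> polys_over E" "g = h * f"
proof -
  obtain a b where ab: "a \<in> polys_over E" "b \<in> polys_over E" "g = a * f + b"
    "b = 0 \<or> degree b < degree f"
    using monic_division[OF subfield_subring[OF E] minpolyD(1,2) assms(1)] by blast
  have "poly b v = 0" using assms(2) ab(3) minpolyD(3) by simp
  then have "b = 0" using ab(2,4) minpolyD(5)[of b] by (metis linorder_not_le)
  with ab show ?thesis by (intro that[of a]) auto
qed

lemma simple_extension_rep:
  assumes "g \<in> polys_over E"
  obtains h where "h \<in> polys_over E" "poly h v = poly g v" "degree h < degree f"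
proof -
  obtain a b where ab: "a \<in> polys_over E" "b \<in> polys_over E" "g = a * f + b"
    "b = 0 \<or> degree b < degree f"
    using monic_division[OF subfield_subring[OF E] minpolyD(1,2) assms] by blast
  show ?thesis
    by (rule that[of b]) (use ab minpolyD(3) degree_minpoly_pos in auto)
qed

text \<open>Euclid's algorithm: divide \<open>f\<close> by the monic multiple \<open>g'\<close> of
  \<open>g\<close>. The remainder has value \<open>- a(v) g'(v)\<close> at \<open>v\<close>. If this
  is non-zero, induction inverts it. If it is zero, then \<open>b = 0\<close>, and \<open>a\<close>
  would vanish at \<open>v\<close> in a degree below the minimal one.\<close>

lemma simple_extension_inverse:
  assumes "g \<in> polys_over E" "degree g < degree f" "poly g v \<noteq> 0"
  shows "\<exists>h\<in>polys_over E. poly h v * poly g v = 1"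
  using assms
proof (induction "degree g" arbitrary: g rule: less_induct)
  case less
  note R = subfield_subring[OF E]
  have g0: "g \<noteq> 0" using less.prems by auto
  define c where "c = inverse (lead_coeff g)"
  have c: "c \<in> E" "c \<noteq> 0"
    unfolding c_def using g0 less.prems(1) by (auto intro: subfield_inverse[OF E] polys_overD)
  define g' where "g' = Polynomial.smult c g"
  have g': "g' \<in> polys_over E" "lead_coeff g' = 1" "degree g' = degree g" "poly g' v \<noteq> 0"
    unfolding g'_def using c g0 less.prems by (auto intro: polys_over_smult[OF R] simp: c_def)
  have "\<exists>h\<in>polys_over E. poly h v * poly g' v = 1"
  proof (cases "degree g = 0")
    case True
    then have "g' = 1" using g'(2,3) by (metis degree_eq_zeroE degree_pCons_0 coeff_pCons_0 one_pCons)
    then show ?thesis by (intro bexI[of _ 1]) (auto simp: polys_over_one[OF R])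
  next
    case False
    obtain a b where ab: "a \<in> polys_over E" "b \<in> polys_over E" "f = a * g' + b"
      "b = 0 \<or> degree b < degree g'"
      using monic_division[OF R g'(1,2) minpolyD(1)] by blast
    have bv: "poly b v = - (poly a v * poly g' v)"
      using ab(3) minpolyD(3) by (simp add: eq_neg_iff_add_eq_0 add.commute)
    show ?thesis
    proof (cases "poly b v = 0")
      case True
      have b0: "b = 0"
        using minpolyD(5)[OF ab(2) True] ab(4) g'(3) less.prems(2) by fastforce
      then have "f = a * g'" using ab(3) by simp
      moreover have "a \<noteq> 0" "g' \<noteq> 0" using calculation minpolyD(4) by auto
      ultimately have "degree a < degree f" using g'(3) False by (simp add: degree_mult_eq)
      moreover have "poly a v = 0" using bv True g'(4) by auto
      ultimately show ?thesis using minpolyD(5)[OF ab(1)] \<open>a \<noteq> 0\<close> by auto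
    next
      case bv0: False
      have "b \<noteq> 0" using bv0 by auto
      then have "degree b < degree g" using ab(4) g'(3) by auto
      then obtain h where h: "h \<in> polys_over E" "poly h v * poly b v = 1"
        using less.hyps[of b] ab(2) less.prems(2) bv0 by auto
      show ?thesis
        by (rule bexI[of _ "- (h * a)"])
           (use h bv in \<open>auto simp: mult.assoc intro!: polys_over_uminus[OF R] polys_over_mult[OF R] ab\<close>)
    qed
  qed
  then obtain h where "h \<in> polys_over E" "poly h v * poly g' v = 1" by blast
  then show ?case
    by (intro bexI[of _ "Polynomial.smult c h"])
       (auto simp: g'_def mult_ac intro: polys_over_smult[OF R] c)
qed

lemma simple_extension:
  "generate_field \<Omega> (insert v E) = (\<lambda>g. poly g v) ` polys_over E" (is "_ = ?S")
proof
  note R = subfield_subring[OF E]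
  have "subfield ?S \<Omega>"
  proof (rule subfieldI_type)
    show "inverse x \<in> ?S" if x: "x \<in> ?S" "x \<noteq> 0" for x
    proof -
      obtain g where g: "x = poly g v" "g \<in> polys_over E" using x by blast
      obtain h where h: "h \<in> polys_over E" "poly h v = poly g v" "degree h < degree f"
        by (rule simple_extension_rep[OF g(2)])
      have "poly h v \<noteq> 0" using h(2) g(1) x(2) by simp
      then obtain k where k: "k \<in> polys_over E" "poly k v * poly h v = 1"
        using simple_extension_inverse[OF h(1,3)] by blast
      have "inverse x = poly k v"
        using k(2) h(2) g(1) by (metis inverse_unique mult.commute)
      then show ?thesis using k(1) by (rule image_eqI)
    qed
  qed (use subring_closed[OF subring_poly_values[OF R]] in auto)
  then show "generate_field \<Omega> (insert v E) \<subseteq> ?S"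
    using poly_values_superset[OF R] by (rule generate_field_least)
  show "?S \<subseteq> generate_field \<Omega> (insert v E)"
    by (rule poly_values_least[OF R subfield_subring[OF subfield_generate_field] generate_field_superset])
qed

text \<open>An element \<open>poly g v\<close> is sent to the value of the transported polynomial at
  \<open>v'\<close>. Two choices of \<open>g\<close> differ by a multiple of the minimal polynomial,
  which is transported to a multiple of a polynomial vanishing at \<open>v'\<close>. The last
  conclusion is what evaluates automorphisms in \<open>fixed_in_adjoin\<close>.\<close>

lemma extend_hom_simple:
  assumes \<tau>: "hom_on E \<tau>" and v': "poly (map_poly \<tau> f) v' = 0"
  obtains \<tau>' where "hom_on (generate_field \<Omega> (insert v E)) \<tau>'" "\<And>x. x \<in> E \<Longrightarrow> \<tau>' x = \<tau> x" "\<tau>' v = v'"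
    "\<And>g. g \<in> polys_over E \<Longrightarrow> \<tau>' (poly g v) = poly (map_poly \<tau> g) v'"
proof -
  note R = subfield_subring[OF E]
  define \<tau>' where "\<tau>' x = poly (map_poly \<tau> (SOME g. g \<in> polys_over E \<and> poly g v = x)) v'" for x
  have wd: "poly (map_poly \<tau> g) v' = poly (map_poly \<tau> h) v'"
    if gh: "g \<in> polys_over E" "h \<in> polys_over E" "poly g v = poly h v" for g h
  proof -
    obtain a where a: "a \<in> polys_over E" "g - h = a * f"
      using minpoly_dvd[of "g - h"] gh polys_over_diff[OF R] by auto
    then have "g = h + a * f" by (simp add: algebra_simps)
    then show ?thesis
      using a gh v' minpolyD(1)
      by (simp add: map_poly_add[OF R \<tau>] map_poly_mult[OF R \<tau>] polys_over_mult[OF R])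
  qed
  have val: "\<tau>' (poly g v) = poly (map_poly \<tau> g) v'" if g: "g \<in> polys_over E" for g
  proof -
    have "\<exists>h. h \<in> polys_over E \<and> poly h v = poly g v" using g by blast
    from someI_ex[OF this] show ?thesis unfolding \<tau>'_def by (intro wd) (use g in auto)
  qed
  have const: "\<tau>' x = \<tau> x" if "x \<in> E" for x
  proof -
    have "map_poly \<tau> [:x:] = [:\<tau> x:]"
      by (rule poly_eqI) (auto simp: coeff_map_poly hom_on_zero[OF \<tau> R] coeff_pCons split: nat.split)
    then show ?thesis using val[of "[:x:]"] polys_over_const[OF R that] by simp
  qed
  have var: "\<tau>' v = v'"
  proof -
    have "map_poly \<tau> (monom 1 1) = monom 1 1"
      by (rule poly_eqI) (auto simp: coeff_map_poly hom_on_zero[OF \<tau> R] hom_on_one[OF \<tau>])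
    then show ?thesis
      using val[of "monom 1 1"] polys_over_monom[OF R subring_one[OF R]] by (simp add: poly_monom)
  qed
  have "hom_on (generate_field \<Omega> (insert v E)) \<tau>'"
    unfolding simple_extension hom_on_iff
  proof (intro conjI ballI)
    show "\<tau>' 1 = 1" using const[OF subring_one[OF R]] hom_on_one[OF \<tau>] by simp
    fix x y assume "x \<in> (\<lambda>g. poly g v) ` polys_over E" "y \<in> (\<lambda>g. poly g v) ` polys_over E"
    then obtain g h where gh: "x = poly g v" "g \<in> polys_over E" "y = poly h v" "h \<in> polys_over E"
      by blast
    show "\<tau>' (x + y) = \<tau>' x + \<tau>' y"
      using val[OF polys_over_add[OF R gh(2,4)]] val[OF gh(2)] val[OF gh(4)] gh(1,3)
      by (simp add: map_poly_add[OF R \<tau> gh(2,4)])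
    show "\<tau>' (x * y) = \<tau>' x * \<tau>' y"
      using val[OF polys_over_mult[OF R gh(2,4)]] val[OF gh(2)] val[OF gh(4)] gh(1,3)
      by (simp add: map_poly_mult[OF R \<tau> gh(2,4)])
  qed
  from that[OF this const var val] show ?thesis .
qed

end

section \<open>Galois groups of separable splitting fields\<close>

lemma generate_field_subfield: "subfield E \<Omega> \<Longrightarrow> generate_field \<Omega> E = (E :: 'a::field set)"
  using generate_field_least[of E E] generate_field_superset[of E] by blast

lemma generate_field_mono:
  assumes "S \<subseteq> T" shows "generate_field \<Omega> S \<subseteq> (generate_field \<Omega> T :: 'a::field set)"
  by (rule generate_field_least[OF subfield_generate_field])
     (use assms generate_field_superset[of T] in blast)

lemma generate_field_generate_field_Un:
  "generate_field \<Omega> (generate_field \<Omega> S \<union> T) = generate_field \<Omega> (S \<union> T :: 'a::field set)"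
proof
  show "generate_field \<Omega> (generate_field \<Omega> S \<union> T) \<subseteq> generate_field \<Omega> (S \<union> T)"
    by (rule generate_field_least[OF subfield_generate_field])
       (use generate_field_mono[of S "S \<union> T"] generate_field_superset[of "S \<union> T"] in auto)
  show "generate_field \<Omega> (S \<union> T) \<subseteq> generate_field \<Omega> (generate_field \<Omega> S \<union> T)"
    by (rule generate_field_mono) (use generate_field_superset[of S] in auto)
qed

lemma carrier_Gal_iff:
  "\<sigma> \<in> carrier (Gal L K) \<longleftrightarrow>
    hom_on L \<sigma> \<and> bij_betw \<sigma> L L \<and> (\<forall>x\<in>K. \<sigma> x = x) \<and> (\<forall>x. x \<notin> L \<longrightarrow> \<sigma> x = x)"
proof -
  have "\<sigma> \<in> ring_iso (\<Omega>|(L)) (\<Omega>|(L)) \<longleftrightarrow> hom_on L \<sigma> \<and> bij_betw \<sigma> L L"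
    by (auto simp: ring_iso_def ring_hom_def bij_betw_def)
  then show ?thesis by (auto simp: Gal_def)
qed

lemma id_in_Gal: "id \<in> carrier (Gal L K)"
  by (auto simp: carrier_Gal_iff hom_on_iff)

lemma comp_in_Gal:
  assumes "\<sigma> \<in> carrier (Gal L K)" "\<tau> \<in> carrier (Gal L K)"
  shows "\<sigma> \<circ> \<tau> \<in> carrier (Gal L K)"
proof -
  have \<sigma>: "hom_on L \<sigma>" "bij_betw \<sigma> L L" and \<tau>: "hom_on L \<tau>" "bij_betw \<tau> L L"
    using assms by (auto simp: carrier_Gal_iff)
  have "\<tau> x \<in> L" if "x \<in> L" for x using bij_betwE[OF \<tau>(2)] that by blast
  then have "hom_on L (\<sigma> \<circ> \<tau>)"
    using \<sigma>(1) \<tau>(1) by (auto simp: hom_on_iff)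
  then show ?thesis
    using bij_betw_trans[OF \<tau>(2) \<sigma>(2)] assms by (auto simp: carrier_Gal_iff)
qed

lemma comp_Gal_cancel:
  assumes "\<tau> \<in> carrier (Gal L K)" "\<sigma> \<in> carrier (Gal L K)" "\<sigma>' \<in> carrier (Gal L K)"
    "\<tau> \<circ> \<sigma> = \<tau> \<circ> \<sigma>'"
  shows "\<sigma> = \<sigma>'"
proof
  fix x
  have \<tau>: "inj_on \<tau> L" using assms(1) by (auto simp: carrier_Gal_iff bij_betw_def)
  show "\<sigma> x = \<sigma>' x"
  proof (cases "x \<in> L")
    case True
    then have "\<sigma> x \<in> L" "\<sigma>' x \<in> L"
      using assms(2,3) by (auto simp: carrier_Gal_iff dest: bij_betwE)
    moreover have "\<tau> (\<sigma> x) = \<tau> (\<sigma>' x)" using fun_cong[OF assms(4), of x] by simp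
    ultimately show ?thesis using \<tau> by (auto dest: inj_onD)
  next
    case False
    then show ?thesis using assms(2,3) by (auto simp: carrier_Gal_iff)
  qed
qed

lemma Gal_mono: "K \<subseteq> K' \<Longrightarrow> carrier (Gal L K') \<subseteq> carrier (Gal L K)"
  unfolding carrier_Gal_iff subset_iff by blast

text \<open>Separability is stated through the derivative at the roots, a form inherited by every
  factor of \<open>f\<close> and in particular by minimal polynomials of its roots.\<close>

locale separable_splitting =
  fixes K :: "'a::alg_closed_field set" and f :: "'a poly"
  assumes K: "subfield K \<Omega>" and f: "f \<in> polys_over K" "f \<noteq> 0"
    and simple: "poly f x = 0 \<Longrightarrow> poly (pderiv f) x \<noteq> 0"
begin

definition V where "V = {x. poly f x = 0}"

definition L where "L = generate_field \<Omega> (K \<union> V)"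

lemma finite_V: "finite V"
  unfolding V_def using f(2) by (rule poly_roots_finite)

lemma L: "subfield L \<Omega>" and K_le_L: "K \<subseteq> L" and V_le_L: "V \<subseteq> L"
  using subfield_generate_field generate_field_superset[of "K \<union> V"] by (auto simp: L_def)

lemma hom_maps_V:
  assumes "hom_on L \<sigma>" "\<And>x. x \<in> K \<Longrightarrow> \<sigma> x = x" "v \<in> V"
  shows "\<sigma> v \<in> V"
proof -
  note R = subfield_subring[OF L] and RK = subfield_subring[OF K]
  have fL: "f \<in> polys_over L" using f(1) K_le_L by (auto simp: polys_over_def)
  have "poly (map_poly \<sigma> f) (\<sigma> v) = \<sigma> 0"
    using poly_map_poly[OF R assms(1) fL, of v] assms(3) V_le_L by (auto simp: V_def)
  moreover have "map_poly \<sigma> f = f"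
    by (rule map_poly_id[OF RK hom_on_subset[OF assms(1) K_le_L] assms(2) f(1)])
  ultimately show ?thesis using hom_on_zero[OF assms(1) R] by (simp add: V_def)
qed

lemma hom_image_V:
  assumes "hom_on L \<sigma>" "\<And>x. x \<in> K \<Longrightarrow> \<sigma> x = x"
  shows "\<sigma> ` V = V"
  by (rule endo_inj_surj[OF finite_V])
     (use hom_maps_V[OF assms] inj_on_subset[OF hom_on_inj[OF assms(1) L] V_le_L] in auto)

text \<open>Such a homomorphism permutes the finite set \<open>V\<close>, so its image is again
  generated by \<open>K\<close> and \<open>V\<close>. Hence it suffices to construct homomorphisms
  into the ambient field.\<close>

lemma restrict_in_Gal:
  assumes \<sigma>: "hom_on L \<sigma>" "\<And>x. x \<in> K \<Longrightarrow> \<sigma> x = x"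
  shows "(\<lambda>x. if x \<in> L then \<sigma> x else x) \<in> carrier (Gal L K)"
proof -
  note R = subfield_subring[OF L]
  have "\<sigma> ` L = L"
  proof
    show "\<sigma> ` L \<subseteq> L"
      using hom_on_image_generate_field[of \<sigma> "K \<union> V" L] \<sigma>(1) L K_le_L V_le_L
        hom_maps_V[OF \<sigma>] \<sigma>(2) by (fastforce simp flip: L_def)
    have "K \<subseteq> \<sigma> ` L" using \<sigma>(2) K_le_L by (metis image_eqI subset_iff)
    moreover have "V \<subseteq> \<sigma> ` L" using hom_image_V[OF \<sigma>] V_le_L by blast
    ultimately show "L \<subseteq> \<sigma> ` L"
      unfolding L_def
      by (intro generate_field_least subfield_image_hom subfield_generate_field)
         (use \<sigma>(1) in \<open>auto simp: L_def\<close>)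
  qed
  then have "bij_betw \<sigma> L L" using hom_on_inj[OF \<sigma>(1) L] by (simp add: bij_betw_def)
  moreover have "bij_betw (\<lambda>x. if x \<in> L then \<sigma> x else x) L L \<longleftrightarrow> bij_betw \<sigma> L L"
    by (rule bij_betw_cong) simp
  moreover have "hom_on L (\<lambda>x. if x \<in> L then \<sigma> x else x)"
    using \<sigma>(1) subring_closed[OF R] by (auto simp: hom_on_iff)
  ultimately show ?thesis using \<sigma>(2) K_le_L by (auto simp: carrier_Gal_iff)
qed

lemma GalD:
  assumes "\<sigma> \<in> carrier (Gal L K)"
  shows "hom_on L \<sigma>" "x \<in> K \<Longrightarrow> \<sigma> x = x" "x \<in> L \<Longrightarrow> \<sigma> x \<in> L" "v \<in> V \<Longrightarrow> \<sigma> v \<in> V" "\<sigma> ` V = V"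
  using assms hom_maps_V hom_image_V by (auto simp: carrier_Gal_iff dest: bij_betwE)

text \<open>An automorphism is determined by the permutation it induces on \<open>V\<close>.\<close>

lemma finite_Gal: "finite (carrier (Gal L K))"
proof (rule finite_imageD)
  let ?r = "\<lambda>\<sigma>. restrict \<sigma> V"
  have "?r ` carrier (Gal L K) \<subseteq> V \<rightarrow>\<^sub>E V"
    using GalD(4) by auto
  then show "finite (?r ` carrier (Gal L K))"
    by (rule finite_subset) (intro finite_PiE finite_V)
  show "inj_on ?r (carrier (Gal L K))"
  proof (rule inj_onI, rule ext)
    fix \<sigma> \<tau> x
    assume *: "\<sigma> \<in> carrier (Gal L K)" "\<tau> \<in> carrier (Gal L K)" "?r \<sigma> = ?r \<tau>"
    show "\<sigma> x = \<tau> x"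
    proof (cases "x \<in> L")
      case True
      have "\<sigma> v = \<tau> v" if "v \<in> K \<union> V" for v
        using that GalD(2)[OF *(1)] GalD(2)[OF *(2)] fun_cong[OF *(3), of v] by auto
      then show ?thesis
        using hom_on_eq_generate_field[of \<sigma> "K \<union> V" \<tau>] GalD(1)[OF *(1)] GalD(1)[OF *(2)] True
        by (auto simp flip: L_def)
    next
      case False
      with * show ?thesis by (auto simp: carrier_Gal_iff)
    qed
  qed
qed

lemma minpoly_divides_f:
  assumes E: "subfield E \<Omega>" "K \<subseteq> E" and w: "w \<in> V" and m: "is_minpoly E w m"
  obtains h where "h \<in> polys_over E" "f = h * m"
proof (rule minpoly_dvd[OF E(1) m])
  show "f \<in> polys_over E" using f(1) E(2) by (auto simp: polys_over_def)
  show "poly f w = 0" using w by (simp add: V_def)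
qed

text \<open>One root at a time: the transported minimal polynomial of \<open>w\<close> has a root
  because the ambient field is algebraically closed, and this root serves as the image of
  \<open>w\<close>.\<close>

lemma extend_hom:
  assumes W: "finite W" "W \<subseteq> V" and E: "subfield E \<Omega>" "K \<subseteq> E"
    and \<tau>: "hom_on E \<tau>" "\<And>x. x \<in> K \<Longrightarrow> \<tau> x = x"
  shows "\<exists>\<tau>'. hom_on (generate_field \<Omega> (E \<union> W)) \<tau>' \<and> (\<forall>x\<in>E. \<tau>' x = \<tau> x)"
  using W
proof (induction W rule: finite_induct)
  case empty
  show ?case using \<tau>(1) by (auto simp: generate_field_subfield[OF E(1)])
next
  case (insert w W)
  define E' where "E' = generate_field \<Omega> (E \<union> W)"
  obtain \<tau>1 where \<tau>1: "hom_on E' \<tau>1" "\<And>x. x \<in> E \<Longrightarrow> \<tau>1 x = \<tau> x"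
    using insert by (auto simp: E'_def)
  have E': "subfield E' \<Omega>" "E \<subseteq> E'"
    using subfield_generate_field generate_field_superset[of "E \<union> W"] by (auto simp: E'_def)
  note R' = subfield_subring[OF E'(1)]
  have fE': "f \<in> polys_over E'" using f(1) E(2) E'(2) by (auto simp: polys_over_def)
  have w: "w \<in> V" using insert by simp
  obtain m where m: "is_minpoly E' w m"
    using ex_minpoly[OF E'(1) fE' f(2)] w by (auto simp: V_def)
  note mp = minpolyD[OF E'(1) m]
  \<comment> \<open>Being monic, the minimal polynomial keeps its degree when transported, so its
    image is not constant.\<close>
  have "lead_coeff m = 1" by (fact mp(2))
  then have "degree (map_poly \<tau>1 m) = degree m"
    by (intro map_poly_degree_eq) (simp add: hom_on_one[OF \<tau>1(1)])
  then have "degree (map_poly \<tau>1 m) > 0" using degree_minpoly_pos[OF E'(1) m] by simp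
  then obtain v' where v': "poly (map_poly \<tau>1 m) v' = 0"
    using alg_closed_imp_poly_has_root by blast
  obtain \<tau>' where \<tau>': "hom_on (generate_field \<Omega> (Set.insert w E')) \<tau>'" "\<And>x. x \<in> E' \<Longrightarrow> \<tau>' x = \<tau>1 x"
    by (rule extend_hom_simple[OF E'(1) m \<tau>1(1) v']) blast
  have "generate_field \<Omega> (Set.insert w E') = generate_field \<Omega> (E \<union> Set.insert w W)"
    using generate_field_generate_field_Un[of "E \<union> W" "{w}"] by (simp add: E'_def Un_commute)
  then show ?case using \<tau>' \<tau>1(2) E'(2) by (intro exI[of _ \<tau>']) auto
qed

lemma extend_hom_to_Gal:
  assumes E: "subfield E \<Omega>" "K \<subseteq> E" "E \<subseteq> L"
    and \<tau>: "hom_on E \<tau>" "\<And>x. x \<in> K \<Longrightarrow> \<tau> x = x"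
  obtains \<sigma> where "\<sigma> \<in> carrier (Gal L K)" "\<And>x. x \<in> E \<Longrightarrow> \<sigma> x = \<tau> x"
proof -
  obtain \<tau>' where \<tau>': "hom_on (generate_field \<Omega> (E \<union> V)) \<tau>'" "\<And>x. x \<in> E \<Longrightarrow> \<tau>' x = \<tau> x"
    using extend_hom[OF finite_V order_refl E(1,2) \<tau>] by blast
  have "L \<subseteq> generate_field \<Omega> (E \<union> V)"
    unfolding L_def by (rule generate_field_mono) (use E(2) in auto)
  then have "hom_on L \<tau>'" using \<tau>'(1) by (rule hom_on_subset[rotated])
  moreover have "\<tau>' x = x" if "x \<in> K" for x using that \<tau>'(2) \<tau>(2) E(2) by auto
  ultimately have "(\<lambda>x. if x \<in> L then \<tau>' x else x) \<in> carrier (Gal L K)"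
    by (rule restrict_in_Gal)
  then show ?thesis by (rule that) (use \<tau>'(2) E(3) in auto)
qed

text \<open>Write \<open>x = g(w)\<close> with \<open>g\<close> over the previous field
  \<open>E\<close> and of degree below that of the minimal polynomial \<open>m\<close> of
  \<open>w\<close>. Sending \<open>w\<close> to any root of \<open>m\<close> extends to an
  automorphism, which fixes \<open>x\<close>; so \<open>g\<close> takes the value \<open>x\<close>
  at all roots of \<open>m\<close>. These are more than its degree allows, hence \<open>g\<close> is
  constant and \<open>x\<close> lies in \<open>E\<close>.\<close>

lemma fixed_in_adjoin:
  assumes x: "\<And>\<sigma>. \<sigma> \<in> carrier (Gal L K) \<Longrightarrow> \<sigma> x = x"
    and W: "finite W" "W \<subseteq> V" "x \<in> generate_field \<Omega> (K \<union> W)"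
  shows "x \<in> K"
  using W
proof (induction W rule: finite_induct)
  case empty
  then show ?case using generate_field_subfield[OF K] by simp
next
  case (insert w W)
  define E where "E = generate_field \<Omega> (K \<union> W)"
  have E: "subfield E \<Omega>" "K \<subseteq> E"
    using subfield_generate_field generate_field_superset[of "K \<union> W"] by (auto simp: E_def)
  have E_le_L: "E \<subseteq> L"
    unfolding E_def L_def by (rule generate_field_mono) (use insert in auto)
  note R = subfield_subring[OF E(1)]
  have fE: "f \<in> polys_over E" using f(1) E(2) by (auto simp: polys_over_def)
  have w: "w \<in> V" using insert by simp
  obtain m where m: "is_minpoly E w m"
    using ex_minpoly[OF E(1) fE f(2)] w by (auto simp: V_def)
  note mp = minpolyD[OF E(1) m]
  obtain h where h: "f = h * m" by (rule minpoly_divides_f[OF E w m])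
  have gen: "generate_field \<Omega> (Set.insert w E) = generate_field \<Omega> (K \<union> Set.insert w W)"
    using generate_field_generate_field_Un[of "K \<union> W" "{w}"] by (simp add: E_def Un_commute)
  have gen_L: "generate_field \<Omega> (Set.insert w E) \<subseteq> L"
    unfolding gen L_def by (rule generate_field_mono) (use insert in auto)
  have "x \<in> (\<lambda>g. poly g w) ` polys_over E"
    using insert.prems(2) unfolding gen[symmetric] simple_extension[OF E(1) m] .
  then obtain g0 where g0: "g0 \<in> polys_over E" "x = poly g0 w" by blast
  obtain g where g: "g \<in> polys_over E" "poly g w = poly g0 w" "degree g < degree m"
    by (rule simple_extension_rep[OF E(1) m g0(1)])
  have id: "hom_on E id" by (auto simp: hom_on_iff)
  have root: "poly g v' = x" if v': "poly m v' = 0" for v'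
  proof -
    have mid: "map_poly id k = k" for k :: "'a poly" by (simp add: map_poly_idI)
    have "poly (map_poly id m) v' = 0" using v' mid by simp
    then obtain \<tau> where \<tau>: "hom_on (generate_field \<Omega> (Set.insert w E)) \<tau>"
      "\<And>x. x \<in> E \<Longrightarrow> \<tau> x = id x" "\<tau> w = v'"
      "\<And>g. g \<in> polys_over E \<Longrightarrow> \<tau> (poly g w) = poly (map_poly id g) v'"
      by (rule extend_hom_simple[OF E(1) m id]) blast
    have sub: "K \<subseteq> generate_field \<Omega> (Set.insert w E)"
      using E(2) generate_field_superset[of "Set.insert w E"] by auto
    have \<tau>_id: "\<tau> y = y" if "y \<in> K" for y using \<tau>(2)[of y] that E(2) by auto
    obtain \<sigma> where \<sigma>: "\<sigma> \<in> carrier (Gal L K)"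
      "\<And>y. y \<in> generate_field \<Omega> (Set.insert w E) \<Longrightarrow> \<sigma> y = \<tau> y"
      by (rule extend_hom_to_Gal[OF subfield_generate_field sub gen_L \<tau>(1) \<tau>_id]) auto
    have "x = \<sigma> x" using x[OF \<sigma>(1)] by simp
    also have "\<dots> = \<tau> x" by (rule \<sigma>(2)) (use insert.prems(2) gen in simp)
    also have "\<dots> = poly g v'" using \<tau>(4)[OF g(1)] g(2) g0(2) mid by simp
    finally show ?thesis by simp
  qed
  \<comment> \<open>A factor of \<open>f\<close> has simple roots too, so \<open>m\<close> has as
    many roots as its degree.\<close>
  have card: "card {v'. poly m v' = 0} = degree m"
  proof (rule simple_roots_factorization(1)[OF mp(4)])
    fix v' assume v': "poly m v' = 0"
    then have "poly f v' = 0" by (simp add: h)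
    from simple[OF this] show "poly (pderiv m) v' \<noteq> 0"
      using v' by (auto simp: h pderiv_mult)
  qed
  have "g - [:x:] = 0"
  proof (rule ccontr)
    assume nz: "g - [:x:] \<noteq> 0"
    have "{v'. poly m v' = 0} \<subseteq> {v'. poly (g - [:x:]) v' = 0}" using root by auto
    then have "degree m \<le> card {v'. poly (g - [:x:]) v' = 0}"
      unfolding card[symmetric] by (rule card_mono[OF poly_roots_finite[OF nz]])
    also have "\<dots> \<le> degree (g - [:x:])" by (rule card_poly_roots_bound[OF nz])
    also have "\<dots> \<le> degree g" by (rule degree_diff_le) auto
    finally show False using g(3) by simp
  qed
  then have "g = [:x:]" by simp
  then have "x \<in> E" using polys_overD[OF g(1), of 0] by simp
  then show ?case using insert by (simp add: E_def)
qed

lemma fixed_field: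
  assumes "x \<in> L" "\<And>\<sigma>. \<sigma> \<in> carrier (Gal L K) \<Longrightarrow> \<sigma> x = x"
  shows "x \<in> K"
  using fixed_in_adjoin[OF _ finite_V subset_refl, of x] assms by (simp add: L_def)

end

section \<open>Lifting the Frobenius\<close>

text \<open>The set \<open>\<mm>\<close> need not be contained in \<open>B\<close>; it is its intersection with \<open>B\<close> that is a prime ideal.\<close>

locale prime_ideal_of_subring =
  fixes B \<mm> :: "'a::field set"
  assumes B: "subring B \<Omega>"
    and zero: "0 \<in> \<mm>" and not_one: "1 \<notin> \<mm>"
    and add: "x \<in> \<mm> \<Longrightarrow> y \<in> \<mm> \<Longrightarrow> x + y \<in> \<mm>"
    and mult: "b \<in> B \<Longrightarrow> x \<in> \<mm> \<Longrightarrow> b * x \<in> \<mm>"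
    and prime: "x \<in> B \<Longrightarrow> y \<in> B \<Longrightarrow> x * y \<in> \<mm> \<Longrightarrow> x \<in> \<mm> \<or> y \<in> \<mm>"
begin

lemma uminus: "x \<in> \<mm> \<Longrightarrow> - x \<in> \<mm>"
  using mult[of "- 1" x] subring_closed[OF B] by simp

lemma diff: "x \<in> \<mm> \<Longrightarrow> y \<in> \<mm> \<Longrightarrow> x - y \<in> \<mm>"
  using add[of x "- y"] uminus by simp

lemma sum: "(\<And>i. i \<in> I \<Longrightarrow> g i \<in> \<mm>) \<Longrightarrow> sum g I \<in> \<mm>"
  by (induction I rule: infinite_finite_induct) (auto simp: zero add)

lemma prod:
  "finite I \<Longrightarrow> (\<And>i. i \<in> I \<Longrightarrow> g i \<in> B) \<Longrightarrow> prod g I \<in> \<mm> \<Longrightarrow> \<exists>i\<in>I. g i \<in> \<mm>"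
proof (induction I rule: finite_induct)
  case (insert i I)
  then have "g i \<in> \<mm> \<or> prod g I \<in> \<mm>" by (intro prime subring_prod[OF B]) auto
  then show ?case using insert by auto
qed (use not_one in auto)

lemma power_congruent: "x \<in> B \<Longrightarrow> y \<in> B \<Longrightarrow> x - y \<in> \<mm> \<Longrightarrow> x ^ k - y ^ k \<in> \<mm>"
  unfolding power_diff_sumr2
  by (subst mult.commute) (intro mult subring_closed[OF B])

lemma poly_congruent:
  assumes "g \<in> polys_over B" "x \<in> B" "y \<in> B" "x - y \<in> \<mm>"
  shows "poly g x - poly g y \<in> \<mm>"
proof -
  have "poly g x - poly g y = (\<Sum>i\<le>degree g. coeff g i * (x ^ i - y ^ i))"
    by (simp add: poly_altdef sum_subtractf right_diff_distrib)
  also have "\<dots> \<in> \<mm>" by (intro sum mult power_congruent assms polys_overD[OF assms(1)])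
  finally show ?thesis .
qed

lemma polys_over_ideal_uminus: "g \<in> polys_over \<mm> \<Longrightarrow> - g \<in> polys_over \<mm>"
  by (auto simp: polys_over_def uminus)

lemma polys_over_ideal_sum:
  "(\<And>i. i \<in> I \<Longrightarrow> g i \<in> polys_over \<mm>) \<Longrightarrow> sum g I \<in> polys_over \<mm>"
  by (auto simp: polys_over_def coeff_sum intro: sum)

lemma polys_over_ideal_mult:
  "f \<in> polys_over B \<Longrightarrow> g \<in> polys_over \<mm> \<Longrightarrow> f * g \<in> polys_over \<mm>"
  by (auto simp: polys_over_def coeff_mult intro!: sum mult)

text \<open>Take the least index with a coefficient outside \<open>\<mm>\<close> in each factor. In
  the coefficient of the product at the sum of these indices, every other term has a factor in
  \<open>\<mm>\<close>.\<close>

lemma Gauss_lemma: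
  assumes f: "f \<in> polys_over B" and g: "g \<in> polys_over B" and fg: "f * g \<in> polys_over \<mm>"
  shows "f \<in> polys_over \<mm> \<or> g \<in> polys_over \<mm>"
proof (rule ccontr)
  assume "\<not> ?thesis"
  then obtain i0 j0 where "coeff f i0 \<notin> \<mm>" "coeff g j0 \<notin> \<mm>" by (auto simp: polys_over_def)
  then obtain i j where i: "coeff f i \<notin> \<mm>" "\<And>k. k < i \<Longrightarrow> coeff f k \<in> \<mm>"
    and j: "coeff g j \<notin> \<mm>" "\<And>k. k < j \<Longrightarrow> coeff g k \<in> \<mm>"
    by (metis exists_least_iff[of "\<lambda>k. coeff f k \<notin> \<mm>"] exists_least_iff[of "\<lambda>k. coeff g k \<notin> \<mm>"])
  let ?t = "\<lambda>k. coeff f k * coeff g (i + j - k)"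
  have "(\<Sum>k\<in>{..i+j} - {i}. ?t k) \<in> \<mm>"
  proof (rule sum)
    fix k assume k: "k \<in> {..i+j} - {i}"
    show "?t k \<in> \<mm>"
    proof (cases "k < i")
      case True
      then show ?thesis using mult[OF polys_overD[OF g] i(2)] by (simp add: mult.commute)
    next
      case False
      then have "i + j - k < j" using k by auto
      then show ?thesis using mult[OF polys_overD[OF f] j(2)] by simp
    qed
  qed
  moreover have "coeff (f * g) (i + j) = ?t i + (\<Sum>k\<in>{..i+j} - {i}. ?t k)"
    unfolding coeff_mult by (subst sum.remove[of _ i]) auto
  moreover have "coeff (f * g) (i + j) \<in> \<mm>" using fg by (rule polys_overD)
  ultimately have "?t i \<in> \<mm>" by (metis add_diff_cancel_right' diff)
  then show False using prime[of "coeff f i" "coeff g j"] polys_overD f g i(1) j(1) by fastforce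
qed

lemma Gauss_lemma_prod:
  "finite I \<Longrightarrow> (\<And>i. i \<in> I \<Longrightarrow> g i \<in> polys_over B) \<Longrightarrow> prod g I \<in> polys_over \<mm> \<Longrightarrow>
    \<exists>i\<in>I. g i \<in> polys_over \<mm>"
proof (induction I rule: finite_induct)
  case empty
  then have "1 \<in> polys_over \<mm>" by simp
  from polys_overD[OF this, of 0] show ?case using not_one by simp
next
  case (insert i I)
  then have "g i \<in> polys_over \<mm> \<or> prod g I \<in> polys_over \<mm>"
    by (intro Gauss_lemma polys_over_prod[OF B]) auto
  then show ?case using insert by auto
qed

end

text \<open>The coefficients are spelled out as sums over subsets, \<open>Y\<close> collecting the
  factors that contribute \<open>y\<close>, so that a permutation of the \<open>a \<sigma>\<close>
  visibly permutes the summands. The ring is general because the \<open>a \<sigma>\<close> will be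
  polynomials.\<close>

lemma symmetric_expansion:
  fixes a :: "'b \<Rightarrow> 'c::comm_ring_1"
  assumes "finite G"
  defines "c \<equiv> \<lambda>j. \<Sum>Y\<in>{Y \<in> Pow G. card Y = j}. \<Prod>\<sigma>\<in>G - Y. - a \<sigma>"
  shows "(\<Prod>\<sigma>\<in>G. y - a \<sigma>) = (\<Sum>j\<le>card G. c j * y ^ j)"
proof -
  have "(\<Prod>\<sigma>\<in>G. y - a \<sigma>) = (\<Sum>Y\<in>Pow G. (\<Prod>\<sigma>\<in>Y. y) * (\<Prod>\<sigma>\<in>G - Y. - a \<sigma>))"
    using prod_add[OF assms(1), of "\<lambda>_. y" "\<lambda>\<sigma>. - a \<sigma>"] by simp
  also have "\<dots> = (\<Sum>j\<le>card G. \<Sum>Y\<in>{Y \<in> Pow G. card Y = j}. y ^ card Y * (\<Prod>\<sigma>\<in>G - Y. - a \<sigma>))"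
    by (subst sum.group) (use assms(1) in \<open>auto simp: card_mono\<close>)
  also have "\<dots> = (\<Sum>j\<le>card G. c j * y ^ j)"
    by (rule sum.cong) (auto simp: c_def sum_distrib_left mult.commute[of _ "y ^ _"] intro!: sum.cong)
  finally show ?thesis .
qed

text \<open>
  If every \<open>\<sigma>\<close> failed at some \<open>\<beta> \<sigma>\<close>, encode these witnesses as the coefficients of one polynomial
  \<open>\<theta>\<close>. The coefficients of \<open>\<Prod>\<sigma>. (Y - \<sigma> \<theta>)\<close> are invariant, hence modulo \<open>\<mm>\<close> unchanged by the
  Frobenius \<open>F\<close> on coefficients; so \<open>F \<theta>\<close> is a root modulo \<open>\<mm>\<close>, and \<open>F \<theta> \<equiv> \<sigma> \<theta>\<close> for some \<open>\<sigma>\<close>.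
\<close>

lemma (in prime_ideal_of_subring) Frobenius_lift:
  fixes G :: "('a \<Rightarrow> 'a) set"
  assumes G: "finite G" "id \<in> G"
    and comp: "\<And>\<sigma> \<tau>. \<sigma> \<in> G \<Longrightarrow> \<tau> \<in> G \<Longrightarrow> \<sigma> \<circ> \<tau> \<in> G"
    and cancel: "\<And>\<tau> \<sigma> \<sigma>'. \<tau> \<in> G \<Longrightarrow> \<sigma> \<in> G \<Longrightarrow> \<sigma>' \<in> G \<Longrightarrow> \<tau> \<circ> \<sigma> = \<tau> \<circ> \<sigma>' \<Longrightarrow> \<sigma> = \<sigma>'"
    and hom: "\<And>\<sigma>. \<sigma> \<in> G \<Longrightarrow> hom_on B \<sigma>"
    and closed: "\<And>\<sigma> b. \<sigma> \<in> G \<Longrightarrow> b \<in> B \<Longrightarrow> \<sigma> b \<in> B"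
    and N: "hom_on UNIV (\<lambda>x :: 'a. x ^ N)"
    and inv: "\<And>b. b \<in> B \<Longrightarrow> (\<And>\<sigma>. \<sigma> \<in> G \<Longrightarrow> \<sigma> b = b) \<Longrightarrow> b ^ N - b \<in> \<mm>"
  shows "\<exists>\<gamma>\<in>G. \<forall>b\<in>B. \<gamma> b - b ^ N \<in> \<mm>"
proof (rule ccontr)
  assume "\<not> ?thesis"
  then obtain \<beta> where \<beta>: "\<And>\<sigma>. \<sigma> \<in> G \<Longrightarrow> \<beta> \<sigma> \<in> B \<and> \<sigma> (\<beta> \<sigma>) - \<beta> \<sigma> ^ N \<notin> \<mm>"
    by metis
  obtain idx :: "('a \<Rightarrow> 'a) \<Rightarrow> nat" where idx: "inj_on idx G"
    using finite_imp_inj_to_nat_seg[OF G(1)] by blast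
  define \<theta> where "\<theta> = (\<Sum>\<sigma>\<in>G. monom (\<beta> \<sigma>) (idx \<sigma>))"
  have \<theta>_coeff: "coeff \<theta> (idx \<sigma>) = \<beta> \<sigma>" if "\<sigma> \<in> G" for \<sigma>
  proof -
    have "coeff \<theta> (idx \<sigma>) = (\<Sum>\<tau>\<in>G. if \<tau> = \<sigma> then \<beta> \<sigma> else 0)"
      unfolding \<theta>_def coeff_sum using that idx by (intro sum.cong) (auto dest: inj_onD)
    then show ?thesis using that G(1) by simp
  qed
  have \<theta>: "\<theta> \<in> polys_over B"
    unfolding \<theta>_def using \<beta> by (intro polys_over_sum[OF B] polys_over_monom[OF B]) auto
  define F where "F = map_poly (\<lambda>x :: 'a. x ^ N)"
  define a where "a \<sigma> = map_poly \<sigma> \<theta>" for \<sigma> :: "'a \<Rightarrow> 'a"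
  have zero_G: "\<sigma> 0 = 0" if "\<sigma> \<in> G" for \<sigma> using hom_on_zero[OF hom[OF that] B] .
  have a: "a \<sigma> \<in> polys_over B" if "\<sigma> \<in> G" for \<sigma>
    unfolding a_def by (rule map_poly_polys_over[OF _ _ \<theta>]) (use zero_G closed that in auto)
  define c where "c j = (\<Sum>Y\<in>{Y \<in> Pow G. card Y = j}. \<Prod>\<sigma>\<in>G - Y. - a \<sigma>)" for j
  have c: "c j \<in> polys_over B" for j
    unfolding c_def
    by (intro polys_over_sum[OF B] polys_over_prod[OF B] polys_over_uminus[OF B] a) auto
  have expand: "(\<Prod>\<sigma>\<in>G. y - a \<sigma>) = (\<Sum>j\<le>card G. c j * y ^ j)" for y
    unfolding c_def by (rule symmetric_expansion[OF G(1)])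
  \<comment> \<open>Composition with \<open>\<tau>\<close> permutes \<open>G\<close>, hence also its
    subsets of a given size, and \<open>\<tau>\<close> carries \<open>a \<sigma>\<close> to
    \<open>a (\<tau> \<circ> \<sigma>)\<close>; so it only reorders the sum
    \<open>c j\<close>.\<close>
  have c_inv: "map_poly \<tau> (c j) = c j" if \<tau>: "\<tau> \<in> G" for \<tau> j
  proof -
    note h = hom[OF \<tau>]
    define t where "t = (\<lambda>\<sigma> :: 'a \<Rightarrow> 'a. \<tau> \<circ> \<sigma>)"
    have t_inj: "inj_on t G" using cancel[OF \<tau>] by (auto simp: t_def inj_on_def)
    have t_G: "t ` G = G"
      by (rule endo_inj_surj[OF G(1) _ t_inj]) (use comp[OF \<tau>] in \<open>auto simp: t_def\<close>)
    let ?S = "{Y \<in> Pow G. card Y = j}"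
    have S_fin: "finite ?S" using G(1) by auto
    have S_inj: "inj_on ((`) t) ?S"
      by (rule inj_on_subset[OF inj_on_image_Pow[OF t_inj]]) auto
    have "(`) t ` ?S = ?S"
    proof (rule endo_inj_surj[OF S_fin _ S_inj])
      show "(`) t ` ?S \<subseteq> ?S"
      proof
        fix Z assume "Z \<in> (`) t ` ?S"
        then obtain Y where Y: "Y \<subseteq> G" "card Y = j" "Z = t ` Y" by auto
        then have "Z \<subseteq> G" using t_G by blast
        moreover have "card Z = j" using card_image[OF inj_on_subset[OF t_inj Y(1)]] Y by simp
        ultimately show "Z \<in> ?S" by simp
      qed
    qed
    then have S_bij: "bij_betw ((`) t) ?S ?S" using S_inj by (simp add: bij_betw_def)
    have act: "map_poly \<tau> (- a \<sigma>) = - a (t \<sigma>)" if "\<sigma> \<in> G" for \<sigma>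
    proof -
      have "map_poly \<tau> (a \<sigma>) = a (t \<sigma>)"
        by (rule poly_eqI)
           (auto simp: a_def t_def coeff_map_poly zero_G[OF \<tau>] zero_G[OF that])
      then show ?thesis using map_poly_uminus[OF B h a[OF that]] by simp
    qed
    have "map_poly \<tau> (c j) = (\<Sum>Y\<in>?S. \<Prod>\<sigma>\<in>G - Y. - a (t \<sigma>))"
    proof -
      have "map_poly \<tau> (c j) = (\<Sum>Y\<in>?S. map_poly \<tau> (\<Prod>\<sigma>\<in>G - Y. - a \<sigma>))"
        unfolding c_def
        by (intro map_poly_sum[OF B h] polys_over_prod[OF B] polys_over_uminus[OF B] a) auto
      also have "\<dots> = (\<Sum>Y\<in>?S. \<Prod>\<sigma>\<in>G - Y. map_poly \<tau> (- a \<sigma>))"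
        by (intro sum.cong refl map_poly_prod[OF B h] polys_over_uminus[OF B] a) auto
      finally show ?thesis using act by simp
    qed
    also have "\<dots> = (\<Sum>Y\<in>?S. \<Prod>\<sigma>\<in>G - t ` Y. - a \<sigma>)"
    proof (rule sum.cong[OF refl])
      fix Y assume "Y \<in> ?S"
      then have Y: "Y \<subseteq> G" by auto
      have "G - t ` Y = t ` (G - Y)"
        using inj_on_image_set_diff[OF t_inj, of G Y] Y t_G by auto
      then show "(\<Prod>\<sigma>\<in>G - Y. - a (t \<sigma>)) = (\<Prod>\<sigma>\<in>G - t ` Y. - a \<sigma>)"
        using prod.reindex[OF inj_on_subset[OF t_inj, of "G - Y"], of "\<lambda>\<sigma>. - a \<sigma>"] by simp
    qed
    also have "\<dots> = c j"
      unfolding c_def by (rule sum.reindex_bij_betw[OF S_bij])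
    finally show ?thesis .
  qed
  have Fc: "F (c j) - c j \<in> polys_over \<mm>" for j
  proof (rule polys_overI)
    fix i
    have N0: "(0 :: 'a) ^ N = 0"
      by (rule hom_on_zero[OF N subring_UNIV])
    have "\<sigma> (coeff (c j) i) = coeff (c j) i" if "\<sigma> \<in> G" for \<sigma>
      using arg_cong[OF c_inv[OF that], of "\<lambda>p. coeff p i"] by (simp add: coeff_map_poly zero_G[OF that])
    then show "coeff (F (c j) - c j) i \<in> \<mm>"
      using inv[of "coeff (c j) i"] polys_overD[OF c] by (simp add: F_def coeff_map_poly N0)
  qed
  have in_UN: "g \<in> polys_over UNIV" for g :: "'a poly" by (simp add: polys_over_def)
  have F_mult: "F (g * h) = F g * F h" and F_sum: "F (sum k I) = (\<Sum>i\<in>I. F (k i))" for g h k and I :: "nat set"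
    unfolding F_def using in_UN by (auto intro: map_poly_mult[OF subring_UNIV N] map_poly_sum[OF subring_UNIV N])
  have F_power: "F (g ^ i) = F g ^ i" for g i
    by (induction i) (auto simp: F_mult, auto simp: F_def map_poly_one[OF subring_UNIV N])
  have F\<theta>: "F \<theta> \<in> polys_over B"
    unfolding F_def
    by (rule map_poly_polys_over[OF _ _ \<theta>]) (use hom_on_zero[OF N subring_UNIV] subring_power[OF B] in auto)
  \<comment> \<open>As \<open>id\<close> lies in \<open>G\<close>, \<open>\<theta>\<close> is an
    exact root of the product. Applying \<open>F\<close> keeps the value 0 and replaces each
    \<open>c j\<close> by \<open>F (c j)\<close>, which differs from \<open>c j\<close> by
    coefficients in \<open>\<mm>\<close>.\<close>
  have "a id = \<theta>" by (simp add: a_def map_poly_idI)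
  then have "(\<Prod>\<sigma>\<in>G. \<theta> - a \<sigma>) = 0" using G by (intro prod_zero) auto
  then have "F (\<Sum>j\<le>card G. c j * \<theta> ^ j) = 0" using expand[of \<theta>] by (simp add: F_def)
  then have "(\<Sum>j\<le>card G. F (c j) * F \<theta> ^ j) = 0" by (simp add: F_sum F_mult F_power)
  then have "(\<Prod>\<sigma>\<in>G. F \<theta> - a \<sigma>) = - (\<Sum>j\<le>card G. F \<theta> ^ j * (F (c j) - c j))"
    unfolding expand by (simp add: right_diff_distrib sum_subtractf mult.commute)
  also have "\<dots> \<in> polys_over \<mm>"
    by (intro polys_over_ideal_uminus polys_over_ideal_sum polys_over_ideal_mult Fc
        polys_over_power[OF B] F\<theta>)
  finally have "(\<Prod>\<sigma>\<in>G. F \<theta> - a \<sigma>) \<in> polys_over \<mm>" .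
  then have "\<exists>\<sigma>\<in>G. F \<theta> - a \<sigma> \<in> polys_over \<mm>"
    by (rule Gauss_lemma_prod[OF G(1), rotated]) (rule polys_over_diff[OF B F\<theta> a])
  then obtain \<sigma> where \<sigma>: "\<sigma> \<in> G" "F \<theta> - a \<sigma> \<in> polys_over \<mm>" by blast
  have "coeff (F \<theta> - a \<sigma>) (idx \<sigma>) = \<beta> \<sigma> ^ N - \<sigma> (\<beta> \<sigma>)"
    using \<theta>_coeff[OF \<sigma>(1)] hom_on_zero[OF N subring_UNIV]
    by (simp add: F_def a_def coeff_map_poly zero_G[OF \<sigma>(1)])
  then have "\<beta> \<sigma> ^ N - \<sigma> (\<beta> \<sigma>) \<in> \<mm>" using polys_overD[OF \<sigma>(2), of "idx \<sigma>"] by simp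
  from uminus[OF this] \<beta>[OF \<sigma>(1)] show False by simp
qed

section \<open>Valuation rings\<close>

locale valuation_subring =
  fixes L \<O> :: "'a::field set"
  assumes L: "subfield L \<Omega>" and \<O>: "subring \<O> \<Omega>" "\<O> \<subseteq> L"
    and val: "x \<in> L \<Longrightarrow> x \<in> \<O> \<or> inverse x \<in> \<O>"
begin

text \<open>Zero is listed apart because \<open>inverse 0 = 0\<close> lies in the ring.\<close>

definition nonunits where "nonunits = {x \<in> \<O>. x = 0 \<or> inverse x \<notin> \<O>}"

lemma unitD: "x \<in> \<O> \<Longrightarrow> x \<notin> nonunits \<Longrightarrow> x \<noteq> 0 \<and> inverse x \<in> \<O>"
  by (auto simp: nonunits_def)

lemma inverse_nonunit: "x \<in> L \<Longrightarrow> x \<notin> \<O> \<Longrightarrow> inverse x \<in> nonunits"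
  using val[of x] by (auto simp: nonunits_def)

text \<open>Since \<open>(1 + x / y) * inverse (x + y) = inverse y\<close>, an invertible sum would
  make \<open>y\<close> invertible.\<close>

lemma nonunits_add_aux:
  assumes "x \<in> nonunits" "y \<in> nonunits" "y \<noteq> 0" "x / y \<in> \<O>"
  shows "x + y \<in> nonunits"
proof -
  have xy: "x \<in> \<O>" "y \<in> \<O>" "inverse y \<notin> \<O>" using assms by (auto simp: nonunits_def)
  have "x + y \<in> \<O>" using xy subring_closed[OF \<O>(1)] by blast
  moreover have "inverse (x + y) \<notin> \<O>" if nz: "x + y \<noteq> 0"
  proof
    assume "inverse (x + y) \<in> \<O>"
    then have "(1 + x / y) * inverse (x + y) \<in> \<O>"
      using assms(4) subring_closed[OF \<O>(1)] by blast
    moreover have "(1 + x / y) * inverse (x + y) = inverse y"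
      using nz assms(3) by (simp add: field_simps)
    ultimately show False using xy by simp
  qed
  ultimately show ?thesis by (auto simp: nonunits_def)
qed

sublocale prime_ideal_of_subring \<O> nonunits
proof (rule prime_ideal_of_subring.intro)
  show "subring \<O> \<Omega>" by (rule \<O>(1))
  show "0 \<in> nonunits" "1 \<notin> nonunits"
    using subring_closed[OF \<O>(1)] by (auto simp: nonunits_def)
  show "x + y \<in> nonunits" if xy: "x \<in> nonunits" "y \<in> nonunits" for x y
  proof (cases "x = 0 \<or> y = 0")
    case False
    have "x / y \<in> L"
      unfolding divide_inverse
      by (intro subring_mult[OF subfield_subring[OF L]] subfield_inverse[OF L])
         (use xy \<O>(2) in \<open>auto simp: nonunits_def\<close>)
    then have "x / y \<in> \<O> \<or> y / x \<in> \<O>" using val[of "x / y"] by simp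
    then show ?thesis
      using nonunits_add_aux[of x y] nonunits_add_aux[of y x] xy False by (auto simp: add.commute)
  qed (use xy in auto)
  show "b * x \<in> nonunits" if bx: "b \<in> \<O>" "x \<in> nonunits" for b x
  proof -
    have x: "x \<in> \<O>" "x = 0 \<or> inverse x \<notin> \<O>" using bx by (auto simp: nonunits_def)
    have "b * x \<in> \<O>" using bx x subring_closed[OF \<O>(1)] by blast
    moreover have "inverse (b * x) \<notin> \<O>" if nz: "b * x \<noteq> 0"
    proof
      assume "inverse (b * x) \<in> \<O>"
      then have "b * inverse (b * x) \<in> \<O>" using bx(1) subring_closed[OF \<O>(1)] by blast
      moreover have "b * inverse (b * x) = inverse x" using nz by (simp add: field_simps)
      ultimately have "inverse x \<in> \<O>" by (simp only:)
      then show False using x nz by auto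
    qed
    ultimately show ?thesis by (auto simp: nonunits_def)
  qed
  show "x \<in> nonunits \<or> y \<in> nonunits" if "x \<in> \<O>" "y \<in> \<O>" "x * y \<in> nonunits" for x y
    using that subring_mult[OF \<O>(1), of "inverse x" "inverse y"]
    by (auto simp: nonunits_def)
qed

text \<open>If \<open>x\<close> had a pole, multiplying the equation by a power of
  \<open>w = 1 / x\<close> would express the leading coefficient through multiples of the non-unit
  \<open>w\<close>. A unit as leading coefficient is the right generality: the pencil may have
  leading coefficient \<open>- s\<close>.\<close>

lemma integrally_closed:
  assumes g: "g \<in> polys_over \<O>" "lead_coeff g \<notin> nonunits" and x: "x \<in> L" "poly g x = 0"
  shows "x \<in> \<O>"
proof (rule ccontr)
  assume "x \<notin> \<O>"
  define w where "w = inverse x"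
  have w: "w \<in> nonunits" unfolding w_def by (rule inverse_nonunit) fact+
  then have wO: "w \<in> \<O>" by (auto simp: nonunits_def)
  have x0: "x \<noteq> 0" using \<open>x \<notin> \<O>\<close> subring_zero[OF \<O>(1)] by auto
  let ?n = "degree g"
  have "0 = w ^ ?n * poly g x" using x by simp
  also have "\<dots> = (\<Sum>i\<le>?n. coeff g i * w ^ (?n - i))"
    unfolding poly_altdef sum_distrib_left
    by (rule sum.cong) (auto simp: w_def x0 power_diff field_simps)
  also have "\<dots> = lead_coeff g + (\<Sum>i<?n. coeff g i * w ^ (?n - i))"
    by (simp add: lessThan_Suc_atMost[symmetric] add.commute)
  finally have "lead_coeff g = - (\<Sum>i<?n. coeff g i * w ^ (?n - i))"
    by (simp add: eq_neg_iff_add_eq_0)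
  also have "\<dots> \<in> nonunits"
  proof (intro uminus sum mult polys_overD[OF g(1)])
    fix i assume "i \<in> {..<?n}"
    then have "w ^ (?n - i) = w ^ (?n - i - 1) * w" by (simp flip: power_Suc2 add: Suc_diff_Suc)
    then show "w ^ (?n - i) \<in> nonunits" using mult[OF subring_power[OF \<O>(1) wO] w] by simp
  qed
  finally show False using g(2) by simp
qed

text \<open>From \<open>x ^ (N - 1) = 1\<close> the inverse of \<open>x\<close> is a power of
  \<open>x\<close> and conversely, so neither can have a pole. Applied to differences of constants,
  it turns congruences into equalities.\<close>

lemma root_of_unity_not_nonunit:
  assumes "x \<in> L" "x \<noteq> 0" "x ^ N = x" "N > 1"
  shows "x \<in> \<O>" "x \<notin> nonunits"
proof -
  have one: "x ^ (N - 1) = 1"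
  proof -
    have "x ^ (N - 1) * x = 1 * x" using assms by (simp flip: power_Suc2)
    then show ?thesis using assms(2) by (metis mult_right_cancel)
  qed
  then have inv: "inverse x = x ^ (N - 2)"
    using assms(2,4) by (intro inverse_unique) (simp flip: power_Suc add: Suc_diff_Suc numeral_2_eq_2)
  show xO: "x \<in> \<O>"
  proof (rule ccontr)
    assume "x \<notin> \<O>"
    from inverse_nonunit[OF assms(1) this] have w: "inverse x \<in> nonunits" .
    then have "inverse x \<in> \<O>" by (auto simp: nonunits_def)
    then have "inverse x ^ (N - 2) * inverse x \<in> nonunits"
      by (intro mult w subring_power[OF \<O>(1)])
    moreover have "inverse x ^ (N - 2) * inverse x = inverse (x ^ (N - 1))"
      using assms(4) by (simp flip: power_Suc2 power_inverse add: Suc_diff_Suc numeral_2_eq_2)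
    ultimately show False using one not_one by simp
  qed
  show "x \<notin> nonunits" using inv subring_power[OF \<O>(1) xO] assms(2) by (auto simp: nonunits_def)
qed

end

text \<open>
  Chevalley's extension theorem for the ideal generated by \<open>\<pi>\<close>: a subring that is maximal among those
  in which \<open>\<pi>\<close> is not invertible is a valuation ring.
\<close>

context
  fixes L S :: "'a::field set" and \<pi> :: 'a
  assumes L: "subfield L \<Omega>" and S: "subring S \<Omega>" "S \<subseteq> L" and \<pi>: "\<pi> \<in> S" "\<pi> \<noteq> 0" "inverse \<pi> \<notin> S"
    and maximal: "\<And>S'. subring S' \<Omega> \<Longrightarrow> S \<subseteq> S' \<Longrightarrow> S' \<subseteq> L \<Longrightarrow> inverse \<pi> \<notin> S' \<Longrightarrow> S' = S"
begin

text \<open>Maximality in usable form: adjoining any new element makes \<open>\<pi>\<close>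
  invertible.\<close>

lemma maximal_adjoin:
  assumes y: "y \<in> L" "y \<notin> S"
  obtains g where "g \<in> polys_over S" "poly g y = inverse \<pi>"
proof -
  let ?S' = "(\<lambda>g. poly g y) ` polys_over S"
  have "S \<subseteq> ?S'" "?S' \<noteq> S" using poly_values_superset[OF S(1), of y] y(2) by auto
  moreover have "?S' \<subseteq> L"
    by (rule poly_values_least[OF S(1) subfield_subring[OF L]]) (use S(2) y(1) in auto)
  ultimately have "inverse \<pi> \<in> ?S'" using maximal[OF subring_poly_values[OF S(1)]] by blast
  then obtain g where "inverse \<pi> = poly g y" "g \<in> polys_over S" by (rule imageE)
  then show ?thesis by (intro that[of g]) auto
qed

text \<open>Otherwise adjoining the inverse of \<open>u = 1 - \<pi> * b\<close> would give
  \<open>u ^ n / \<pi>\<close> in \<open>S\<close> for some \<open>n\<close>. But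
  \<open>u ^ n\<close> is 1 modulo \<open>\<pi>\<close>, which would put \<open>1 / \<pi>\<close>
  itself into \<open>S\<close>.\<close>

lemma maximal_unit:
  assumes b: "b \<in> S"
  shows "1 - \<pi> * b \<noteq> 0" "inverse (1 - \<pi> * b) \<in> S"
proof -
  define u where "u = 1 - \<pi> * b"
  note cl = subring_closed[OF S(1)]
  have u: "u \<in> S" unfolding u_def by (intro cl b \<pi>)
  show u0: "1 - \<pi> * b \<noteq> 0"
  proof
    assume "1 - \<pi> * b = 0"
    then have "\<pi> * b = 1" by simp
    then have "inverse \<pi> = b" by (rule inverse_unique)
    then show False using b \<pi>(3) by simp
  qed
  show "inverse (1 - \<pi> * b) \<in> S"
    unfolding u_def[symmetric]
  proof (rule ccontr)
    assume "inverse u \<notin> S"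
    moreover have "inverse u \<in> L" using u S(2) subfield_inverse[OF L] by blast
    ultimately obtain g where g: "g \<in> polys_over S" "poly g (inverse u) = inverse \<pi>"
      using maximal_adjoin by blast
    let ?n = "degree g"
    have "u ^ ?n * poly g (inverse u) = (\<Sum>i\<le>?n. coeff g i * u ^ (?n - i))"
      unfolding poly_altdef sum_distrib_left
      by (rule sum.cong) (use u0 in \<open>auto simp: u_def[symmetric] power_diff field_simps\<close>)
    also have "\<dots> \<in> S" by (intro cl polys_overD[OF g(1)] u)
    finally have 1: "u ^ ?n * inverse \<pi> \<in> S" using g(2) by simp
    have "\<exists>c\<in>S. u ^ k = 1 + \<pi> * c" for k
    proof (induction k)
      case 0
      show ?case by (intro bexI[of _ 0]) (auto intro: cl)
    next
      case (Suc k)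
      then obtain c where c: "c \<in> S" "u ^ k = 1 + \<pi> * c" by blast
      show ?case
        by (rule bexI[of _ "c - b - b * (\<pi> * c)"])
           (use c b \<pi> in \<open>auto intro!: cl simp: u_def[symmetric], simp add: u_def algebra_simps\<close>)
    qed
    then obtain c where c: "c \<in> S" "u ^ ?n = 1 + \<pi> * c" by blast
    have "u ^ ?n * inverse \<pi> - c = inverse \<pi>" using \<pi>(2) by (simp add: c(2) field_simps)
    then show False using subring_diff[OF S(1) 1 c(1)] \<pi>(3) by simp
  qed
qed

text \<open>Divided by the unit \<open>1 - \<pi> * h(0)\<close> and multiplied by
  \<open>y ^ n\<close>, the relation in \<open>1 / y\<close> expresses \<open>y ^ n\<close> through
  lower powers of \<open>y\<close>; this uses \<open>degree h \<le> n\<close>. Substituting it for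
  the leading power in \<open>g\<close> lowers the degree.\<close>

lemma maximal_descent:
  assumes y: "y \<noteq> 0" and g: "g \<in> polys_over S" "poly g y = inverse \<pi>"
    and h: "h \<in> polys_over S" "poly h (inverse y) = inverse \<pi>" and deg: "degree h \<le> degree g"
  obtains g' where "g' \<in> polys_over S" "poly g' y = inverse \<pi>" "degree g' < degree g"
proof -
  note cl = subring_closed[OF S(1)]
  define n where "n = degree g"
  define u where "u = 1 - \<pi> * coeff h 0"
  have u: "u \<noteq> 0" "inverse u \<in> S"
    unfolding u_def by (rule maximal_unit[OF polys_overD[OF h(1)]])+
  have "\<pi> * poly h (inverse y) = 1" using h(2) \<pi>(2) by simp
  moreover have "poly h (inverse y) = coeff h 0 + (\<Sum>i=1..degree h. coeff h i * inverse y ^ i)"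
    unfolding poly_altdef by (simp add: atMost_atLeast0 sum.atLeast_Suc_atMost)
  ultimately have "u = \<pi> * (\<Sum>i=1..degree h. coeff h i * inverse y ^ i)"
    by (simp add: u_def algebra_simps)
  then have "inverse u * (\<pi> * (\<Sum>i=1..degree h. coeff h i * inverse y ^ i)) = 1"
    using left_inverse[OF u(1)] by simp
  then have "y ^ n = y ^ n * (inverse u * (\<pi> * (\<Sum>i=1..degree h. coeff h i * inverse y ^ i)))"
    by simp
  also have "\<dots> = (\<Sum>i=1..degree h. (inverse u * \<pi> * coeff h i) * (y ^ n * inverse y ^ i))"
    by (simp add: sum_distrib_left mult_ac)
  also have "\<dots> = (\<Sum>i=1..degree h. (inverse u * \<pi> * coeff h i) * y ^ (n - i))"
    by (rule sum.cong) (use deg y in \<open>auto simp: n_def power_diff field_simps\<close>)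
  finally have yn: "y ^ n = (\<Sum>i=1..degree h. (inverse u * \<pi> * coeff h i) * y ^ (n - i))" .
  define k where "k = (\<Sum>i=1..degree h. monom (inverse u * \<pi> * coeff h i) (n - i))"
  have k: "k \<in> polys_over S" "poly k y = y ^ n"
    unfolding k_def yn
    by (intro polys_over_sum[OF S(1)] polys_over_monom[OF S(1)] cl u \<pi> polys_overD[OF h(1)])
       (simp add: poly_sum poly_monom)
  have n0: "n > 0"
  proof (rule ccontr)
    assume "\<not> n > 0"
    then obtain a where a: "g = [:a:]" unfolding n_def by (metis degree_eq_zeroE gr0I)
    then have "a = inverse \<pi>" using g(2) by simp
    then show False using polys_overD[OF g(1), of 0] a \<pi>(3) by simp
  qed
  have k_deg: "degree k \<le> n - 1"
    unfolding k_def by (rule degree_sum_le) (auto intro: order_trans[OF degree_monom_le])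
  define g1 where "g1 = g - monom (lead_coeff g) n"
  have g1_deg: "degree g1 \<le> n - 1"
  proof (rule degree_le, intro allI impI)
    fix i assume "i > n - 1"
    then show "coeff g1 i = 0" by (cases "i = n") (auto simp: g1_def n_def coeff_eq_0)
  qed
  define g' where "g' = g1 + Polynomial.smult (lead_coeff g) k"
  show ?thesis
  proof (rule that[of g'])
    show "g' \<in> polys_over S"
      unfolding g'_def g1_def
      by (intro polys_over_add[OF S(1)] polys_over_diff[OF S(1)] polys_over_smult[OF S(1)]
          polys_over_monom[OF S(1)] polys_overD[OF g(1)] g(1) k)
    show "poly g' y = inverse \<pi>" using g(2) k(2) by (simp add: g'_def g1_def poly_monom)
    have "degree g' \<le> n - 1"
      unfolding g'_def by (intro degree_add_le g1_deg order_trans[OF degree_smult_le] k_deg)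
    then show "degree g' < degree g" using n0 by (simp add: n_def)
  qed
qed

text \<open>Take relations for \<open>1 / \<pi>\<close> of least degree in \<open>x\<close> and in
  \<open>1 / x\<close>. The descent is symmetric under exchanging the two, so the one of larger
  degree could still be lowered.\<close>

lemma maximal_valuation:
  assumes x: "x \<in> L" shows "x \<in> S \<or> inverse x \<in> S"
proof (rule ccontr)
  assume "\<not> ?thesis"
  then have nx: "x \<notin> S" "inverse x \<notin> S" by auto
  have x0: "x \<noteq> 0" using nx(1) subring_zero[OF S(1)] by auto
  let ?P = "\<lambda>y g. g \<in> polys_over S \<and> poly g y = inverse \<pi>"
  obtain g0 where "?P x g0" using maximal_adjoin[OF x nx(1)] by blast
  then obtain g where g: "?P x g" "\<And>g'. ?P x g' \<Longrightarrow> degree g \<le> degree g'"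
    using ex_has_least_nat[of "?P x" g0 degree] by blast
  obtain h0 where "?P (inverse x) h0"
    using maximal_adjoin[OF subfield_inverse[OF L x] nx(2)] by blast
  then obtain h where h: "?P (inverse x) h" "\<And>h'. ?P (inverse x) h' \<Longrightarrow> degree h \<le> degree h'"
    using ex_has_least_nat[of "?P (inverse x)" h0 degree] by blast
  show False
  proof (cases "degree h \<le> degree g")
    case True
    obtain g' where "?P x g'" "degree g' < degree g"
      using maximal_descent[OF x0 _ _ _ _ True] g(1) h(1) by blast
    then show False using g(2)[of g'] by simp
  next
    case False
    have "poly g (inverse (inverse x)) = inverse \<pi>" using g(1) by simp
    then obtain h' where "?P (inverse x) h'" "degree h' < degree h"
      using maximal_descent[of "inverse x" h g] x0 g(1) h(1) False by auto
    then show False using h(2)[of h'] by simp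
  qed
qed

end

lemma exists_valuation_subring:
  fixes L A :: "'a::field set"
  assumes L: "subfield L \<Omega>" and A: "subring A \<Omega>" "A \<subseteq> L"
    and \<pi>: "\<pi> \<in> A" "\<pi> \<noteq> 0" "inverse \<pi> \<notin> A"
  obtains \<O> where "valuation_subring L \<O>" "A \<subseteq> \<O>" "inverse \<pi> \<notin> \<O>"
proof -
  define \<A> where "\<A> = {S. subring S \<Omega> \<and> A \<subseteq> S \<and> S \<subseteq> L \<and> inverse \<pi> \<notin> S}"
  have "\<A> \<noteq> {}" using A \<pi> by (auto simp: \<A>_def)
  moreover have "\<Union>\<C> \<in> \<A>" if \<C>: "\<C> \<noteq> {}" "subset.chain \<A> \<C>" for \<C>
  proof -
    have sub: "\<C> \<subseteq> \<A>" and tot: "\<And>S T. S \<in> \<C> \<Longrightarrow> T \<in> \<C> \<Longrightarrow> S \<subseteq> T \<or> T \<subseteq> S"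
      using \<C>(2) by (auto simp: subset_chain_def)
    have ring: "subring S \<Omega>" if "S \<in> \<C>" for S using that sub by (auto simp: \<A>_def)
    have two: "\<exists>S\<in>\<C>. x \<in> S \<and> y \<in> S" if xy: "x \<in> \<Union>\<C>" "y \<in> \<Union>\<C>" for x y
    proof -
      obtain S T where "S \<in> \<C>" "T \<in> \<C>" "x \<in> S" "y \<in> T" using xy by auto
      then show ?thesis using tot[of S T] by blast
    qed
    have "subring (\<Union>\<C>) \<Omega>"
    proof (rule subringI_type)
      show "1 \<in> \<Union>\<C>" using \<C>(1) subring_one[OF ring] by blast
      show "- x \<in> \<Union>\<C>" if "x \<in> \<Union>\<C>" for x using that subring_uminus[OF ring] by blast
      fix x y assume "x \<in> \<Union>\<C>" "y \<in> \<Union>\<C>"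
      then obtain T where T: "T \<in> \<C>" "x \<in> T" "y \<in> T" using two by blast
      show "x * y \<in> \<Union>\<C>" using T subring_mult[OF ring[OF T(1)]] by blast
      show "x + y \<in> \<Union>\<C>" using T subring_add[OF ring[OF T(1)]] by blast
    qed
    then show ?thesis using \<C>(1) sub by (auto simp: \<A>_def)
  qed
  ultimately obtain \<O> where \<O>: "\<O> \<in> \<A>" "\<And>S. S \<in> \<A> \<Longrightarrow> \<O> \<subseteq> S \<Longrightarrow> S = \<O>"
    using subset_Zorn_nonempty[of \<A>] by blast
  have O: "subring \<O> \<Omega>" "A \<subseteq> \<O>" "\<O> \<subseteq> L" "inverse \<pi> \<notin> \<O>" using \<O>(1) by (auto simp: \<A>_def)
  have max: "S' = \<O>" if "subring S' \<Omega>" "\<O> \<subseteq> S'" "S' \<subseteq> L" "inverse \<pi> \<notin> S'" for S'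
    using \<O>(2)[of S'] that O by (auto simp: \<A>_def)
  have "\<pi> \<in> \<O>" using \<pi>(1) O(2) by blast
  have "valuation_subring L \<O>"
    unfolding valuation_subring_def
    using L O maximal_valuation[OF L O(1,3) \<open>\<pi> \<in> \<O>\<close> \<pi>(2) O(4) max] by blast
  then show ?thesis using that O by blast
qed

section \<open>Rational functions\<close>

lemma root_factor:
  fixes k :: "'a::field set"
  assumes k: "subring k \<Omega>" and f: "f \<in> polys_over k" and c: "c \<in> k" "poly f c = 0"
  obtains g where "g \<in> polys_over k" "f = [:- c, 1:] * g"
proof -
  have lin: "[:- c, 1:] \<in> polys_over k"
    using c(1) by (intro polys_over_linear[OF k] subring_uminus[OF k])
  obtain a b where ab: "a \<in> polys_over k" "f = a * [:- c, 1:] + b" "b = 0 \<or> degree b < 1"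
    using monic_division[OF k lin _ f] by auto
  obtain b0 where b0: "b = [:b0:]" using ab(3) by (metis degree_eq_zeroE less_one pCons_0_0)
  have "b = 0" using c(2) ab(2) b0 by simp
  then show ?thesis using ab by (intro that[of a]) (auto simp: mult.commute)
qed

lemma generate_field_rational:
  fixes k :: "'a::field set"
  assumes k: "subfield k \<Omega>" and z: "z \<in> generate_field \<Omega> (insert s k)"
  obtains f g where "f \<in> polys_over k" "g \<in> polys_over k" "poly g s \<noteq> 0" "z = poly f s / poly g s"
proof -
  note R = subfield_subring[OF k]
  note cl = polys_over_one[OF R] polys_over_uminus[OF R] polys_over_add[OF R] polys_over_mult[OF R]
    polys_over_const[OF R] polys_over_monom[OF R]
  define Q where "Q = {z. \<exists>f\<in>polys_over k. \<exists>g\<in>polys_over k. poly g s \<noteq> 0 \<and> z = poly f s / poly g s}"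
  have QI: "poly f s / poly g s \<in> Q"
    if "f \<in> polys_over k" "g \<in> polys_over k" "poly g s \<noteq> 0" for f g
    using that by (auto simp: Q_def)
  have "subfield Q \<Omega>"
  proof (rule subfieldI_type)
    show "1 \<in> Q" using QI[of 1 1] cl by simp
    fix x assume "x \<in> Q"
    then obtain f g where fg: "f \<in> polys_over k" "g \<in> polys_over k" "poly g s \<noteq> 0"
      "x = poly f s / poly g s" by (auto simp: Q_def)
    show "- x \<in> Q" using QI[of "- f" g] fg cl by simp
    show "inverse x \<in> Q" if "x \<noteq> 0" using QI[of g f] fg that by simp
    fix y assume "y \<in> Q"
    then obtain f' g' where fg': "f' \<in> polys_over k" "g' \<in> polys_over k" "poly g' s \<noteq> 0"
      "y = poly f' s / poly g' s" by (auto simp: Q_def)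
    show "x * y \<in> Q" using QI[of "f * f'" "g * g'"] fg fg' cl by simp
    show "x + y \<in> Q"
      using QI[of "f * g' + f' * g" "g * g'"] fg fg' cl by (simp add: add_frac_eq)
  qed
  moreover have "insert s k \<subseteq> Q"
  proof
    fix x assume "x \<in> insert s k"
    moreover have "s \<in> Q"
      using QI[of "monom 1 1" 1] cl subring_one[OF R] by (simp add: poly_monom)
    moreover have "x \<in> Q" if "x \<in> k" using QI[of "[:x:]" 1] cl that by simp
    ultimately show "x \<in> Q" by auto
  qed
  ultimately have "generate_field \<Omega> (insert s k) \<subseteq> Q" by (rule generate_field_least)
  then have "z \<in> Q" using z by blast
  then show ?thesis using that by (auto simp: Q_def)
qed

text \<open>Only a common zero at \<open>c\<close> has to be excluded, and a denominator of least
  degree excludes it, because a common factor \<open>X - c\<close> could be cancelled.\<close>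

lemma generate_field_rational_reduced:
  fixes k :: "'a::field set"
  assumes k: "subfield k \<Omega>" and z: "z \<in> generate_field \<Omega> (insert s k)" and c: "c \<in> k"
  obtains f g where "f \<in> polys_over k" "g \<in> polys_over k" "poly g s \<noteq> 0" "z = poly f s / poly g s"
    "poly f c \<noteq> 0 \<or> poly g c \<noteq> 0"
proof -
  note R = subfield_subring[OF k]
  let ?P = "\<lambda>(f, g). f \<in> polys_over k \<and> g \<in> polys_over k \<and> poly g s \<noteq> 0 \<and> z = poly f s / poly g s"
  obtain f0 g0 where "?P (f0, g0)"
    by (rule generate_field_rational[OF k z]) auto
  then obtain fg where "?P fg" and least: "\<And>fg'. ?P fg' \<Longrightarrow> degree (snd fg) \<le> degree (snd fg')"
    using ex_has_least_nat[of ?P "(f0, g0)" "\<lambda>fg. degree (snd fg)"] by blast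
  then obtain f g where fg: "fg = (f, g)" "f \<in> polys_over k" "g \<in> polys_over k" "poly g s \<noteq> 0"
    "z = poly f s / poly g s" by (cases fg) auto
  have "poly f c \<noteq> 0 \<or> poly g c \<noteq> 0"
  proof (rule ccontr)
    assume "\<not> ?thesis"
    then have "poly f c = 0" "poly g c = 0" by auto
    then obtain f1 g1 where 1: "f1 \<in> polys_over k" "f = [:- c, 1:] * f1"
      "g1 \<in> polys_over k" "g = [:- c, 1:] * g1"
      using root_factor[OF R fg(2) c] root_factor[OF R fg(3) c] by metis
    have s: "s \<noteq> c" "poly g1 s \<noteq> 0" using fg(4) 1(4) by auto
    then have "?P (f1, g1)" using 1 fg(5) by (auto simp: left_diff_distrib[symmetric])
    from least[OF this] have "degree g \<le> degree g1" by (simp add: fg(1))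
    moreover have "g1 \<noteq> 0" using s by auto
    ultimately show False
      using 1(4) degree_mult_eq[of "[:- c, 1:]" g1] by simp
  qed
  with fg show ?thesis by (intro that[of f g])
qed

section \<open>Reduction of rational functions at the point \<open>s = c\<close>\<close>

context valuation_subring
begin

context
  fixes k s c
  assumes k: "subfield k \<Omega>" "k \<subseteq> \<O>" and c: "c \<in> k" and s: "s \<in> \<O>" "s - c \<in> nonunits"
begin

lemma subfield_nonunits: "x \<in> k \<Longrightarrow> x \<in> nonunits \<Longrightarrow> x = 0"
  using subfield_inverse[OF k(1), of x] k(2) by (auto simp: nonunits_def)

lemma polys_over_subfield: "f \<in> polys_over k \<Longrightarrow> f \<in> polys_over \<O>"
  using k(2) by (auto simp: polys_over_def)

lemma poly_reduction: "f \<in> polys_over k \<Longrightarrow> poly f s - poly f c \<in> nonunits"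
  using k c s polys_over_subfield by (intro poly_congruent) auto

lemma poly_nonunit_iff:
  assumes "f \<in> polys_over k"
  shows "poly f s \<in> nonunits \<longleftrightarrow> poly f c = 0"
proof
  assume "poly f s \<in> nonunits"
  then have "poly f c \<in> nonunits"
    using diff[OF _ poly_reduction[OF assms], of "poly f s"] by simp
  then show "poly f c = 0"
    by (rule subfield_nonunits[OF poly_in_subring[OF subfield_subring[OF k(1)] assms c]])
next
  assume "poly f c = 0"
  then show "poly f s \<in> nonunits" using poly_reduction[OF assms] by simp
qed

text \<open>If the denominator were a non-unit, so would be the numerator \<open>z * g(s)\<close>;
  both would vanish at \<open>c\<close>, against the reduced form.\<close>

lemma rational_integral_rep:
  assumes z: "z \<in> generate_field \<Omega> (insert s k)" "z \<in> \<O>"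
  obtains f g where "f \<in> polys_over k" "g \<in> polys_over k" "poly g s \<notin> nonunits"
    "z = poly f s / poly g s"
proof -
  obtain f g where fg: "f \<in> polys_over k" "g \<in> polys_over k" "poly g s \<noteq> 0"
    "z = poly f s / poly g s" "poly f c \<noteq> 0 \<or> poly g c \<noteq> 0"
    by (rule generate_field_rational_reduced[OF k(1) z(1) c])
  have "poly g s \<notin> nonunits"
  proof
    assume "poly g s \<in> nonunits"
    then have "z * poly g s \<in> nonunits" using z(2) by (intro mult)
    then have "poly f s \<in> nonunits" using fg(3,4) by simp
    then show False
      using fg(5) \<open>poly g s \<in> nonunits\<close> poly_nonunit_iff[OF fg(1)] poly_nonunit_iff[OF fg(2)] by auto
  qed
  with fg show ?thesis by (intro that[of f g])
qed

text \<open>Substituting \<open>c\<close> for \<open>s\<close> gives the residue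
  \<open>f(c) / g(c)\<close>, so rational functions have no residues outside \<open>k\<close> at
  this point.\<close>

lemma rational_residue:
  assumes z: "z \<in> generate_field \<Omega> (insert s k)" "z \<in> \<O>"
  obtains b where "b \<in> k" "z - b \<in> nonunits"
proof -
  obtain f g where fg: "f \<in> polys_over k" "g \<in> polys_over k" "poly g s \<notin> nonunits"
    "z = poly f s / poly g s"
    by (rule rational_integral_rep[OF z])
  note R = subfield_subring[OF k(1)]
  define b where "b = poly f c / poly g c"
  have gc: "poly g c \<noteq> 0" using fg(3) poly_nonunit_iff[OF fg(2)] by simp
  have b: "b \<in> k"
    unfolding b_def divide_inverse
    by (intro subring_mult[OF R] subfield_inverse[OF k(1)] poly_in_subring[OF R] fg c)
  have gs: "poly g s \<noteq> 0" using fg(3) zero by auto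
  have "f - Polynomial.smult b g \<in> polys_over k"
    by (intro polys_over_diff[OF R] polys_over_smult[OF R] fg b)
  then have "poly (f - Polynomial.smult b g) s \<in> nonunits"
    using gc by (subst poly_nonunit_iff) (auto simp: b_def)
  then have "(z - b) * poly g s \<in> nonunits" using gs fg(4) by (simp add: algebra_simps)
  moreover have "z - b \<in> \<O>" "poly g s \<in> \<O>"
    using z(2) b k(2) s(1) fg(2) subring_diff[OF \<O>(1)] poly_in_subring[OF \<O>(1) polys_over_subfield]
    by auto
  ultimately show ?thesis using prime[of "z - b" "poly g s"] fg(3) b by (intro that[of b]) auto
qed

text \<open>This says that \<open>s - c\<close> is a uniformizer: the numerator of a non-unit
  vanishes at \<open>c\<close>, so a factor \<open>X - c\<close> splits off while the denominator
  stays a unit.\<close>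

lemma rational_nonunit:
  assumes z: "z \<in> generate_field \<Omega> (insert s k)" "z \<in> nonunits"
  obtains y where "y \<in> \<O>" "z = (s - c) * y"
proof -
  have zO: "z \<in> \<O>" using z(2) by (auto simp: nonunits_def)
  obtain f g where fg: "f \<in> polys_over k" "g \<in> polys_over k" "poly g s \<notin> nonunits"
    "z = poly f s / poly g s"
    by (rule rational_integral_rep[OF z(1) zO])
  note R = subfield_subring[OF k(1)]
  have gs: "poly g s \<in> \<O>" using s(1) fg(2) poly_in_subring[OF \<O>(1) polys_over_subfield] by blast
  have u: "poly g s \<noteq> 0" "inverse (poly g s) \<in> \<O>" using unitD[OF gs fg(3)] by auto
  have "poly g s * z \<in> nonunits" using gs z(2) by (rule mult)
  then have "poly f s \<in> nonunits" using u(1) fg(4) by simp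
  then have "poly f c = 0" using poly_nonunit_iff[OF fg(1)] by simp
  then obtain f1 where f1: "f1 \<in> polys_over k" "f = [:- c, 1:] * f1"
    using root_factor[OF R fg(1) c] by blast
  have "poly f1 s \<in> \<O>" using s(1) f1(1) poly_in_subring[OF \<O>(1) polys_over_subfield] by blast
  then have "poly f1 s * inverse (poly g s) \<in> \<O>" using u(2) by (rule subring_mult[OF \<O>(1)])
  then show ?thesis
    by (rule that) (simp add: fg(4) f1(2) divide_inverse algebra_simps)
qed

end

end


section \<open>Places\<close>

lemma ring_subring_of: "subring A \<Omega> \<Longrightarrow> ring (\<Omega>|(A) :: 'a::field ring)"
  by (rule ring.subring_is_ring[OF ring_ambient])

lemma cring_subring_of: "subring A \<Omega> \<Longrightarrow> cring (\<Omega>|(A) :: 'a::field ring)"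
  by (intro cring.intro ring_subring_of comm_monoid.intro ring.is_monoid comm_monoid_axioms.intro)
     (auto simp: mult.commute)

lemma ideal_subring_ofI:
  fixes A :: "'a::field set"
  assumes A: "subring A \<Omega>" and I: "I \<subseteq> A" "0 \<in> I" "\<And>x y. x \<in> I \<Longrightarrow> y \<in> I \<Longrightarrow> x + y \<in> I"
    "\<And>a x. a \<in> A \<Longrightarrow> x \<in> I \<Longrightarrow> a * x \<in> I"
  shows "ideal I (\<Omega>|(A))"
proof (rule idealI[OF ring_subring_of[OF A]])
  have m: "- x \<in> I" if "x \<in> I" for x
    using I(4)[of "- 1" x] that subring_closed[OF A] by simp
  show "subgroup I (add_monoid (\<Omega>|(A)))"
  proof (rule group.subgroupI[OF abelian_group.a_group[OF ring.is_abelian_group[OF ring_subring_of[OF A]]]])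
    show "inv\<^bsub>add_monoid (\<Omega>|(A))\<^esub> x \<in> I" if x: "x \<in> I" for x
    proof -
      have "\<ominus>\<^bsub>\<Omega>|(A)\<^esub> x = - x"
        by (rule abelian_group.minus_equality[OF ring.is_abelian_group[OF ring_subring_of[OF A]]])
           (use x m[OF x] I(1) in auto)
      then show ?thesis using m[OF x] by (simp add: a_inv_def)
    qed
  qed (use I in auto)
  show "x \<otimes>\<^bsub>\<Omega>|(A)\<^esub> a \<in> I" "a \<otimes>\<^bsub>\<Omega>|(A)\<^esub> x \<in> I" if "a \<in> I" "x \<in> carrier (\<Omega>|(A))" for a x
    using I(4)[of x a] that by (auto simp: mult.commute)
qed

text \<open>A proper ideal contains no unit, and in a valuation ring the non-units already form an
  ideal, so the maximal ideal is exactly this one. From here on places are handled through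
  \<open>nonunits\<close>.\<close>

lemma place_imp_valuation_subring:
  assumes "subfield F \<Omega>" "place K F A P"
  shows "valuation_subring F A" "P = valuation_subring.nonunits A"
proof -
  have A: "subring A \<Omega>" "A \<subseteq> F" "\<And>x. x \<in> F \<Longrightarrow> x \<in> A \<or> inverse x \<in> A" and P: "maximalideal P (\<Omega>|(A))"
    using assms(2) by (auto simp: place_def valuation_ring_def)
  show "valuation_subring F A" using A assms(1) by (simp add: valuation_subring_def)
  then interpret valuation_subring F A .
  interpret P: maximalideal P "\<Omega>|(A)" by (rule P)
  have "ideal nonunits (\<Omega>|(A))"
    by (rule ideal_subring_ofI[OF A(1)]) (use zero add mult in \<open>auto simp: nonunits_def\<close>)
  moreover have "P \<subseteq> nonunits"
  proof
    fix x assume x: "x \<in> P"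
    then have xA: "x \<in> A" using P.a_subset by auto
    show "x \<in> nonunits"
    proof (rule ccontr)
      assume "x \<notin> nonunits"
      then have "x \<noteq> 0" "inverse x \<in> A" using unitD[OF xA] by auto
      then have "1 \<in> P" using P.I_l_closed[OF x, of "inverse x"] by simp
      then have "P = A" using P.one_imp_carrier by simp
      then show False using P.I_notcarr by simp
    qed
  qed
  moreover have "nonunits \<subseteq> A" by (auto simp: nonunits_def)
  ultimately have "nonunits = P \<or> nonunits = A" using P.I_maximal[of nonunits] by simp
  then show "P = nonunits" using not_one subring_one[OF A(1)] by auto
qed

text \<open>A one-dimensional residue field is spanned by the class of some \<open>w\<close>, which
  need not be 1. Writing 1 as a multiple \<open>k0 * w\<close> shows that the class of
  \<open>w\<close>, and with it every class, comes from \<open>K\<close>. The cardinality gives the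
  exponent in \<open>Frobenius_element\<close>.\<close>

lemma place_degree_one:
  assumes F: "subfield F \<Omega>" and K: "subfield K \<Omega>" and P: "place K F A P" and deg: "place_has_degree K A P 1"
  shows "\<And>a. a \<in> A \<Longrightarrow> \<exists>c\<in>K. a - c \<in> P" "card (carrier (residue_field A P)) = card K"
proof -
  have A: "subring A \<Omega>" "K \<subseteq> A" and max: "maximalideal P (\<Omega>|(A))"
    using P by (auto simp: place_def valuation_ring_def)
  interpret valuation_subring F A using place_imp_valuation_subring[OF F P] by simp
  have Pn: "P = nonunits" using place_imp_valuation_subring[OF F P] by simp
  interpret P: maximalideal P "\<Omega>|(A)" by (rule max)
  define Q where "Q = residue_field A P"
  define h where "h = (\<lambda>x. P +>\<^bsub>\<Omega>|(A)\<^esub> x)"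
  interpret Q: ring Q unfolding Q_def residue_field_def by (rule P.quotient_is_ring)
  have hom: "h \<in> ring_hom (\<Omega>|(A)) Q"
    unfolding h_def Q_def residue_field_def by (rule P.rcos_ring_hom)
  have h_eq: "h x = h y \<longleftrightarrow> x - y \<in> P" if xy: "x \<in> A" "y \<in> A" for x y
  proof -
    have "\<ominus>\<^bsub>\<Omega>|(A)\<^esub> y = - y"
      by (rule P.minus_equality) (use xy subring_uminus[OF A(1)] in auto)
    then have "x \<ominus>\<^bsub>\<Omega>|(A)\<^esub> y = x - y" by (simp add: a_minus_def)
    then show ?thesis
      unfolding h_def using P.quotient_eq_iff_same_a_r_cos[OF P.is_ideal, of x y] xy by simp
  qed
  have carr: "carrier Q = h ` A"
    by (auto simp: Q_def residue_field_def FactRing_def A_RCOSETS_def' h_def)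
  have "Q.dimension (Suc 0) (h ` K) (carrier Q)"
    using deg by (simp add: place_has_degree_def Q_def h_def)
  then obtain v where v: "v \<in> carrier Q" "carrier Q = Q.line_extension (h ` K) v {\<zero>\<^bsub>Q\<^esub>}"
    by (cases rule: Q.dimension.cases) (auto elim: Q.dimension.cases)
  obtain w where w: "w \<in> A" "v = h w" using v(1) carr by auto
  have rep: "\<exists>k\<in>K. a - k * w \<in> P" if a: "a \<in> A" for a
  proof -
    have "h a \<in> Q.line_extension (h ` K) v {\<zero>\<^bsub>Q\<^esub>}" using a v(2) carr by auto
    then obtain k where k: "k \<in> K" "h a = h k \<otimes>\<^bsub>Q\<^esub> h w \<oplus>\<^bsub>Q\<^esub> \<zero>\<^bsub>Q\<^esub>"
      unfolding Q.line_extension_mem_iff w(2) by auto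
    have kA: "k \<in> A" using k A by auto
    have "h k \<otimes>\<^bsub>Q\<^esub> h w \<in> carrier Q" using kA w(1) carr by (intro Q.m_closed) auto
    then have "h a = h (k * w)" using k(2) ring_hom_mult[OF hom, of k w] kA w(1) by simp
    then show ?thesis
      using h_eq[OF a subring_mult[OF A(1) kA w(1)]] k(1) by blast
  qed
  obtain k0 where k0: "k0 \<in> K" "1 - k0 * w \<in> P" using rep[OF subring_one[OF A(1)]] by blast
  have k0_nz: "k0 \<noteq> 0" using k0(2) Pn not_one by auto
  note RK = subfield_subring[OF K]
  have k0i: "inverse k0 \<in> K" using k0(1) by (rule subfield_inverse[OF K])
  show res: "\<exists>c\<in>K. a - c \<in> P" if a: "a \<in> A" for a
  proof -
    obtain k where k: "k \<in> K" "a - k * w \<in> P" using rep[OF a] by blast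
    have "k * inverse k0 * (1 - k0 * w) \<in> P"
      unfolding Pn by (intro mult) (use k0 k k0i A(2) Pn subring_mult[OF RK] in auto)
    then have "(a - k * w) - k * inverse k0 * (1 - k0 * w) \<in> P"
      using k(2) unfolding Pn by (rule diff[rotated])
    moreover have "(a - k * w) - k * inverse k0 * (1 - k0 * w) = a - k * inverse k0"
      using k0_nz by (simp add: field_simps)
    ultimately show ?thesis using k(1) k0i subring_mult[OF RK] by (metis (no_types, lifting))
  qed
  have "bij_betw h K (carrier Q)"
    unfolding bij_betw_def
  proof
    show "inj_on h K"
    proof (rule inj_onI)
      fix x y assume xy: "x \<in> K" "y \<in> K" "h x = h y"
      then have "x - y \<in> nonunits" using h_eq[of x y] A(2) Pn by auto
      moreover have "inverse (x - y) \<in> A"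
        using xy subfield_inverse[OF K subring_diff[OF RK]] A(2) by blast
      ultimately show "x = y" by (auto simp: nonunits_def)
    qed
    show "h ` K = carrier Q"
    proof
      show "h ` K \<subseteq> carrier Q" using carr A(2) by auto
      show "carrier Q \<subseteq> h ` K"
      proof
        fix y assume "y \<in> carrier Q"
        then obtain a where a: "a \<in> A" "y = h a" using carr by auto
        obtain c where c: "c \<in> K" "a - c \<in> P" using res[OF a(1)] by blast
        then show "y \<in> h ` K" using h_eq[of a c] a A(2) by auto
      qed
    qed
  qed
  then show "card (carrier (residue_field A P)) = card K"
    using bij_betw_same_card Q_def by metis
qed

text \<open>With ramification index 1 the ideal \<open>R\<close> is generated by \<open>P\<close>,
  so it lies in every principal ideal that contains \<open>P\<close>.\<close>

lemma unramified_principal: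
  assumes B: "subring B \<Omega>" and R: "ideal R (\<Omega>|(B))" and ram: "has_ramification_index P B R 1"
    and P: "P \<subseteq> (\<lambda>b. \<pi> * b) ` B" and \<pi>: "\<pi> \<in> B"
  shows "R \<subseteq> (\<lambda>b. \<pi> * b) ` B"
proof -
  interpret cring "\<Omega>|(B)" by (rule cring_subring_of[OF B])
  have "R [^]\<^bsub>ideals_set (\<Omega>|(B))\<^esub> (1::nat) = R"
    by (rule monoid.nat_pow_eone[OF comm_monoid.axioms(1)[OF ideals_set_is_comm_monoid]])
       (use R in \<open>simp add: ideals_set_def\<close>)
  then have "R = Idl\<^bsub>\<Omega>|(B)\<^esub> P" using ram by (simp add: has_ramification_index_def)
  moreover have "ideal ((\<lambda>b. \<pi> * b) ` B) (\<Omega>|(B))"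
  proof (rule ideal_subring_ofI[OF B])
    show "(\<lambda>b. \<pi> * b) ` B \<subseteq> B" using subring_mult[OF B \<pi>] by auto
    show "0 \<in> (\<lambda>b. \<pi> * b) ` B" by (rule image_eqI[of _ _ 0]) (auto simp: subring_zero[OF B])
    show "x + y \<in> (\<lambda>b. \<pi> * b) ` B" if "x \<in> (\<lambda>b. \<pi> * b) ` B" "y \<in> (\<lambda>b. \<pi> * b) ` B" for x y
      using that subring_add[OF B] by (auto simp flip: distrib_left)
    show "a * x \<in> (\<lambda>b. \<pi> * b) ` B" if "a \<in> B" "x \<in> (\<lambda>b. \<pi> * b) ` B" for a x
      using that subring_mult[OF B] by (auto simp: mult.left_commute)
  qed
  ultimately show ?thesis using genideal_minimal P by simp
qed

section \<open>Algebraic elements and dimensions\<close>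

text \<open>Coefficient lists in HOL-Algebra begin with the leading coefficient, those of
  \<open>Poly\<close> with the constant term; hence \<open>rev\<close>.\<close>

lemma eval_eq_poly: "ring.eval \<Omega> xs x = poly (Poly (rev xs)) (x :: 'a::field)"
proof -
  interpret field "\<Omega> :: 'a ring" by (rule field_ambient)
  have pow: "y [^]\<^bsub>\<Omega>\<^esub> (k :: nat) = y ^ k" for y :: 'a and k
    by (induction k) (auto simp: nat_pow_Suc)
  show ?thesis by (induction xs) (auto simp: Poly_append poly_monom pow)
qed

lemma transcendental_nonzero:
  fixes K :: "'a::field set"
  assumes tr: "ring.transcendental \<Omega> K s" and f: "f \<in> polys_over K" "f \<noteq> 0"
  shows "poly f s \<noteq> 0"
proof
  assume "poly f s = 0"
  then have "ring.eval \<Omega> (rev (coeffs f)) s = \<zero>\<^bsub>\<Omega>\<^esub>" by (simp add: eval_eq_poly)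
  moreover have "rev (coeffs f) \<in> carrier (K[X]\<^bsub>\<Omega>\<^esub>)"
    using f by (auto simp: univ_poly_def polynomial_def hd_rev last_coeffs_eq_coeff_degree
        coeffs_def polys_over_def)
  ultimately have "rev (coeffs f) = []"
    using ring.eval_transcendental[OF ring_ambient] tr unfolding over_def by blast
  then show False using f(2) by simp
qed

lemma algebraic_obtain:
  fixes K :: "'a::field set"
  assumes K: "subring K \<Omega>" and alg: "ring.algebraic \<Omega> K x"
  obtains f where "f \<in> polys_over K" "f \<noteq> 0" "poly f x = 0"
proof -
  interpret field "\<Omega> :: 'a ring" by (rule field_ambient)
  have "a_kernel (K[X]\<^bsub>\<Omega>\<^esub>) \<Omega> (\<lambda>p. eval p x) \<noteq> {[]}"
    using trivial_ker_imp_transcendental[OF K, of x] alg by (auto simp: over_def)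
  moreover have "[] \<in> a_kernel (K[X]\<^bsub>\<Omega>\<^esub>) \<Omega> (\<lambda>p. eval p x)"
    by (auto simp: a_kernel_def' univ_poly_def)
  ultimately obtain xs where xs: "xs \<in> a_kernel (K[X]\<^bsub>\<Omega>\<^esub>) \<Omega> (\<lambda>p. eval p x)" "xs \<noteq> []"
    by blast
  then have p: "set xs \<subseteq> K" "hd xs \<noteq> 0" "poly (Poly (rev xs)) x = 0"
    by (auto simp: a_kernel_def' univ_poly_def polynomial_def eval_eq_poly)
  show ?thesis
  proof (rule that[of "Poly (rev xs)"])
    show "Poly (rev xs) \<in> polys_over K"
      using p(1) subring_zero[OF K] by (auto simp: polys_over_def nth_default_def rev_nth subset_iff)
    have "poly.coeff (Poly (rev xs)) (length xs - 1) = hd xs"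
      using xs(2) by (simp add: nth_default_def rev_nth hd_conv_nth)
    then show "Poly (rev xs) \<noteq> 0" using p(2) by (metis coeff_0)
    show "poly (Poly (rev xs)) x = 0" by (rule p(3))
  qed
qed

text \<open>The elements \<open>x ^ (q ^ j)\<close> are all roots of one polynomial over
  \<open>GF q\<close>, whose coefficients the Frobenius fixes. So two of them coincide, and
  injectivity of the Frobenius cancels the common exponent.\<close>

lemma algebraic_over_GF_iff:
  assumes q: "char_power TYPE('a::alg_closed_field) q"
  shows "ring.algebraic \<Omega> (GF q) (x :: 'a) \<longleftrightarrow> (\<exists>j\<ge>1. x ^ (q ^ j) = x)"
proof
  assume "ring.algebraic \<Omega> (GF q) x"
  then obtain f where f: "f \<in> polys_over (GF q)" "f \<noteq> 0" "poly f x = 0"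
    using algebraic_obtain[OF subring_GF[OF q]] by blast
  have step: "poly f (y ^ q) = 0" if "poly f y = 0" for y
  proof -
    have "map_poly (\<lambda>x. x ^ q) f = f"
      by (rule map_poly_id[OF subring_GF[OF q] hom_on_char_power[OF q] _ f(1)]) (simp add: GF_def)
    then show ?thesis
      using poly_map_poly[OF subring_UNIV hom_on_char_power[OF q], of f y] that char_power_gt_1[OF q]
      by (simp add: polys_over_def zero_power)
  qed
  have "poly f (x ^ (q ^ j)) = 0" for j
  proof (induction j)
    case (Suc j)
    from step[OF this] show ?case by (simp flip: power_mult add: mult.commute)
  qed (simp add: f(3))
  then have "range (\<lambda>j. x ^ (q ^ j)) \<subseteq> {y. poly f y = 0}" by auto
  then have "finite (range (\<lambda>j. x ^ (q ^ j)))"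
    using poly_roots_finite[OF f(2)] finite_subset by blast
  then have "\<not> inj (\<lambda>j. x ^ (q ^ j))" using finite_imageD infinite_UNIV_nat by blast
  then obtain i j where ij: "i < j" "x ^ (q ^ i) = x ^ (q ^ j)"
    unfolding inj_def by (metis nat_neq_iff)
  have "(x ^ (q ^ (j - i))) ^ (q ^ i) = x ^ (q ^ i)"
    using ij by (simp flip: power_mult power_add)
  \<comment> \<open>The exponent \<open>i = 0\<close> is separate because \<open>q ^ 0 = 1\<close>
    is not a \<open>char_power\<close>.\<close>
  moreover have "u = y" if "u ^ (q ^ i) = y ^ (q ^ i)" for u y :: 'a
  proof (cases "i = 0")
    case False
    then show ?thesis using char_power_inj[OF char_power_power[OF q, of i]] that by simp
  qed (use that in simp)
  ultimately show "\<exists>j\<ge>1. x ^ (q ^ j) = x" using ij(1) by (intro exI[of _ "j - i"]) auto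
next
  assume "\<exists>j\<ge>1. x ^ (q ^ j) = x"
  then obtain j where j: "j \<ge> 1" "x ^ (q ^ j) = x" by blast
  note gp = GF_poly[OF char_power_power[OF q j(1)]]
  note R = subring_GF[OF q]
  define g where "g = (monom 1 (q ^ j) - monom 1 1 :: 'a poly)"
  note gp = gp[folded g_def]
  have "g \<in> polys_over (GF q)"
    unfolding g_def
    by (intro polys_over_diff[OF R] polys_over_monom[OF R] subring_one[OF R])
  moreover have "g \<noteq> 0" using gp(2) by auto
  ultimately show "ring.algebraic \<Omega> (GF q) x"
    using transcendental_nonzero[of "GF q" x] gp(3)[of x] j(2) by auto
qed

text \<open>A norm argument: the product of the \<open>j\<close> Frobenius conjugates of
  \<open>f\<close> is invariant, so its coefficients lie in \<open>GF q\<close>, and it vanishes at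
  \<open>s\<close> if \<open>f\<close> does.\<close>

lemma transcendental_GF_power:
  assumes q: "char_power TYPE('a::alg_closed_field) q"
    and s: "\<And>f. f \<in> polys_over (GF q :: 'a set) \<Longrightarrow> f \<noteq> 0 \<Longrightarrow> poly f s \<noteq> 0"
    and j: "j \<ge> 1" and f: "f \<in> polys_over (GF (q ^ j) :: 'a set)" "f \<noteq> 0"
  shows "poly f s \<noteq> 0"
proof
  assume fs: "poly f s = 0"
  define \<phi> where "\<phi> i = map_poly (\<lambda>x :: 'a. x ^ (q ^ i))" for i
  have q0: "q ^ i > 0" for i using char_power_gt_1[OF q] by simp
  have co: "coeff (\<phi> i g) k = coeff g k ^ (q ^ i)" for i g k
    unfolding \<phi>_def using q0[of i] by (subst coeff_map_poly) auto
  have \<phi>0: "\<phi> 0 g = g" for g by (rule poly_eqI) (simp add: co)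
  have \<phi>_nz: "\<phi> i f \<noteq> 0" for i
  proof -
    have "coeff (\<phi> i f) (degree f) \<noteq> 0" using f(2) by (simp add: co)
    then show ?thesis by auto
  qed
  define P where "P = (\<Prod>i<j. \<phi> i f)"
  have "\<phi> 1 P = (\<Prod>i<j. \<phi> 1 (\<phi> i f))"
    unfolding P_def \<phi>_def[of 1]
    by (rule map_poly_prod[OF subring_UNIV])
       (use hom_on_char_power[OF q] in \<open>auto simp: polys_over_def\<close>)
  also have "\<dots> = (\<Prod>i<j. \<phi> (Suc i) f)"
    by (rule prod.cong) (auto intro!: poly_eqI simp: co mult.commute simp flip: power_mult)
  \<comment> \<open>The factors are shifted cyclically: the \<open>j\<close>-th conjugate is
    \<open>f\<close> again because the coefficients of \<open>f\<close> lie in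
    \<open>GF (q ^ j)\<close>.\<close>
  also have "\<dots> = P"
  proof -
    have "\<phi> j f = \<phi> 0 f"
      by (rule poly_eqI) (use polys_overD[OF f(1)] in \<open>auto simp: co GF_def\<close>)
    moreover have "(\<Prod>i<j. \<phi> (Suc i) f) * \<phi> 0 f = P * \<phi> j f"
      unfolding P_def using prod.lessThan_Suc_shift[of "\<lambda>i. \<phi> i f" j]
      by (simp add: mult.commute)
    ultimately show ?thesis using \<phi>_nz[of 0] by simp
  qed
  finally have inv: "\<phi> 1 P = P" .
  have "P \<in> polys_over (GF q)"
  proof (rule polys_overI)
    show "coeff P k \<in> GF q" for k
      using arg_cong[OF inv, of "\<lambda>g. coeff g k"] by (simp add: co GF_def)
  qed
  moreover have "P \<noteq> 0" unfolding P_def using \<phi>_nz by (simp add: prod_zero_iff)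
  ultimately have "poly P s \<noteq> 0" by (rule s)
  moreover have "poly P s = 0"
    unfolding P_def poly_prod using j fs \<phi>0[of f] by (intro prod_zero bexI[of _ 0]) auto
  ultimately show False by simp
qed

text \<open>Links the inductive notion of dimension with counting: a line extension by
  \<open>v\<close> outside \<open>E'\<close> is in bijection with \<open>K \<times> E'\<close>. A
  finite space is spanned by the list of its elements, so \<open>dim\<close> is meaningful
  here.\<close>

lemma finite_subspace_card:
  fixes K E :: "'a::field set"
  assumes K: "subfield K \<Omega>" "finite K" and E: "finite E" "0 \<in> E"
    "\<And>x y. x \<in> E \<Longrightarrow> y \<in> E \<Longrightarrow> x + y \<in> E" "\<And>c x. c \<in> K \<Longrightarrow> x \<in> E \<Longrightarrow> c * x \<in> E"
  shows "card E = card K ^ ring.dim \<Omega> K E"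
proof -
  interpret field "\<Omega> :: 'a ring" by (rule field_ambient)
  note RK = subfield_subring[OF K(1)]
  have "- x \<in> E" if "x \<in> E" for x
    using E(4)[of "- 1" x] that subring_uminus[OF RK subring_one[OF RK]] by simp
  then have "inv\<^bsub>add_monoid \<Omega>\<^esub> x \<in> E" if "x \<in> E" for x
    using that a_inv_ambient[of x] by (simp add: a_inv_def)
  then have "subgroup E (add_monoid \<Omega>)"
    by (intro group.subgroupI[OF a_group]) (use E in auto)
  then have sub: "subalgebra K E \<Omega>"
    using E(4) by (auto simp: subalgebra_def subalgebra_axioms_def)
  obtain Us where Us: "set Us = E" using finite_list[OF E(1)] by blast
  have "Span K Us = E"
    using subalgebra_Span_incl[OF K(1) sub, of Us] Span_base_incl[OF K(1), of Us] Us by auto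
  then have "finite_dimension K E" using Span_finite_dimension[OF K(1), of Us] by simp
  then have "dimension (dim K E) K E" using finite_dimensionE[OF K(1)] by (simp add: over_def)
  moreover have "finite E \<and> card E = card K ^ k" if "dimension k K E" for k E
    using that
  proof (induction k arbitrary: E)
    case 0
    then have "E = {0}" by (auto elim: dimension.cases)
    then show ?case by simp
  next
    case (Suc k)
    obtain v E' where v: "v \<notin> E'" "dimension k K E'" and E_eq: "E = line_extension K v E'"
      using Suc.prems by (auto elim: dimension.cases)
    have "finite_dimension K E'" using v(2) by (rule finite_dimensionI)
    then interpret E: subalgebra K E' \<Omega> by (rule finite_dimension_imp_subalgebra[OF K(1)])
    let ?f = "\<lambda>(c, u). c * v + u"
    have img: "line_extension K v E' = ?f ` (K \<times> E')"
    proof (rule Set.set_eqI)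
      show "x \<in> line_extension K v E' \<longleftrightarrow> x \<in> ?f ` (K \<times> E')" for x
        by (simp add: line_extension_mem_iff image_iff Bex_def)
    qed
    have "inj_on ?f (K \<times> E')"
    proof (rule inj_onI, clarify)
      fix c u c' u' assume *: "c \<in> K" "u \<in> E'" "c' \<in> K" "u' \<in> E'" "c * v + u = c' * v + u'"
      then have eq: "(c - c') * v = u' + (- u)" by (simp add: algebra_simps)
      have "- u \<in> E'" using E.m_inv_closed[OF *(2)] a_inv_ambient[of u] by (simp add: a_inv_def)
      then have in_E: "(c - c') * v \<in> E'" using E.m_closed[OF *(4), of "- u"] eq by simp
      have "c = c'"
      proof (rule ccontr)
        assume ne: "c \<noteq> c'"
        have "inverse (c - c') \<in> K" using * by (intro subfield_inverse[OF K(1)] subring_diff[OF RK])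
        then have "inverse (c - c') * ((c - c') * v) \<in> E'" using E.smult_closed in_E by simp
        moreover have "inverse (c - c') * ((c - c') * v) = v"
          using ne by (simp add: mult.assoc[symmetric] del: mult_minus_left)
        ultimately show False using v(1) by (simp only:)
      qed
      then show "c = c' \<and> u = u'" using *(5) by simp
    qed
    then show ?case
      using Suc.IH[OF v(2)] K(2) by (simp add: E_eq img card_image card_cartesian_product)
  qed
  ultimately show ?thesis by blast
qed

text \<open>Rank-nullity by counting: every non-empty fibre of \<open>g\<close> is a translate of
  the kernel.\<close>

lemma card_kernel_image:
  fixes g :: "'a::ab_group_add \<Rightarrow> 'a"
  assumes V: "finite V" "\<And>x y. x \<in> V \<Longrightarrow> y \<in> V \<Longrightarrow> x + y \<in> V" "\<And>x y. x \<in> V \<Longrightarrow> y \<in> V \<Longrightarrow> x - y \<in> V"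
    and g: "\<And>x y. x \<in> V \<Longrightarrow> y \<in> V \<Longrightarrow> g (x + y) = g x + g y"
  shows "card V = card {x \<in> V. g x = 0} * card (g ` V)"
proof -
  have "card {x \<in> V. g x = y} = card {x \<in> V. g x = 0}" if y: "y \<in> g ` V" for y
  proof -
    obtain x0 where x0: "x0 \<in> V" "y = g x0" using y by blast
    have sub: "g (x - x0) = g x - g x0" if "x \<in> V" for x
      using g[OF V(3)[OF that x0(1)] x0(1)] by (simp add: algebra_simps)
    have "bij_betw (\<lambda>x. x + x0) {x \<in> V. g x = 0} {x \<in> V. g x = y}"
      by (rule bij_betw_byWitness[of _ "\<lambda>x. x - x0"])
         (use x0 g V sub in auto)
    then show ?thesis by (simp add: bij_betw_same_card)
  qed
  then have "(\<Sum>y\<in>g ` V. card {x \<in> V. g x = y}) = card {x \<in> V. g x = 0} * card (g ` V)"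
    by simp
  moreover have "(\<Sum>y\<in>g ` V. card {x \<in> V. g x = y}) = (\<Sum>x\<in>V. 1)"
    using sum.group[OF V(1) finite_imageI[OF V(1)], of g g "\<lambda>_. 1 :: nat"] by simp
  ultimately show ?thesis by simp
qed

section \<open>The pencil of linearized polynomials\<close>

locale pencil_setup =
  fixes q n t r :: nat and l :: "'a::alg_closed_field poly" and s :: 'a
  assumes q: "char_power TYPE('a) q" and n: "n \<ge> 1" and t: "t \<ge> 1"
    and l_coeff: "\<And>i. coeff l i \<in> GF (q ^ n)"
    and linearized: "linearized_of_degree q r l" and normalized: "t_normalized q t l"
    and s_transcendental: "\<And>f. f \<in> polys_over (GF q) \<Longrightarrow> f \<noteq> 0 \<Longrightarrow> poly f s \<noteq> 0"
begin

definition a where "a i = coeff l (q ^ i)"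

definition M where "M = splitting_field (rational_function_field (q ^ n) s) (pencil q t l s)"

lemma q_gt_1: "q > 1"
  by (rule char_power_gt_1[OF q])

lemma q_power_eq_iff [simp]: "q ^ i = q ^ j \<longleftrightarrow> i = j"
  using q_gt_1 by (simp add: power_inject_exp)

text \<open>The last claim separates the two shapes of the pencil: normalization makes the
  coefficient at \<open>q ^ t\<close> zero, while the one at \<open>q ^ r\<close> is 1.\<close>

lemma l_eq: "l = (\<Sum>i\<le>r. monom (a i) (q ^ i))"
  and degree_l: "degree l = q ^ r" and a_r: "a r = 1" and a_0: "a 0 \<noteq> 0"
  and r_neq_t: "r \<noteq> t"
proof -
  obtain b where b: "b r \<noteq> 0" "l = (\<Sum>i\<le>r. monom (b i) (q ^ i))"
    using linearized by (auto simp: linearized_of_degree_def)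
  have co: "coeff l (q ^ j) = b j" if "j \<le> r" for j
    using that by (simp add: b(2) coeff_sum if_distrib sum.delta cong: if_cong)
  then have "a j = b j" if "j \<le> r" for j using that by (simp add: a_def)
  then show "l = (\<Sum>i\<le>r. monom (a i) (q ^ i))" by (subst b(2)) (auto intro!: sum.cong)
  have "degree l \<le> q ^ r"
    unfolding b(2)
    by (rule degree_sum_le)
       (use q_gt_1 in \<open>auto intro: order_trans[OF degree_monom_le] power_increasing\<close>)
  moreover have "coeff l (q ^ r) \<noteq> 0" using co[of r] b(1) by simp
  ultimately show d: "degree l = q ^ r" by (metis le_antisym le_degree)
  show ar: "a r = 1" using normalized d by (simp add: t_normalized_def a_def)
  show "a 0 \<noteq> 0" using normalized by (auto simp: t_normalized_def a_def)
  have "a t = 0" using normalized by (auto simp: t_normalized_def a_def)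
  with ar show "r \<noteq> t" by auto
qed

lemma poly_l: "poly l x = (\<Sum>i\<le>r. a i * x ^ (q ^ i))"
  by (subst l_eq) (simp add: poly_sum poly_monom)

lemma poly_pencil: "poly (pencil q t l c) x = poly l x - c * x ^ (q ^ t)"
  by (simp add: pencil_def poly_monom)

lemma q_power_add: "(x + y :: 'a) ^ (q ^ i) = x ^ (q ^ i) + y ^ (q ^ i)"
proof (cases "i = 0")
  case False
  then show ?thesis using char_power_add[OF char_power_power[OF q, of i]] by simp
qed simp

lemma pencil_add:
  "poly (pencil q t l c) (x + y) = poly (pencil q t l c) x + poly (pencil q t l c) y"
  by (simp add: poly_pencil poly_l q_power_add sum.distrib distrib_left)

lemma pencil_smult:
  assumes "b \<in> GF q" shows "poly (pencil q t l c) (b * x) = b * poly (pencil q t l c) x"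
proof -
  have b: "b ^ (q ^ i) = b" for i
    by (rule iterated_power_fixed) (use assms in \<open>simp add: GF_def\<close>)
  show ?thesis
    by (simp add: poly_pencil poly_l power_mult_distrib b sum_distrib_left algebra_simps)
qed

lemma pencil_uminus: "poly (pencil q t l c) (- x) = - poly (pencil q t l c) x"
  using pencil_smult[of "- 1" c x] subring_uminus[OF subring_GF[OF q] subring_one[OF subring_GF[OF q]]]
  by simp

lemma coeff_pencil: "coeff (pencil q t l c) 0 = 0" "coeff (pencil q t l c) 1 = a 0"
proof -
  have "coeff l 0 = 0" by (subst l_eq) (use q_gt_1 in \<open>auto simp: coeff_sum intro!: sum.neutral\<close>)
  then show "coeff (pencil q t l c) 0 = 0" using q_gt_1 by (simp add: pencil_def)
  show "coeff (pencil q t l c) 1 = a 0" using q_gt_1 t by (simp add: pencil_def a_def)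
qed

text \<open>All exponents except 1 are divisible by the characteristic, that of the subtracted term
  because \<open>t \<ge> 1\<close>. So every member of the pencil has simple roots.\<close>

lemma pderiv_pencil: "pderiv (pencil q t l c) = [:a 0:]"
proof (rule poly_eqI)
  fix k
  have z: "of_nat (q ^ i) = (0 :: 'a)" if "i \<noteq> 0" for i
    using of_nat_char_power[OF char_power_power[OF q, of i]] that by simp
  have "of_nat (Suc k) * coeff (pencil q t l c) (Suc k) = (if k = 0 then a 0 else 0)"
  proof (cases "\<exists>i. Suc k = q ^ i")
    case True
    then obtain i where i: "Suc k = q ^ i" by blast
    show ?thesis
    proof (cases "i = 0")
      case True
      then show ?thesis using i coeff_pencil(2)[of c] by simp
    next
      case False
      then have "q ^ i > 1" using q_gt_1 by (intro one_less_power) auto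
      then show ?thesis using i z[OF False] by auto
    qed
  next
    case False
    then have "q ^ i \<noteq> Suc k" for i by metis
    then have "coeff (pencil q t l c) (Suc k) = 0"
      by (subst pencil_def, subst l_eq) (simp add: coeff_sum)
    moreover have "k \<noteq> 0" using False by (metis One_nat_def power_0)
    ultimately show ?thesis by simp
  qed
  then show "coeff (pderiv (pencil q t l c)) k = coeff [:a 0:] k"
    by (simp add: coeff_pderiv coeff_pCons split: nat.split)
qed

lemma pencil_simple: "poly (pderiv (pencil q t l c)) x \<noteq> 0"
  using a_0 by (simp add: pderiv_pencil)

lemma degree_pencil_gt:
  assumes "r > t" shows "degree (pencil q t l c) = q ^ r" "lead_coeff (pencil q t l c) = 1"
proof -
  have lt: "q ^ t < q ^ r" using assms q_gt_1 by simp
  have "degree (monom c (q ^ t)) < degree l"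
    using lt degree_monom_le[of c "q ^ t"] degree_l by simp
  then show "degree (pencil q t l c) = q ^ r" "lead_coeff (pencil q t l c) = 1"
    using degree_l a_r lt r_neq_t
    by (simp_all add: pencil_def diff_conv_add_uminus degree_add_eq_left a_def del: add_uminus_conv_diff)
qed

text \<open>At \<open>c = 0\<close> the degree falls to \<open>q ^ r\<close> and the missing roots
  go to infinity; this is why \<open>r < t\<close> needs separate treatment.\<close>

lemma degree_pencil_lt:
  assumes "r < t" "c \<noteq> 0"
  shows "degree (pencil q t l c) = q ^ t" "lead_coeff (pencil q t l c) = - c"
proof -
  have lt: "q ^ r < q ^ t" using assms q_gt_1 by simp
  have "degree l < degree (- monom c (q ^ t))"
    using lt degree_l assms(2) by (simp add: degree_monom_eq)
  then have d: "degree (pencil q t l c) = q ^ t"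
    using assms(2) by (simp add: pencil_def diff_conv_add_uminus degree_add_eq_right degree_monom_eq
        del: add_uminus_conv_diff)
  then show "degree (pencil q t l c) = q ^ t" .
  show "lead_coeff (pencil q t l c) = - c"
    unfolding d using lt degree_l by (simp add: pencil_def coeff_eq_0)
qed

lemma s_nonzero: "s \<noteq> 0"
proof -
  have "poly (monom 1 1) s \<noteq> 0"
    by (rule s_transcendental)
       (use polys_over_monom[OF subring_GF[OF q] subring_one[OF subring_GF[OF q]]] in auto)
  then show ?thesis by (simp add: poly_monom)
qed

lemma pencil_nonzero: "pencil q t l c \<noteq> 0"
  using pderiv_pencil[of c] a_0 by auto

end

section \<open>The splitting field and its Galois groups at a fixed level \<open>m\<close>\<close>

locale pencil_level = pencil_setup +
  fixes m :: nat
  assumes m: "m \<ge> 1"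
begin

abbreviation N where "N \<equiv> q ^ (n * m)"

abbreviation K where "K \<equiv> rational_function_field N s"

lemma N: "char_power TYPE('a) N"
  using char_power_power[OF q, of "n * m"] n m by simp

lemma GF_n_le: "GF (q ^ n) \<subseteq> (GF N :: 'a set)"
  using GF_power_mono[OF char_power_power[OF q n], of m] by (simp add: power_mult)

lemma GF_q_le: "GF q \<subseteq> (GF N :: 'a set)"
  by (rule GF_power_mono[OF q])

lemma subfield_K: "subfield K \<Omega>"
  unfolding rational_function_field_def by (rule subfield_generate_field)

lemma GF_le_K: "GF N \<subseteq> K" and s_in_K: "s \<in> K"
  using generate_field_superset[of "insert s (GF N)"] by (auto simp: rational_function_field_def)

lemma a_in_GF: "a i \<in> GF N"
  using l_coeff GF_n_le by (auto simp: a_def)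

lemma pencil_over:
  assumes S: "subring S \<Omega>" "GF N \<subseteq> S" "c \<in> S"
  shows "pencil q t l c \<in> polys_over S"
  unfolding pencil_def
  by (intro polys_over_diff[OF S(1)] polys_over_monom[OF S(1)] S(3) polys_overI)
     (use l_coeff GF_n_le S(2) in blast)

sublocale separable_splitting K "pencil q t l s"
proof (rule separable_splitting.intro)
  show "subfield K \<Omega>" by (rule subfield_K)
  show "pencil q t l s \<in> polys_over K"
    by (rule pencil_over[OF subfield_subring[OF subfield_K] GF_le_K s_in_K])
  show "pencil q t l s \<noteq> 0" by (rule pencil_nonzero)
  show "poly (pderiv (pencil q t l s)) x \<noteq> 0" for x by (rule pencil_simple)
qed

lemma V_iff: "x \<in> V \<longleftrightarrow> poly (pencil q t l s) x = 0"
  by (simp add: V_def)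

lemma V_zero: "0 \<in> V"
  and V_add: "x \<in> V \<Longrightarrow> y \<in> V \<Longrightarrow> x + y \<in> V"
  and V_uminus: "x \<in> V \<Longrightarrow> - x \<in> V"
  and V_smult: "b \<in> GF q \<Longrightarrow> x \<in> V \<Longrightarrow> b * x \<in> V"
  using coeff_pencil(1)[of s] by (auto simp: V_iff pencil_add pencil_uminus pencil_smult poly_0_coeff_0)

lemma V_diff: "x \<in> V \<Longrightarrow> y \<in> V \<Longrightarrow> x - y \<in> V"
  using V_add[of x "- y"] V_uminus[of y] by simp

lemma card_V: "card V = q ^ max r t"
proof -
  have "card V = degree (pencil q t l s)"
    unfolding V_def by (rule simple_roots_factorization(1)[OF pencil_nonzero pencil_simple])
  also have "\<dots> = q ^ max r t"
    using r_neq_t degree_pencil_gt degree_pencil_lt[OF _ s_nonzero] by (cases "r > t") (auto simp: max_def)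
  finally show ?thesis .
qed

lemma V_subset_M: "V \<subseteq> M"
  unfolding M_def splitting_field_def V_def
  using generate_field_superset[of "rational_function_field (q ^ n) s \<union> {x. poly (pencil q t l s) x = 0}"]
  by blast

lemma M_eq: "M = generate_field \<Omega> (insert s (GF (q ^ n)) \<union> V)"
  unfolding M_def splitting_field_def rational_function_field_def generate_field_generate_field_Un V_def ..

text \<open>The compositum is itself the splitting field of the pencil over the enlarged base, so
  the Galois theory of \<open>separable_splitting\<close> applies to \<open>G_arith\<close>.\<close>

lemma M_ext_eq: "M_ext q n m M = L"
proof -
  have "insert s (GF (q ^ n)) \<union> V \<union> GF N = insert s (GF N) \<union> V" using GF_n_le by auto
  then show ?thesis
    unfolding L_def unfolding M_ext_def M_eq rational_function_field_def generate_field_generate_field_Un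
    by simp
qed

abbreviation \<kappa> where "\<kappa> \<equiv> const_field q n m M"

lemma const_iff: "u \<in> \<kappa> \<longleftrightarrow> u \<in> L \<and> (\<exists>j\<ge>1. u ^ (q ^ j) = u)"
  unfolding const_field_def M_ext_eq using algebraic_over_GF_iff[OF q, of u] by auto

lemma GF_le_const: "GF N \<subseteq> \<kappa>"
proof
  fix u :: 'a assume u: "u \<in> GF N"
  then have "u \<in> L" using GF_le_K K_le_L by blast
  moreover have "n * m \<ge> 1" using n m by simp
  ultimately show "u \<in> \<kappa>" unfolding const_iff using u unfolding GF_def by blast
qed

lemma G_arith_eq: "G_arith q n m s M = Gal L K"
  by (simp add: G_arith_def M_ext_eq)

lemma G_geomD:
  assumes "h \<in> carrier (G_geom q n m s M)"
  shows "h \<in> carrier (Gal L K)" "u \<in> \<kappa> \<Longrightarrow> h u = u"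
proof -
  let ?E = "generate_field \<Omega> (insert s \<kappa>)"
  have h: "h \<in> carrier (Gal L ?E)" using assms by (simp add: G_geom_def M_ext_eq)
  have "K \<subseteq> ?E"
    unfolding rational_function_field_def by (rule generate_field_mono) (use GF_le_const in auto)
  from Gal_mono[OF this] h show "h \<in> carrier (Gal L K)" by blast
  show "h u = u" if "u \<in> \<kappa>"
    using h that generate_field_superset[of "insert s \<kappa>"] unfolding carrier_Gal_iff by blast
qed

lemma id_in_G_geom: "id \<in> carrier (G_geom q n m s M)"
  unfolding G_geom_def by (rule id_in_Gal)

text \<open>The choice of a representative is harmless: each has the form
  \<open>\<gamma> \<circ> h\<close> with \<open>h\<close> trivial on the constants.\<close>

lemma induces_Frobenius_iff:
  "induces_Frobenius q n m s M \<gamma> \<longleftrightarrow> (\<forall>u\<in>\<kappa>. \<gamma> u = u ^ N)"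
proof -
  let ?S = "\<gamma> <#\<^bsub>Gal L K\<^esub> carrier (G_geom q n m s M)"
  have S: "?S = (\<lambda>h. \<gamma> \<circ> h) ` carrier (G_geom q n m s M)"
    by (auto simp: l_coset_def Gal_def)
  then have "?S \<noteq> {}" using id_in_G_geom by blast
  then have "(SOME \<gamma>'. \<gamma>' \<in> ?S) \<in> ?S" by (simp add: some_in_eq)
  then obtain h where h: "h \<in> carrier (G_geom q n m s M)" "(SOME \<gamma>'. \<gamma>' \<in> ?S) = \<gamma> \<circ> h"
    unfolding S by blast
  have "(SOME \<gamma>'. \<gamma>' \<in> ?S) u = \<gamma> u" if "u \<in> \<kappa>" for u
    unfolding h(2) using G_geomD(2)[OF h(1) that] by simp
  then show ?thesis
    unfolding induces_Frobenius_def const_restriction_def const_Frobenius_def G_arith_eq fun_eq_iff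
    by auto
qed

text \<open>Counting \<open>V\<close> by kernel and image gives \<open>q ^ max r t\<close> as the
  number of fixed vectors times \<open>q ^ rk\<close>. At most \<open>q\<close> fixed vectors
  therefore means \<open>max r t \<le> rk + 1\<close>.\<close>

lemma rank_ge_iff:
  assumes \<sigma>: "\<sigma> \<in> carrier (Gal L K)"
  shows "rk q V (\<lambda>v. \<sigma> v - v) \<ge> max r t - 1 \<longleftrightarrow> card {v \<in> V. \<sigma> v = v} \<le> q"
proof -
  define g where "g = (\<lambda>v. \<sigma> v - v)"
  note R = subfield_subring[OF L]
  have g_add: "g (x + y) = g x + g y" if "x \<in> V" "y \<in> V" for x y
    using hom_on_add[OF GalD(1)[OF \<sigma>], of x y] that V_le_L by (auto simp: g_def)
  have g_smult: "g (b * x) = b * g x" if b: "b \<in> GF q" and x: "x \<in> V" for b x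
  proof -
    have bK: "b \<in> K" using b GF_q_le GF_le_K by blast
    then have "\<sigma> (b * x) = b * \<sigma> x"
      using hom_on_mult[OF GalD(1)[OF \<sigma>], of b x] GalD(2)[OF \<sigma> bK] x V_le_L K_le_L by auto
    then show ?thesis by (simp add: g_def algebra_simps)
  qed
  have "card (g ` V) = card (GF q :: 'a set) ^ ring.dim \<Omega> (GF q) (g ` V)"
  proof (rule finite_subspace_card[OF subfield_GF[OF q] finite_GF[OF q]])
    show "finite (g ` V)" using finite_V by simp
    have "g 0 = 0" using hom_on_zero[OF GalD(1)[OF \<sigma>] R] by (simp add: g_def)
    then show "0 \<in> g ` V" using V_zero by (metis image_eqI)
    show "x + y \<in> g ` V" if xy: "x \<in> g ` V" "y \<in> g ` V" for x y
    proof -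
      obtain u v where "u \<in> V" "v \<in> V" "x = g u" "y = g v" using xy by blast
      then show ?thesis using g_add[of u v] V_add[of u v] by (metis image_eqI)
    qed
    show "b * x \<in> g ` V" if bx: "b \<in> GF q" "x \<in> g ` V" for b x
    proof -
      obtain u where "u \<in> V" "x = g u" using bx by blast
      then show ?thesis using g_smult[OF bx(1)] V_smult[OF bx(1)] by (metis image_eqI)
    qed
  qed
  then have im: "card (g ` V) = q ^ rk q V g" by (simp add: rk_def card_GF[OF q])
  have "card V = card {x \<in> V. g x = 0} * card (g ` V)"
    by (rule card_kernel_image[OF finite_V V_add V_diff g_add])
  then have eq: "q ^ max r t = card {v \<in> V. \<sigma> v = v} * q ^ rk q V g"
    by (simp add: card_V im) (simp add: g_def)
  have "card {v \<in> V. \<sigma> v = v} \<le> q \<longleftrightarrow> q ^ max r t \<le> q ^ Suc (rk q V g)"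
    unfolding eq using q_gt_1 by simp
  also have "\<dots> \<longleftrightarrow> max r t \<le> Suc (rk q V g)"
    using q_gt_1 by (intro power_increasing_iff) simp
  finally show ?thesis by (auto simp: g_def)
qed

end

lemma (in pencil_level) GF_nonunit_zero:
  assumes "valuation_subring L B" "b \<in> GF N" "b \<in> valuation_subring.nonunits B"
  shows "b = 0"
  using assms valuation_subring.root_of_unity_not_nonunit(2)[OF assms(1), of b N]
    char_power_gt_1[OF N] GF_le_K K_le_L by (auto simp: GF_def)

text \<open>The points of \<open>V\<close> stay distinct modulo \<open>\<mm>\<close>, since the derivative of the pencil is a unit.\<close>

lemma (in prime_ideal_of_subring) small_root_zero:
  assumes f: "f \<in> polys_over B" "coeff f 0 = 0" "coeff f 1 \<notin> \<mm>"
    and w: "w \<in> B" "w \<in> \<mm>" "poly f w = 0"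
  shows "w = 0"
proof (rule ccontr)
  assume w0: "w \<noteq> 0"
  obtain f1 where f1: "f = pCons 0 f1" using f(2) by (metis pCons_cases coeff_pCons_0)
  obtain b h where h: "f1 = pCons b h" by (rule pCons_cases)
  have b: "coeff f 1 = b" using f1 h by simp
  have hB: "h \<in> polys_over B"
  proof (rule polys_overI)
    show "coeff h i \<in> B" for i using polys_overD[OF f(1), of "Suc (Suc i)"] f1 h by simp
  qed
  have "b + w * poly h w = 0" using w(3) w0 by (simp add: f1 h)
  then have "b = - (poly h w * w)" by (simp add: eq_neg_iff_add_eq_0 mult.commute)
  also have "\<dots> \<in> \<mm>" by (intro uminus mult poly_in_subring[OF B] hB w)
  finally show False using f(3) b by simp
qed


section \<open>From scattered polynomials to ranks\<close>

context pencil_level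
begin

text \<open>A fixed vector is congruent to its own \<open>N\<close>-th power, so by the
  factorization of \<open>X ^ N - X\<close> it is congruent to some \<open>\<rho> v\<close> in
  \<open>GF N\<close>. This residue is a root of the pencil at \<open>c\<close>, and
  \<open>small_root_zero\<close> makes \<open>\<rho>\<close> injective.\<close>

lemma fixed_points_of_Frobenius:
  assumes scat: "scattered q n m t l"
    and B: "valuation_subring L B" "GF N \<subseteq> B" "V \<subseteq> B"
    and c: "c \<in> GF N" "s - c \<in> valuation_subring.nonunits B"
    and \<sigma>: "\<And>x. x \<in> B \<Longrightarrow> \<sigma> x - x ^ N \<in> valuation_subring.nonunits B"
  shows "card {v \<in> V. \<sigma> v = v} \<le> q"
proof -
  interpret B: valuation_subring L B by (rule B(1))
  note RB = B.\<O>(1)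
  let ?W = "{v \<in> V. \<sigma> v = v}"
  note GF_unit = GF_nonunit_zero[OF B(1)]
  have "s - c \<in> B" using c(2) by (auto simp: B.nonunits_def)
  then have sB: "s \<in> B" using subring_add[OF RB, of "s - c" c] c(1) B(2) by auto
  have pB: "pencil q t l s \<in> polys_over B" by (rule pencil_over[OF RB B(2) sB])
  have "\<exists>b\<in>GF N. v - b \<in> B.nonunits" if v: "v \<in> ?W" for v
  proof -
    have vB: "v \<in> B" using v B(3) by auto
    have "v - v ^ N \<in> B.nonunits" using \<sigma>[OF vB] v by simp
    from B.uminus[OF this] have "(\<Prod>b\<in>GF N. v - b) \<in> B.nonunits"
      by (simp add: GF_factorization[OF N])
    then show ?thesis
      by (rule B.prod[OF finite_GF[OF N], rotated]) (use vB B(2) subring_diff[OF RB] in auto)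
  qed
  then obtain \<rho> where \<rho>: "\<And>v. v \<in> ?W \<Longrightarrow> \<rho> v \<in> GF N \<and> v - \<rho> v \<in> B.nonunits" by metis
  have "inj_on \<rho> ?W"
  proof (rule inj_onI)
    fix v v' assume v: "v \<in> ?W" "v' \<in> ?W" "\<rho> v = \<rho> v'"
    have "(v - \<rho> v) - (v' - \<rho> v') \<in> B.nonunits" using \<rho>[OF v(1)] \<rho>[OF v(2)] B.diff by blast
    then have d: "v - v' \<in> B.nonunits" using v(3) by simp
    have "v - v' \<in> V" using v by (auto intro: V_diff)
    moreover have "a 0 \<notin> B.nonunits" using GF_unit[OF a_in_GF] a_0 by blast
    ultimately have "v - v' = 0"
      using B.small_root_zero[OF pB coeff_pencil(1), of "v - v'"] d B(3)
      by (auto simp: V_iff coeff_pencil(2)[unfolded One_nat_def])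
    then show "v = v'" by simp
  qed
  moreover have "\<rho> ` ?W \<subseteq> {x \<in> GF N. poly (pencil q t l c) x = 0}"
  proof clarify
    fix v assume v: "v \<in> V" "\<sigma> v = v"
    then have b: "\<rho> v \<in> GF N" "v - \<rho> v \<in> B.nonunits" using \<rho>[of v] by auto
    have "poly (pencil q t l s) v - poly (pencil q t l s) (\<rho> v) \<in> B.nonunits"
      by (rule B.poly_congruent[OF pB]) (use v b B(2,3) in auto)
    then have 1: "- poly (pencil q t l s) (\<rho> v) \<in> B.nonunits" using v by (simp add: V_iff)
    \<comment> \<open>Replacing \<open>s\<close> by \<open>c\<close> changes the value of the pencil
      by a multiple of \<open>s - c\<close>; the new value lies in \<open>GF N\<close>, where 0 is
      the only non-unit.\<close>
    have "\<rho> v ^ (q ^ t) * (s - c) \<in> B.nonunits"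
      by (rule B.mult[OF subring_power[OF RB] c(2)]) (use b B(2) in auto)
    from B.diff[OF this 1] have "poly (pencil q t l c) (\<rho> v) \<in> B.nonunits"
      by (simp add: poly_pencil algebra_simps)
    moreover have "poly (pencil q t l c) (\<rho> v) \<in> GF N"
      by (rule poly_in_subring[OF subring_GF[OF N] pencil_over[OF subring_GF[OF N] subset_refl c(1)] b(1)])
    ultimately show "\<rho> v \<in> GF N \<and> poly (pencil q t l c) (\<rho> v) = 0" using GF_unit b(1) by blast
  qed
  ultimately have "card ?W \<le> card {x \<in> GF N. poly (pencil q t l c) x = 0}"
    by (rule card_inj_on_le) (use finite_GF[OF N] in auto)
  also have "\<dots> \<le> q" using scat c(1) by (auto simp: scattered_def)
  finally show ?thesis .
qed

text \<open>
  For \<open>r < t\<close> the place \<open>s = 0\<close> is ramified: an element \<open>v\<close> of \<open>V\<close> with a pole satisfies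
  \<open>s = v ^ - (q ^ t - q ^ r) * u\<close> with \<open>u\<close> integral.
\<close>

lemma ramified_at_zero:
  assumes rt: "r < t" "t \<ge> 2"
    and B: "valuation_subring L B" "GF N \<subseteq> B" and s: "s \<in> valuation_subring.nonunits B"
  shows "\<not> valuation_subring.nonunits B \<subseteq> (\<lambda>b. s * b) ` B"
proof
  interpret B: valuation_subring L B by (rule B(1))
  note RB = B.\<O>(1)
  assume principal: "B.nonunits \<subseteq> (\<lambda>b. s * b) ` B"
  \<comment> \<open>If all roots were integral, comparing the coefficients of \<open>x\<close> in
    the factorization with leading coefficient \<open>- s\<close> would make the unit
    \<open>a 0\<close> a multiple of \<open>s\<close>.\<close>
  have "\<not> V \<subseteq> B"
  proof
    assume VB: "V \<subseteq> B"
    define g where "g = (\<Prod>v\<in>V. [:- v, 1:])"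
    have g: "g \<in> polys_over B"
      unfolding g_def using VB
      by (intro polys_over_prod[OF RB] polys_over_linear[OF RB] subring_uminus[OF RB]) auto
    have "pencil q t l s = Polynomial.smult (lead_coeff (pencil q t l s)) g"
      unfolding g_def V_def by (rule simple_roots_factorization(2)[OF pencil_nonzero pencil_simple])
    then have "pencil q t l s = Polynomial.smult (- s) g"
      using degree_pencil_lt(2)[OF rt(1) s_nonzero] by simp
    then have "a 0 = - (coeff g 1 * s)" using coeff_pencil(2)[of s] by (simp add: mult.commute)
    also have "\<dots> \<in> B.nonunits" by (intro B.uminus B.mult polys_overD[OF g] s)
    finally show False using a_0 GF_nonunit_zero[OF B(1) a_in_GF] by simp
  qed
  then obtain v where v: "v \<in> V" "v \<notin> B" by blast
  define w where "w = inverse v"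
  have w: "w \<in> B.nonunits"
    unfolding w_def by (rule B.inverse_nonunit) (use v V_le_L in auto)
  have wB: "w \<in> B" using w by (auto simp: B.nonunits_def)
  have v0: "v \<noteq> 0" using v(2) subring_zero[OF RB] by auto
  \<comment> \<open>Here \<open>t \<ge> 2\<close> enters: already \<open>q ^ t - q ^ (t - 1)\<close>
    is at least \<open>q\<close>, so a factor \<open>w ^ 2\<close> can be split off from every term
    of \<open>s\<close>.\<close>
  have exp: "q ^ t - q ^ i \<ge> 2" if "i \<le> r" for i
  proof -
    have "q ^ i \<le> q ^ (t - 1)" using that rt q_gt_1 by (intro power_increasing) auto
    moreover have "q ^ t = q * q ^ (t - 1)" using rt(2) by (cases t) auto
    then have "2 * q ^ (t - 1) \<le> q ^ t" using q_gt_1 by simp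
    moreover have "q \<le> q ^ (t - 1)" using rt(2) q_gt_1 by (intro self_le_power) auto
    ultimately show ?thesis using q_gt_1 by linarith
  qed
  define u where "u = (\<Sum>i\<le>r. a i * w ^ (q ^ t - q ^ i - 2))"
  have u: "u \<in> B"
    unfolding u_def using a_in_GF B(2) wB by (intro subring_closed[OF RB]) auto
  have "s * v ^ (q ^ t) = poly l v" using v(1) by (simp add: V_iff poly_pencil)
  then have "s = w ^ (q ^ t) * poly l v" using v0 by (simp add: w_def field_simps power_inverse)
  also have "\<dots> = (\<Sum>i\<le>r. a i * (w ^ (q ^ t) * v ^ (q ^ i)))"
    by (simp add: poly_l sum_distrib_left mult_ac)
  also have "\<dots> = (\<Sum>i\<le>r. w ^ 2 * (a i * w ^ (q ^ t - q ^ i - 2)))"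
  proof (rule sum.cong[OF refl])
    fix i assume "i \<in> {..r}"
    then have e: "q ^ t = 2 + (q ^ t - q ^ i - 2) + q ^ i" using exp[of i] by simp
    have "w ^ (q ^ t) = w ^ 2 * w ^ (q ^ t - q ^ i - 2) * w ^ (q ^ i)"
      by (subst e) (simp only: power_add)
    moreover have "w ^ (q ^ i) * v ^ (q ^ i) = 1"
      using v0 by (simp add: w_def flip: power_mult_distrib)
    ultimately show "a i * (w ^ (q ^ t) * v ^ (q ^ i)) = w ^ 2 * (a i * w ^ (q ^ t - q ^ i - 2))"
      by (simp add: mult_ac)
  qed
  also have "\<dots> = w ^ 2 * u" by (simp add: u_def sum_distrib_left)
  finally have su: "s = w ^ 2 * u" .
  \<comment> \<open>Combining \<open>w = s * b\<close> with \<open>s = w ^ 2 * u\<close> and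
    cancelling \<open>w\<close> leaves 1 as a multiple of the non-unit \<open>w\<close>.\<close>
  obtain b where b: "b \<in> B" "w = s * b" using principal w by blast
  have "w * 1 = w * (u * b * w)" using b(2) su by (simp add: power2_eq_square mult_ac)
  moreover have "w \<noteq> 0" using v0 by (simp add: w_def)
  ultimately have "1 = u * b * w" by (metis mult_left_cancel)
  moreover have "u * b * w \<in> B.nonunits" by (intro B.mult subring_mult[OF RB] u b w)
  ultimately show False using B.not_one by simp
qed

text \<open>If the leading coefficient of the pencil is a unit at the place, then \<open>V\<close>
  is integral there and fixed vectors can be counted. Otherwise \<open>r < t\<close> and the place
  lies over \<open>s = 0\<close>; for \<open>t \<ge> 2\<close> it would be ramified, and for
  \<open>t = 1\<close> the bound to prove is 0.\<close>

lemma rank_of_Frobenius: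
  assumes scat: "scattered q n m t l" and \<sigma>: "\<sigma> \<in> carrier (Gal L K)"
    and Frob: "Frobenius_of_rational_place q n m s M \<sigma>"
  shows "rk q V (\<lambda>v. \<sigma> v - v) \<ge> max r t - 1"
proof -
  obtain A P B R where P: "place (GF N) K A P" "s \<in> A" "place_has_degree (GF N) A P 1"
    and unram: "unramified P \<kappa> L" and R: "place \<kappa> L B R" "P \<subseteq> R" "Frobenius_element A P B R \<sigma>"
    using Frob unfolding Frobenius_of_rational_place_def M_ext_eq by blast
  interpret A: valuation_subring K A by (rule place_imp_valuation_subring(1)[OF subfield_K P(1)])
  interpret B: valuation_subring L B by (rule place_imp_valuation_subring(1)[OF L R(1)])
  have P_eq: "P = A.nonunits" by (rule place_imp_valuation_subring(2)[OF subfield_K P(1)])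
  have R_eq: "R = B.nonunits" by (rule place_imp_valuation_subring(2)[OF L R(1)])
  note RB = B.\<O>(1)
  have GF_A: "GF N \<subseteq> A" using P(1) by (auto simp: place_def valuation_ring_def)
  have "\<kappa> \<subseteq> B" using R(1) by (auto simp: place_def valuation_ring_def)
  then have GF_B: "GF N \<subseteq> B" using GF_le_const by auto
  note deg1 = place_degree_one[OF subfield_K subfield_GF[OF N] P(1,3)]
  have P_B: "P \<subseteq> B" using R(2) by (auto simp: R_eq B.nonunits_def)
  \<comment> \<open>Lying above is expressed through \<open>P\<close> alone. The inclusion of rings
    comes from degree one, because \<open>A\<close> is the sum of \<open>P\<close> and
    \<open>GF N\<close>.\<close>
  have AB: "A \<subseteq> B"
  proof
    fix x assume "x \<in> A"
    then obtain b where "b \<in> GF N" "x - b \<in> P" using deg1(1) by blast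
    then have "x - b + b \<in> B" using P_B GF_B by (intro subring_add[OF RB]) auto
    then show "x \<in> B" by simp
  qed
  obtain c where c: "c \<in> GF N" "s - c \<in> P" using deg1(1)[OF P(2)] by blast
  have sB: "s \<in> B" using P(2) AB by auto
  have sc: "s - c \<in> B.nonunits" using c(2) R(2) R_eq by auto
  have \<sigma>B: "\<sigma> x - x ^ N \<in> B.nonunits" if "x \<in> B" for x
    using R(3) that by (auto simp: Frobenius_element_def deg1(2) card_GF[OF N] R_eq)
  have pB: "pencil q t l s \<in> polys_over B" by (rule pencil_over[OF RB GF_B sB])
  show ?thesis
  proof (cases "lead_coeff (pencil q t l s) \<in> B.nonunits")
    case False
    then have "V \<subseteq> B"
      using B.integrally_closed[OF pB] V_le_L by (auto simp: V_iff)
    then show ?thesis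
      unfolding rank_ge_iff[OF \<sigma>]
      by (rule fixed_points_of_Frobenius[OF scat B.valuation_subring_axioms GF_B _ c(1) sc \<sigma>B])
  next
    case True
    then have rt: "r < t" using r_neq_t degree_pencil_gt(2)[of s] B.not_one by (cases "r > t") auto
    have "- s \<in> B.nonunits" using True degree_pencil_lt(2)[OF rt s_nonzero] by simp
    from B.uminus[OF this] have s: "s \<in> B.nonunits" by simp
    then have "c \<in> B.nonunits" using B.diff[OF s sc] by simp
    then have c0: "c = 0" by (rule GF_nonunit_zero[OF B.valuation_subring_axioms c(1)])
    have "t < 2"
    proof (rule ccontr)
      assume "\<not> t < 2"
      then have t2: "t \<ge> 2" by simp
      have sA: "s - 0 \<in> A.nonunits" using c(2) c0 P_eq by simp
      \<comment> \<open>As \<open>s\<close> is a uniformizer of the place below, unramifiedness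
        would make it generate the non-units above.\<close>
      have "P \<subseteq> (\<lambda>b. s * b) ` B"
      proof
        fix z assume z: "z \<in> P"
        then have zA: "z \<in> A.nonunits" "z \<in> generate_field \<Omega> (insert s (GF N))"
          using A.\<O>(2) by (auto simp: P_eq A.nonunits_def rational_function_field_def)
        obtain y where "y \<in> A" "z = (s - 0) * y"
          by (rule A.rational_nonunit[OF subfield_GF[OF N] GF_A
                subring_zero[OF subring_GF[OF N]] P(2) sA zA(2,1)])
        then show "z \<in> (\<lambda>b. s * b) ` B" using AB by auto
      qed
      moreover have "has_ramification_index P B R 1"
        using unram R(1,2) by (auto simp: unramified_def)
      moreover have "ideal R (\<Omega>|(B))"
        using R(1) by (auto simp: place_def intro: maximalideal.axioms)
      ultimately have "R \<subseteq> (\<lambda>b. s * b) ` B" using unramified_principal[OF RB _ _ _ sB] by blast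
      then show False
        using ramified_at_zero[OF rt t2 B.valuation_subring_axioms GF_B s] by (simp add: R_eq)
    qed
    then show ?thesis using rt by simp
  qed
qed

end

section \<open>Frobenius elements over rational points\<close>

context pencil_level
begin

lemma poly_s_nonzero: "f \<in> polys_over (GF N) \<Longrightarrow> f \<noteq> 0 \<Longrightarrow> poly f s \<noteq> 0"
  using transcendental_GF_power[OF q s_transcendental, of "n * m" f] n m by simp

text \<open>Chevalley's theorem for the polynomial ring in \<open>s\<close> and the element
  \<open>s - c\<close> provides a point of the splitting field over \<open>s = c\<close>, also where
  \<open>V\<close> has poles.\<close>

lemma exists_valuation_at:
  assumes c: "c \<in> GF N"
  obtains \<O> where "valuation_subring L \<O>" "GF N \<subseteq> \<O>" "s \<in> \<O>"
    "s - c \<in> valuation_subring.nonunits \<O>"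
proof -
  note R = subring_GF[OF N]
  define A where "A = (\<lambda>f. poly f s) ` polys_over (GF N)"
  have A: "subring A \<Omega>" unfolding A_def by (rule subring_poly_values[OF R])
  have GF_A: "GF N \<subseteq> A" and sA: "s \<in> A" using poly_values_superset[OF R, of s] by (auto simp: A_def)
  have AL: "A \<subseteq> L"
    unfolding A_def
    by (rule poly_values_least[OF R subfield_subring[OF L]]) (use GF_le_K s_in_K K_le_L in auto)
  have lin: "[:- c, 1:] \<in> polys_over (GF N)"
    using c by (intro polys_over_linear[OF R] subring_uminus[OF R])
  have sc: "s - c \<noteq> 0" using poly_s_nonzero[OF lin] by simp
  have scA: "s - c \<in> A" using sA GF_A c subring_diff[OF A] by blast
  have "inverse (s - c) \<notin> A"
  proof
    assume "inverse (s - c) \<in> A"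
    then obtain f where f: "inverse (s - c) = poly f s" "f \<in> polys_over (GF N)" by (auto simp: A_def)
    \<comment> \<open>A polynomial inverse of \<open>s - c\<close> would make \<open>s\<close> a
      root of \<open>?g\<close>, which is non-zero because its value at \<open>c\<close> is
      \<open>-1\<close>.\<close>
    let ?g = "[:- c, 1:] * f - 1"
    have "?g \<in> polys_over (GF N)"
      by (intro polys_over_diff[OF R] polys_over_mult[OF R] lin f polys_over_one[OF R])
    moreover have "poly ?g c \<noteq> 0" by simp
    then have "?g \<noteq> 0" by (metis poly_0)
    ultimately have "poly ?g s \<noteq> 0" by (rule poly_s_nonzero)
    moreover have "poly ?g s = (s - c) * inverse (s - c) - 1" by (simp add: f(1) algebra_simps)
    ultimately show False using sc by simp
  qed
  then obtain \<O> where \<O>: "valuation_subring L \<O>" "A \<subseteq> \<O>" "inverse (s - c) \<notin> \<O>"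
    by (rule exists_valuation_subring[OF L A AL scA sc])
  have "s - c \<in> valuation_subring.nonunits \<O>"
    using \<O>(2,3) scA by (auto simp: valuation_subring.nonunits_def[OF \<O>(1)])
  with \<O> GF_A sA show ?thesis by (intro that[of \<O>]) auto
qed

text \<open>\<open>Frobenius_lift\<close> asks for a Galois-stable ring, which \<open>\<O>\<close>
  in general is not; the elements all of whose conjugates lie in \<open>\<O>\<close> form one, and
  the non-units of \<open>\<O>\<close> cut out a prime ideal in it.\<close>

lemma exists_Frobenius:
  assumes \<O>: "valuation_subring L \<O>" "GF N \<subseteq> \<O>" "s \<in> \<O>"
    and c: "c \<in> GF N" "s - c \<in> valuation_subring.nonunits \<O>"
  obtains \<gamma> where "\<gamma> \<in> carrier (Gal L K)" "\<And>u. u \<in> \<kappa> \<Longrightarrow> \<gamma> u = u ^ N"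
    "\<And>b. b \<in> L \<Longrightarrow> (\<And>\<sigma>. \<sigma> \<in> carrier (Gal L K) \<Longrightarrow> \<sigma> b \<in> \<O>) \<Longrightarrow>
      \<gamma> b - b ^ N \<in> valuation_subring.nonunits \<O>"
proof -
  interpret O: valuation_subring L \<O> by (rule \<O>(1))
  note RO = O.\<O>(1) and RL = subfield_subring[OF L]
  let ?G = "carrier (Gal L K)"
  define B where "B = {b \<in> L. \<forall>\<sigma>\<in>?G. \<sigma> b \<in> \<O>}"
  have BL: "B \<subseteq> L" by (auto simp: B_def)
  have BO: "B \<subseteq> \<O>" using id_in_Gal[of L K] by (force simp: B_def)
  have B: "subring B \<Omega>"
    by (rule subringI_type)
       (auto simp: B_def subring_closed[OF RL] subring_closed[OF RO] hom_on_one[OF GalD(1)]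
         hom_on_uminus[OF GalD(1) RL] hom_on_mult[OF GalD(1)] hom_on_add[OF GalD(1)])
  interpret B: prime_ideal_of_subring B O.nonunits
  proof (rule prime_ideal_of_subring.intro[OF B O.zero O.not_one O.add])
    show "b * x \<in> O.nonunits" if "b \<in> B" "x \<in> O.nonunits" for b x
      using O.mult[of b x] that BO by blast
    show "x \<in> O.nonunits \<or> y \<in> O.nonunits" if "x \<in> B" "y \<in> B" "x * y \<in> O.nonunits" for x y
      using O.prime[of x y] that BO by blast
  qed
  have "\<exists>\<gamma>\<in>?G. \<forall>b\<in>B. \<gamma> b - b ^ N \<in> O.nonunits"
  proof (rule B.Frobenius_lift[OF finite_Gal id_in_Gal comp_in_Gal comp_Gal_cancel])
    show "hom_on B \<sigma>" if "\<sigma> \<in> ?G" for \<sigma> using GalD(1)[OF that] BL by (rule hom_on_subset)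
    show "\<sigma> b \<in> B" if \<sigma>: "\<sigma> \<in> ?G" and b: "b \<in> B" for \<sigma> b
    proof -
      have "\<tau> (\<sigma> b) \<in> \<O>" if "\<tau> \<in> ?G" for \<tau>
        using comp_in_Gal[OF that \<sigma>] b by (auto simp: B_def)
      then show ?thesis using GalD(3)[OF \<sigma>] b by (auto simp: B_def)
    qed
    show "hom_on UNIV (\<lambda>x :: 'a. x ^ N)" by (rule hom_on_char_power[OF N])
    \<comment> \<open>An invariant element lies in \<open>K\<close>, where its residue
      \<open>c'\<close> belongs to \<open>GF N\<close>, so \<open>c' ^ N = c'\<close>.\<close>
    show "b ^ N - b \<in> O.nonunits" if b: "b \<in> B" "\<And>\<sigma>. \<sigma> \<in> ?G \<Longrightarrow> \<sigma> b = b" for b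
    proof -
      have "b \<in> K" by (rule fixed_field) (use b BL in auto)
      then have bK: "b \<in> generate_field \<Omega> (insert s (GF N))" by (simp add: rational_function_field_def)
      have bO: "b \<in> \<O>" using b BO by auto
      obtain c' where c': "c' \<in> GF N" "b - c' \<in> O.nonunits"
        by (rule O.rational_residue[OF subfield_GF[OF N] \<O>(2) c(1) \<O>(3) c(2) bK bO])
      have "b ^ N - c' ^ N \<in> O.nonunits"
        by (rule O.power_congruent[OF bO _ c'(2)]) (use c' \<O>(2) in auto)
      then have "(b ^ N - c' ^ N) - (b - c') \<in> O.nonunits" using c'(2) by (rule O.diff)
      then show ?thesis using c'(1) by (simp add: GF_def)
    qed
  qed auto
  then obtain \<gamma> where \<gamma>: "\<gamma> \<in> ?G" "\<And>b. b \<in> B \<Longrightarrow> \<gamma> b - b ^ N \<in> O.nonunits" by blast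
  show ?thesis
  proof (rule that[OF \<gamma>(1)])
    show "\<gamma> b - b ^ N \<in> O.nonunits" if "b \<in> L" "\<And>\<sigma>. \<sigma> \<in> ?G \<Longrightarrow> \<sigma> b \<in> \<O>" for b
      by (rule \<gamma>(2)) (use that in \<open>auto simp: B_def\<close>)
    show "\<gamma> u = u ^ N" if u: "u \<in> \<kappa>" for u
    proof -
      obtain j where j: "u \<in> L" "j \<ge> 1" "u ^ (q ^ j) = u" using u const_iff by blast
      have Q: "char_power TYPE('a) (q ^ j)" by (rule char_power_power[OF q j(2)])
      have \<sigma>u: "\<sigma> u ^ (q ^ j) = \<sigma> u" if "\<sigma> \<in> ?G" for \<sigma>
        using hom_on_power[OF GalD(1)[OF that] RL j(1), of "q ^ j"] j(3) by simp
      have "\<sigma> u \<in> \<O>" if \<sigma>: "\<sigma> \<in> ?G" for \<sigma>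
      proof (cases "\<sigma> u = 0")
        case False
        then show ?thesis
          using O.root_of_unity_not_nonunit(1)[OF GalD(3)[OF \<sigma> j(1)] _ \<sigma>u[OF \<sigma>]] char_power_gt_1[OF Q]
          by blast
      qed (simp add: subring_zero[OF RO])
      then have "u \<in> B" using j(1) by (simp add: B_def)
      from \<gamma>(2)[OF this] have nu: "\<gamma> u - u ^ N \<in> O.nonunits" .
      \<comment> \<open>On constants the congruence is an equality:
        \<open>\<gamma> u - u ^ N\<close> is again fixed by a Frobenius power, so it is a unit or
        zero.\<close>
      have "(u ^ N) ^ (q ^ j) = (u ^ (q ^ j)) ^ N" by (simp flip: power_mult add: mult.commute)
      then have "(\<gamma> u - u ^ N) ^ (q ^ j) = \<gamma> u - u ^ N"
        using char_power_diff[OF Q, of "\<gamma> u" "u ^ N"] \<sigma>u[OF \<gamma>(1)] j(3) by simp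
      moreover have "\<gamma> u - u ^ N \<in> L"
        using GalD(3)[OF \<gamma>(1) j(1)] j(1) by (intro subring_diff[OF RL] subring_power[OF RL])
      ultimately have "\<gamma> u - u ^ N = 0"
        using O.root_of_unity_not_nonunit(2)[of "\<gamma> u - u ^ N" "q ^ j"] nu char_power_gt_1[OF Q] by blast
      then show ?thesis by simp
    qed
  qed
qed

text \<open>For \<open>r > t\<close> all of \<open>V\<close> is integral and a root \<open>z\<close>
  is congruent to some \<open>v\<close> in \<open>V\<close>. Then \<open>\<gamma> v\<close>,
  \<open>v ^ N\<close>, \<open>z ^ N = z\<close> and \<open>v\<close> are congruent, and congruent
  elements of \<open>V\<close> are equal, so \<open>v\<close> is fixed. For \<open>r < t\<close> the
  same chain is run with inverses.\<close>

lemma rational_roots_le_fixed: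
  assumes c: "c \<in> GF N"
  obtains \<gamma> where "\<gamma> \<in> carrier (Gal L K)" "\<And>u. u \<in> \<kappa> \<Longrightarrow> \<gamma> u = u ^ N"
    "card {x \<in> GF N. poly (pencil q t l c) x = 0} \<le> card {v \<in> V. \<gamma> v = v}"
proof -
  obtain \<O> where \<O>: "valuation_subring L \<O>" "GF N \<subseteq> \<O>" "s \<in> \<O>"
    "s - c \<in> valuation_subring.nonunits \<O>"
    by (rule exists_valuation_at[OF c])
  interpret O: valuation_subring L \<O> by (rule \<O>(1))
  note RO = O.\<O>(1) and RL = subfield_subring[OF L]
  obtain \<gamma> where \<gamma>: "\<gamma> \<in> carrier (Gal L K)" "\<And>u. u \<in> \<kappa> \<Longrightarrow> \<gamma> u = u ^ N"
    "\<And>b. b \<in> L \<Longrightarrow> (\<And>\<sigma>. \<sigma> \<in> carrier (Gal L K) \<Longrightarrow> \<sigma> b \<in> \<O>) \<Longrightarrow> \<gamma> b - b ^ N \<in> O.nonunits"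
    using exists_Frobenius[OF \<O>(1-3) c \<O>(4)] by blast
  let ?Z = "{x \<in> GF N. poly (pencil q t l c) x = 0}"
  let ?W = "{v \<in> V. \<gamma> v = v}"
  note GF_unit = GF_nonunit_zero[OF \<O>(1)]
  have pO: "pencil q t l s \<in> polys_over \<O>" by (rule pencil_over[OF RO \<O>(2,3)])
  have a0: "a 0 \<notin> O.nonunits" using GF_unit[OF a_in_GF] a_0 by blast
  have small: "v = 0" if "v \<in> V" "v \<in> O.nonunits" for v
    using O.small_root_zero[OF pO coeff_pencil(1), of v] that a0
    by (auto simp: V_iff coeff_pencil(2)[unfolded One_nat_def] O.nonunits_def)
  have at_z: "poly (pencil q t l s) z = - (s - c) * z ^ (q ^ t)" if "z \<in> ?Z" for z
    using that by (simp add: poly_pencil algebra_simps)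
  have fac: "poly (pencil q t l s) z = lead_coeff (pencil q t l s) * (\<Prod>v\<in>V. z - v)" for z
    using arg_cong[OF simple_roots_factorization(2)[OF pencil_nonzero[of s] pencil_simple], of "\<lambda>g. poly g z"]
    by (simp add: V_def poly_prod)
  have "\<exists>\<rho>. inj_on \<rho> ?Z \<and> \<rho> ` ?Z \<subseteq> ?W"
  proof (cases "r > t")
    case True
    have VO: "V \<subseteq> \<O>"
      using O.integrally_closed[OF pO] degree_pencil_gt(2)[OF True] O.not_one V_le_L
      by (auto simp: V_iff)
    have "\<exists>v\<in>V. z - v \<in> O.nonunits" if z: "z \<in> ?Z" for z
    proof -
      have "z ^ (q ^ t) * (s - c) \<in> O.nonunits"
        using z \<O>(2) by (intro O.mult subring_power[OF RO] \<O>(4)) auto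
      moreover have "(\<Prod>v\<in>V. z - v) = - (z ^ (q ^ t) * (s - c))"
        using at_z[OF z] fac[of z] degree_pencil_gt(2)[OF True, of s] by (simp add: algebra_simps)
      ultimately have "(\<Prod>v\<in>V. z - v) \<in> O.nonunits" using O.uminus by metis
      then show ?thesis
        by (rule O.prod[OF finite_V, rotated]) (use z \<O>(2) VO subring_diff[OF RO] in auto)
    qed
    then obtain \<rho> where \<rho>: "\<And>z. z \<in> ?Z \<Longrightarrow> \<rho> z \<in> V \<and> z - \<rho> z \<in> O.nonunits" by metis
    have "inj_on \<rho> ?Z"
    proof (rule inj_onI)
      fix z z' assume z: "z \<in> ?Z" "z' \<in> ?Z" "\<rho> z = \<rho> z'"
      have "(z - \<rho> z) - (z' - \<rho> z') \<in> O.nonunits" using \<rho>[OF z(1)] \<rho>[OF z(2)] O.diff by blast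
      then have "z - z' \<in> O.nonunits" using z(3) by simp
      moreover have "z - z' \<in> GF N" using z by (auto intro: subring_diff[OF subring_GF[OF N]])
      ultimately show "z = z'" using GF_unit[of "z - z'"] by simp
    qed
    moreover have "\<rho> z \<in> ?W" if z: "z \<in> ?Z" for z
    proof -
      have v: "\<rho> z \<in> V" "z - \<rho> z \<in> O.nonunits" using \<rho>[OF z] by auto
      have zO: "z \<in> \<O>" "z ^ N = z" using z \<O>(2) by (auto simp: GF_def)
      have "\<gamma> (\<rho> z) - \<rho> z ^ N \<in> O.nonunits"
        by (rule \<gamma>(3)) (use v V_le_L VO GalD(4) in auto)
      moreover have "z ^ N - \<rho> z ^ N \<in> O.nonunits"
        by (rule O.power_congruent) (use v zO VO in auto)
      ultimately have "(\<gamma> (\<rho> z) - \<rho> z ^ N) - (z ^ N - \<rho> z ^ N) + (z - \<rho> z) \<in> O.nonunits"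
        using v(2) O.diff O.add by blast
      then have "\<gamma> (\<rho> z) - \<rho> z \<in> O.nonunits" using zO(2) by simp
      moreover have "\<gamma> (\<rho> z) - \<rho> z \<in> V" using GalD(4)[OF \<gamma>(1) v(1)] v(1) by (rule V_diff)
      ultimately show ?thesis using small[of "\<gamma> (\<rho> z) - \<rho> z"] v(1) by simp
    qed
    ultimately show ?thesis by blast
  next
    case False
    then have rt: "r < t" using r_neq_t by simp
    \<comment> \<open>A non-zero \<open>v\<close> may have a pole but no zero, since
      \<open>small\<close> keeps it out of the non-units; so \<open>1 / v\<close> is
      integral.\<close>
    have inv_O: "inverse v \<in> \<O>" if v: "v \<in> V" "v \<noteq> 0" for v
    proof (rule ccontr)
      assume "inverse v \<notin> \<O>"
      then have "inverse (inverse v) \<in> O.nonunits"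
        using v V_le_L by (intro O.inverse_nonunit subfield_inverse[OF L]) auto
      then show False using small[of v] v by simp
    qed
    have inv_hom: "\<sigma> (inverse v) = inverse (\<sigma> v)" "\<sigma> v \<noteq> 0"
      if "\<sigma> \<in> carrier (Gal L K)" "v \<in> V" "v \<noteq> 0" for \<sigma> v
    proof -
      show "\<sigma> (inverse v) = inverse (\<sigma> v)"
        using hom_on_inverse[OF GalD(1)[OF that(1)] L] that V_le_L by blast
      show "\<sigma> v \<noteq> 0"
        using inj_onD[OF hom_on_inj[OF GalD(1)[OF that(1)] L], of v 0] that V_le_L
          hom_on_zero[OF GalD(1)[OF that(1)] RL] subring_zero[OF RL] by auto
    qed
    \<comment> \<open>Each factor is \<open>z - v = z * (- v) * (1 / z - 1 / v)\<close>, and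
      \<open>- s\<close> times the product of all \<open>- v\<close> is the coefficient
      \<open>a 0\<close>. After division by \<open>z ^ (q ^ t)\<close> the degenerating leading
      coefficient is replaced by the unit \<open>a 0\<close>.\<close>
    have prod_eq: "a 0 * (\<Prod>v\<in>V - {0}. inverse z - inverse v) = - (s - c)"
      if z: "z \<in> ?Z" "z \<noteq> 0" for z
    proof -
      have lc: "lead_coeff (pencil q t l s) = - s" by (rule degree_pencil_lt(2)[OF rt s_nonzero])
      have sp: "pencil q t l s = Polynomial.smult (- s) (\<Prod>v\<in>V. [:- v, 1:])"
        using simple_roots_factorization(2)[OF pencil_nonzero[of s] pencil_simple] lc
        by (simp add: V_def)
      have split: "(\<Prod>v\<in>V. g v) = g 0 * (\<Prod>v\<in>V - {0}. g v)" for g :: "'a \<Rightarrow> 'b::comm_monoid_mult"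
        by (rule prod.remove[OF finite_V V_zero])
      have "a 0 = - s * (\<Prod>v\<in>V - {0}. - v)"
      proof -
        have "coeff (\<Prod>v\<in>V. [:- v, 1:]) 1 = coeff ([:0, 1:] * (\<Prod>v\<in>V - {0}. [:- v, 1:])) 1"
          by (subst split) simp
        also have "\<dots> = coeff (\<Prod>v\<in>V - {0}. [:- v, 1:]) 0" by simp
        also have "\<dots> = (\<Prod>v\<in>V - {0}. - v)"
          by (simp add: poly_0_coeff_0[symmetric] poly_prod)
        finally have co: "coeff (\<Prod>v\<in>V. [:- v, 1:]) 1 = (\<Prod>v\<in>V - {0}. - v)" .
        have "a 0 = coeff (Polynomial.smult (- s) (\<Prod>v\<in>V. [:- v, 1:])) 1"
          unfolding sp[symmetric] by (rule coeff_pencil(2)[symmetric])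
        then show ?thesis unfolding coeff_smult co .
      qed
      moreover have "(\<Prod>v\<in>V. z - v) =
        z * (\<Prod>v\<in>V - {0}. z) * (\<Prod>v\<in>V - {0}. - v) * (\<Prod>v\<in>V - {0}. inverse z - inverse v)"
      proof -
        have "(\<Prod>v\<in>V - {0}. z - v) = (\<Prod>v\<in>V - {0}. z * - v * (inverse z - inverse v))"
          by (rule prod.cong) (use z(2) in \<open>auto simp: field_simps\<close>)
        also have "\<dots> = (\<Prod>v\<in>V - {0}. z) * (\<Prod>v\<in>V - {0}. - v) * (\<Prod>v\<in>V - {0}. inverse z - inverse v)"
          by (simp only: prod.distrib)
        finally show ?thesis by (subst split) (simp only: diff_zero mult.assoc)
      qed
      moreover have "z * (\<Prod>v\<in>V - {0}. z) = z ^ (q ^ t)"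
        using split[of "\<lambda>_. z"] card_V rt by (simp add: max_def)
      ultimately have "a 0 * (\<Prod>v\<in>V - {0}. inverse z - inverse v) * z ^ (q ^ t) =
        - s * (\<Prod>v\<in>V. z - v)" by (simp add: mult_ac)
      also have "\<dots> = - (s - c) * z ^ (q ^ t)" using fac[of z] at_z[OF z(1)] lc by simp
      finally show ?thesis using z(2) by (simp only: mult_right_cancel[OF power_not_zero[OF z(2)]])
    qed
    have inv_z: "inverse z \<in> GF N" if "z \<in> ?Z" for z
      using that subfield_inverse[OF subfield_GF[OF N]] by auto
    have "\<exists>v\<in>V - {0}. inverse z - inverse v \<in> O.nonunits" if z: "z \<in> ?Z" "z \<noteq> 0" for z
    proof -
      have in_O: "inverse z - inverse v \<in> \<O>" if "v \<in> V - {0}" for v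
        using inv_O[of v] that inv_z[OF z(1)] \<O>(2) by (auto intro!: subring_diff[OF RO])
      have "a 0 * (\<Prod>v\<in>V - {0}. inverse z - inverse v) \<in> O.nonunits"
        unfolding prod_eq[OF z] by (rule O.uminus[OF \<O>(4)])
      moreover have "a 0 \<in> \<O>" using a_in_GF \<O>(2) by blast
      moreover have "(\<Prod>v\<in>V - {0}. inverse z - inverse v) \<in> \<O>"
        by (rule subring_prod[OF RO in_O])
      ultimately have pr: "(\<Prod>v\<in>V - {0}. inverse z - inverse v) \<in> O.nonunits"
        using O.prime[of "a 0" "\<Prod>v\<in>V - {0}. inverse z - inverse v"] a0 by simp
      have "finite (V - {0})" using finite_V by simp
      then show ?thesis using in_O pr by (rule O.prod)
    qed
    then obtain \<rho>' where \<rho>': "\<And>z. z \<in> ?Z \<Longrightarrow> z \<noteq> 0 \<Longrightarrow> \<rho>' z \<in> V \<and> \<rho>' z \<noteq> 0 \<and>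
        inverse z - inverse (\<rho>' z) \<in> O.nonunits" by (metis Diff_iff singletonI)
    \<comment> \<open>The root 0 has no useful inverse and is matched with the zero vector.\<close>
    define \<rho> where "\<rho> z = (if z = 0 then 0 else \<rho>' z)" for z
    have "inj_on \<rho> ?Z"
    proof (rule inj_onI)
      fix z z' assume z: "z \<in> ?Z" "z' \<in> ?Z" "\<rho> z = \<rho> z'"
      show "z = z'"
      proof (cases "z = 0 \<or> z' = 0")
        case True
        then show ?thesis using z \<rho>'[OF z(1)] \<rho>'[OF z(2)] by (auto simp: \<rho>_def split: if_splits)
      next
        case False
        then have "\<rho>' z = \<rho>' z'" using z(3) by (simp add: \<rho>_def)
        moreover have "(inverse z - inverse (\<rho>' z)) - (inverse z' - inverse (\<rho>' z')) \<in> O.nonunits"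
          using \<rho>'[OF z(1)] \<rho>'[OF z(2)] False O.diff by blast
        ultimately have "inverse z - inverse z' \<in> O.nonunits" by simp
        moreover have "inverse z - inverse z' \<in> GF N"
          using inv_z z by (intro subring_diff[OF subring_GF[OF N]]) auto
        ultimately show ?thesis using GF_unit[of "inverse z - inverse z'"] by simp
      qed
    qed
    moreover have "\<rho> z \<in> ?W" if z: "z \<in> ?Z" for z
    proof (cases "z = 0")
      case True
      then show ?thesis using V_zero hom_on_zero[OF GalD(1)[OF \<gamma>(1)] RL] by (simp add: \<rho>_def)
    next
      case False
      define v where "v = \<rho>' z"
      define v' where "v' = \<gamma> v"
      have v: "v \<in> V" "v \<noteq> 0" "inverse z - inverse v \<in> O.nonunits"
        using \<rho>'[OF z False] by (auto simp: v_def)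
      have v': "v' \<in> V" "v' \<noteq> 0" "\<gamma> (inverse v) = inverse v'"
        using GalD(4)[OF \<gamma>(1) v(1)] inv_hom[OF \<gamma>(1) v(1,2)] by (auto simp: v'_def)
      have zO: "inverse z \<in> \<O>" "inverse z ^ N = inverse z" using inv_z[OF z] \<O>(2) by (auto simp: GF_def)
      have "\<gamma> (inverse v) - inverse v ^ N \<in> O.nonunits"
      proof (rule \<gamma>(3))
        show "inverse v \<in> L" using v V_le_L by (intro subfield_inverse[OF L]) auto
        show "\<sigma> (inverse v) \<in> \<O>" if "\<sigma> \<in> carrier (Gal L K)" for \<sigma>
          using inv_hom[OF that v(1,2)] inv_O[OF GalD(4)[OF that v(1)]] by simp
      qed
      moreover have "inverse z ^ N - inverse v ^ N \<in> O.nonunits"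
        by (rule O.power_congruent[OF zO(1) inv_O[OF v(1,2)] v(3)])
      ultimately have "(\<gamma> (inverse v) - inverse v ^ N) - (inverse z ^ N - inverse v ^ N) \<in> O.nonunits"
        by (rule O.diff)
      then have d: "inverse v' - inverse z \<in> O.nonunits" using zO(2) v'(3) by simp
      \<comment> \<open>If they differed, \<open>1 / (v - v')\<close> would be integral, as is every
        inverse of a non-zero element of \<open>V\<close>. Multiplied by the non-unit
        \<open>1 / v' - 1 / v\<close> it gives \<open>1 / (v * v')\<close>, so one of the two
        inverses, and with it \<open>1 / z\<close>, would be a non-unit.\<close>
      have "v = v'"
      proof (rule ccontr)
        assume ne: "v \<noteq> v'"
        have "v - v' \<in> V" using v(1) v'(1) by (rule V_diff)
        then have "inverse (v - v') * ((inverse v' - inverse z) + (inverse z - inverse v)) \<in> O.nonunits"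
          using ne v(3) d inv_O[of "v - v'"] by (intro O.mult O.add) auto
        moreover have "inverse (v - v') * ((inverse v' - inverse z) + (inverse z - inverse v)) =
          inverse v * inverse v'"
          using ne v(2) v'(2) by (simp add: field_simps)
        ultimately have "inverse v * inverse v' \<in> O.nonunits" by (simp only:)
        then have "inverse v \<in> O.nonunits \<or> inverse v' \<in> O.nonunits"
          using O.prime[OF inv_O[OF v(1,2)] inv_O[OF v'(1,2)]] by blast
        then have "inverse z \<in> O.nonunits"
        proof
          assume "inverse v \<in> O.nonunits"
          from O.add[OF v(3) this] show ?thesis by simp
        next
          assume "inverse v' \<in> O.nonunits"
          from O.diff[OF this d] show ?thesis by simp
        qed
        then show False using GF_unit[OF inv_z[OF z]] False by simp
      qed
      then show ?thesis using v False by (simp add: \<rho>_def v_def v'_def)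
    qed
    ultimately show ?thesis by blast
  qed
  then obtain \<rho> where \<rho>: "inj_on \<rho> ?Z" "\<rho> ` ?Z \<subseteq> ?W" by blast
  have "finite ?W" using finite_V by simp
  from card_inj_on_le[OF \<rho> this] have "card ?Z \<le> card ?W" .
  from that[OF \<gamma>(1,2) this] show ?thesis .
qed

text \<open>Condition (2) with \<open>h\<close> absorbed, since \<open>h \<circ> \<gamma>\<close>
  stays in the coset, and with the rank bound read as a bound on fixed vectors. In this form levels
  can be compared, because \<open>V\<close> is the same for all of them.\<close>

definition Frobenius_coset_scattered where
  "Frobenius_coset_scattered \<longleftrightarrow>
    (\<forall>\<gamma>\<in>carrier (Gal L K). (\<forall>u\<in>\<kappa>. \<gamma> u = u ^ N) \<longrightarrow> card {v \<in> V. \<gamma> v = v} \<le> q)"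

text \<open>Each \<open>c\<close> has its own element of the coset, with at least as many fixed
  vectors as there are roots at \<open>c\<close>. This holds at every level, so it also serves the
  levels reached by transfer.\<close>

lemma scattered_if_Frobenius_coset_scattered:
  assumes "Frobenius_coset_scattered" shows "scattered q n m t l"
  unfolding scattered_def
proof
  fix c :: 'a assume "c \<in> GF N"
  then obtain \<gamma> where \<gamma>: "\<gamma> \<in> carrier (Gal L K)" "\<And>u. u \<in> \<kappa> \<Longrightarrow> \<gamma> u = u ^ N"
    "card {x \<in> GF N. poly (pencil q t l c) x = 0} \<le> card {v \<in> V. \<gamma> v = v}"
    using rational_roots_le_fixed by blast
  note \<gamma>(3)
  also have "card {v \<in> V. \<gamma> v = v} \<le> q"
    using assms \<gamma>(1,2) by (auto simp: Frobenius_coset_scattered_def)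
  finally show "card {x \<in> GF N. poly (pencil q t l c) x = 0} \<le> q" .
qed

end

section \<open>Changing the level\<close>

text \<open>Cyclicity of the multiplicative group makes adjoining \<open>GF Q\<close> a simple
  extension, so an extended homomorphism is prescribed by one value.\<close>

lemma GF_generator:
  assumes Q: "char_power TYPE('a::alg_closed_field) Q"
  obtains \<zeta> :: "'a::alg_closed_field" where "\<zeta> \<in> GF Q" "\<And>x. x \<in> GF Q \<Longrightarrow> x \<noteq> 0 \<Longrightarrow> \<exists>i. x = \<zeta> ^ i"
proof -
  interpret F: field "\<Omega>|(GF Q :: 'a set)"
    by (rule ring.subfield_iff(2)[OF ring_ambient subfield_GF[OF Q]])
  have pow: "y [^]\<^bsub>\<Omega>|(GF Q)\<^esub> (k :: nat) = y ^ k" for y :: 'a and k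
    by (induction k) auto
  have "finite (carrier (\<Omega>|(GF Q :: 'a set)))" using finite_GF[OF Q] by simp
  from F.finite_field_mult_group_has_gen[OF this]
  obtain \<zeta> :: 'a where \<zeta>: "\<zeta> \<in> carrier (Multiplicative_Group.mult_of (\<Omega>|(GF Q)))"
    "carrier (Multiplicative_Group.mult_of (\<Omega>|(GF Q))) = {\<zeta> [^]\<^bsub>\<Omega>|(GF Q)\<^esub> i |i :: nat. i \<in> UNIV}"
    by blast
  show ?thesis
  proof (rule that[of \<zeta>])
    show "\<zeta> \<in> GF Q" using \<zeta>(1) by (simp add: Multiplicative_Group.carrier_mult_of)
    fix x :: 'a assume "x \<in> GF Q" "x \<noteq> 0"
    then have "x \<in> carrier (Multiplicative_Group.mult_of (\<Omega>|(GF Q)))" by (simp add: Multiplicative_Group.carrier_mult_of)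
    then show "\<exists>i. x = \<zeta> ^ i" unfolding \<zeta>(2) pow by blast
  qed
qed

context pencil_level
begin

lemma subfield_M: "subfield M \<Omega>" and s_in_M: "s \<in> M"
  using subfield_generate_field generate_field_superset[of "insert s (GF (q ^ n)) \<union> V"]
  by (auto simp: M_eq)

lemma L_eq_M: "L = generate_field \<Omega> (M \<union> GF N)"
  unfolding M_ext_eq[symmetric] M_ext_def ..

lemma M_le_L: "M \<subseteq> L"
  using generate_field_superset[of "M \<union> GF N"] by (auto simp: L_eq_M)

text \<open>
  The minimal polynomial over \<open>M\<close> of a generator \<open>\<zeta>\<close> of the finite field divides
  \<open>X ^ (q ^ J) - X\<close>, so its coefficients are constants, where \<open>\<sigma>\<close> is the \<open>N\<close>-th power map;
  hence \<open>\<zeta> ^ N\<close> is a legitimate image of \<open>\<zeta>\<close>.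
\<close>

lemma extend_by_Frobenius:
  assumes \<sigma>: "hom_on M \<sigma>" and const: "\<And>u j. u \<in> M \<Longrightarrow> j \<ge> 1 \<Longrightarrow> u ^ (q ^ j) = u \<Longrightarrow> \<sigma> u = u ^ N"
    and J: "J \<ge> 1"
  obtains \<tau> where "hom_on (generate_field \<Omega> (M \<union> GF (q ^ J))) \<tau>" "\<And>x. x \<in> M \<Longrightarrow> \<tau> x = \<sigma> x"
    "\<And>x. x \<in> GF (q ^ J) \<Longrightarrow> \<tau> x = x ^ N"
proof -
  define Q where "Q = q ^ J"
  have Q: "char_power TYPE('a) Q" unfolding Q_def by (rule char_power_power[OF q J])
  note RM = subfield_subring[OF subfield_M] and RQ = subring_GF[OF Q]
  obtain \<zeta> :: 'a where \<zeta>: "\<zeta> \<in> GF Q" "\<And>x. x \<in> GF Q \<Longrightarrow> x \<noteq> 0 \<Longrightarrow> \<exists>i. x = \<zeta> ^ i"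
    by (rule GF_generator[OF Q]) blast
  define g where "g = (monom 1 Q - monom 1 1 :: 'a poly)"
  note gp = GF_poly[OF Q, folded g_def]
  have "g \<in> polys_over M"
    unfolding g_def by (intro polys_over_diff[OF RM] polys_over_monom[OF RM] subring_one[OF RM])
  moreover have "g \<noteq> 0" using gp(2) by auto
  moreover have "poly g \<zeta> = 0" using gp(3) \<zeta>(1) by (simp add: GF_def)
  ultimately have g: "g \<in> polys_over M" "g \<noteq> 0" "poly g \<zeta> = 0" .
  obtain \<mu> where \<mu>: "is_minpoly M \<zeta> \<mu>" by (rule ex_minpoly[OF subfield_M g])
  note mp = minpolyD[OF subfield_M \<mu>]
  obtain h where h: "g = h * \<mu>" by (rule minpoly_dvd[OF subfield_M \<mu> g(1,3)])
  have "poly (pderiv \<mu>) x \<noteq> 0" if "poly \<mu> x = 0" for x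
  proof
    assume "poly (pderiv \<mu>) x = 0"
    then have "poly (pderiv g) x = 0" using that by (simp add: h pderiv_mult)
    then show False by (simp add: gp(4))
  qed
  from simple_roots_factorization(2)[OF mp(4) this]
  have "\<mu> = (\<Prod>x | poly \<mu> x = 0. [:- x, 1:])" by (simp add: mp(2))
  also have "\<dots> \<in> polys_over (GF Q)"
  proof (intro polys_over_prod[OF RQ] polys_over_linear[OF RQ] subring_uminus[OF RQ])
    fix x assume "x \<in> {x. poly \<mu> x = 0}"
    then have "poly g x = 0" by (simp add: h)
    then show "x \<in> GF Q" by (simp add: gp(3) GF_def)
  qed
  finally have "\<mu> \<in> polys_over (GF Q)" .
  then have "\<sigma> (coeff \<mu> i) = coeff \<mu> i ^ N" for i
    using polys_overD[of \<mu> "GF Q" i] polys_overD[OF mp(1), of i] const[OF _ J]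
    by (simp add: GF_def Q_def)
  moreover have zN: "(0 :: 'a) ^ N = 0" using q_gt_1 by simp
  ultimately have map_\<mu>: "map_poly \<sigma> \<mu> = map_poly (\<lambda>x. x ^ N) \<mu>"
    using hom_on_zero[OF \<sigma> RM] by (intro poly_eqI) (simp add: coeff_map_poly del: power_eq_0_iff)
  have "poly (map_poly \<sigma> \<mu>) (\<zeta> ^ N) = 0"
    using poly_map_poly[OF subring_UNIV hom_on_char_power[OF N], of \<mu> \<zeta>] mp(3) zN
    by (simp add: map_\<mu> polys_over_def del: power_eq_0_iff)
  then obtain \<tau> where \<tau>: "hom_on (generate_field \<Omega> (insert \<zeta> M)) \<tau>" "\<And>x. x \<in> M \<Longrightarrow> \<tau> x = \<sigma> x"
    "\<tau> \<zeta> = \<zeta> ^ N"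
    by (rule extend_hom_simple[OF subfield_M \<mu> \<sigma>]) blast
  let ?E = "generate_field \<Omega> (insert \<zeta> M)"
  note RE = subfield_subring[OF subfield_generate_field[of "insert \<zeta> M"]]
  have \<zeta>E: "\<zeta> \<in> ?E" "M \<subseteq> ?E" using generate_field_superset[of "insert \<zeta> M"] by auto
  have GF_E: "x \<in> ?E \<and> \<tau> x = x ^ N" if x: "x \<in> GF Q" for x
  proof (cases "x = 0")
    case True
    then show ?thesis
      using subring_zero[OF RE] hom_on_zero[OF \<tau>(1) RE] zN by (simp del: power_eq_0_iff)
  next
    case False
    then obtain i where i: "x = \<zeta> ^ i" using \<zeta>(2)[OF x] by blast
    have "\<tau> x = (\<zeta> ^ N) ^ i" unfolding i hom_on_power[OF \<tau>(1) RE \<zeta>E(1)] \<tau>(3) ..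
    then show ?thesis
      using subring_power[OF RE \<zeta>E(1)] by (simp add: i flip: power_mult add: mult.commute)
  qed
  have "generate_field \<Omega> (M \<union> GF Q) \<subseteq> ?E"
    by (rule generate_field_least[OF subfield_generate_field]) (use \<zeta>E GF_E in auto)
  from hom_on_subset[OF \<tau>(1) this] \<tau>(2) GF_E show ?thesis
    unfolding Q_def by (intro that[of \<tau>]) auto
qed

text \<open>The \<open>N\<close>-th power map is the identity on \<open>GF N\<close>, so prescribing
  it there gives an extension trivial on \<open>K\<close>. Thus the coset at level \<open>m\<close>
  is governed by restrictions to \<open>M\<close>.\<close>

lemma extend_to_Gal_by_Frobenius:
  assumes \<sigma>: "hom_on M \<sigma>" "\<sigma> s = s"
    and const: "\<And>u j. u \<in> M \<Longrightarrow> j \<ge> 1 \<Longrightarrow> u ^ (q ^ j) = u \<Longrightarrow> \<sigma> u = u ^ N"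
  obtains g where "g \<in> carrier (Gal L K)" "\<And>x. x \<in> M \<Longrightarrow> g x = \<sigma> x" "\<And>u. u \<in> \<kappa> \<Longrightarrow> g u = u ^ N"
proof -
  have nm: "n * m \<ge> 1" using n m by simp
  obtain \<tau> where \<tau>: "hom_on (generate_field \<Omega> (M \<union> GF N)) \<tau>" "\<And>x. x \<in> M \<Longrightarrow> \<tau> x = \<sigma> x"
    "\<And>x. x \<in> GF N \<Longrightarrow> \<tau> x = x ^ N"
    by (rule extend_by_Frobenius[OF \<sigma>(1) const nm]) blast+
  note \<tau> = \<tau>(1)[folded L_eq_M] \<tau>(2,3)
  have "\<tau> x = x" if x: "x \<in> K" for x
  proof -
    have "hom_on (generate_field \<Omega> (insert s (GF N))) \<tau>"
      using hom_on_subset[OF \<tau>(1) K_le_L] by (simp add: rational_function_field_def)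
    moreover have "hom_on (generate_field \<Omega> (insert s (GF N))) id" by (auto simp: hom_on_iff)
    moreover have "\<tau> y = id y" if "y \<in> insert s (GF N)" for y
      using that \<tau>(2)[OF s_in_M] \<sigma>(2) \<tau>(3)[of y] by (auto simp: GF_def)
    moreover have "x \<in> generate_field \<Omega> (insert s (GF N))"
      using x by (simp add: rational_function_field_def)
    ultimately have "\<tau> x = id x" by (rule hom_on_eq_generate_field)
    then show ?thesis by simp
  qed
  from restrict_in_Gal[OF \<tau>(1) this]
  have g: "(\<lambda>x. if x \<in> L then \<tau> x else x) \<in> carrier (Gal L K)" .
  have "\<tau> u = u ^ N" if u: "u \<in> \<kappa>" for u
  proof -
    obtain j where j: "u \<in> L" "j \<ge> 1" "u ^ (q ^ j) = u" using u const_iff by blast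
    \<comment> \<open>A constant of \<open>L\<close> need not lie in \<open>M\<close> or in
      \<open>GF N\<close>. With this \<open>J\<close>, \<open>GF (q ^ J)\<close> contains both
      \<open>u\<close> and \<open>GF N\<close>; the extension to the larger compositum agrees with
      \<open>\<tau>\<close> on generators of \<open>L\<close> and is the power map at
      \<open>u\<close>.\<close>
    define J where "J = n * m * j"
    have J: "J \<ge> 1" using nm j(2) by (simp add: J_def)
    have "GF N \<subseteq> (GF (q ^ J) :: 'a set)" using GF_power_mono[OF N, of j] by (simp add: J_def power_mult)
    then have LE: "L \<subseteq> generate_field \<Omega> (M \<union> GF (q ^ J))"
      unfolding L_eq_M by (intro generate_field_mono) auto
    have "u ^ (q ^ J) = u"
      using iterated_power_fixed[OF j(3), of "n * m"] by (simp add: J_def power_mult mult.commute)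
    then have uJ: "u \<in> GF (q ^ J)" by (simp add: GF_def)
    obtain \<tau>' where \<tau>': "hom_on (generate_field \<Omega> (M \<union> GF (q ^ J))) \<tau>'" "\<And>x. x \<in> M \<Longrightarrow> \<tau>' x = \<sigma> x"
      "\<And>x. x \<in> GF (q ^ J) \<Longrightarrow> \<tau>' x = x ^ N"
      by (rule extend_by_Frobenius[OF \<sigma>(1) const J]) blast+
    have "\<tau> u = \<tau>' u"
    proof (rule hom_on_eq_generate_field[of \<tau> "M \<union> GF N"])
      show "hom_on (generate_field \<Omega> (M \<union> GF N)) \<tau>" using \<tau>(1) by (simp add: L_eq_M)
      show "hom_on (generate_field \<Omega> (M \<union> GF N)) \<tau>'"
        using hom_on_subset[OF \<tau>'(1) LE] by (simp add: L_eq_M)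
      show "\<tau> x = \<tau>' x" if "x \<in> M \<union> GF N" for x
        using that \<tau>(2,3) \<tau>'(2,3) \<open>GF N \<subseteq> GF (q ^ J)\<close> by auto
      show "u \<in> generate_field \<Omega> (M \<union> GF N)" using j(1) by (simp add: L_eq_M)
    qed
    then show ?thesis using \<tau>'(3)[OF uJ] by simp
  qed
  then show ?thesis using M_le_L \<tau>(2) const_iff by (intro that[OF g]) auto
qed

text \<open>Restrict an automorphism of level \<open>m'\<close> to \<open>M\<close> and extend it to
  level \<open>m\<close>: the two power maps agree on the constants of \<open>M\<close>. As
  \<open>V\<close> lies in \<open>M\<close>, the fixed vectors are the same.\<close>

lemma Frobenius_coset_scattered_transfer:
  assumes scat: "Frobenius_coset_scattered" and m': "m' \<ge> 1"
    and period: "\<And>u j. u \<in> M \<Longrightarrow> j \<ge> 1 \<Longrightarrow> u ^ (q ^ j) = u \<Longrightarrow> u ^ (q ^ (n * m')) = u ^ N"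
  shows "pencil_level.Frobenius_coset_scattered q n t l s m'"
proof -
  interpret m': pencil_level q n t r l s m' by unfold_locales (rule m')
  show ?thesis
    unfolding m'.Frobenius_coset_scattered_def
  proof (intro ballI impI)
    fix \<gamma> assume \<gamma>: "\<gamma> \<in> carrier (Gal m'.L m'.K)" "\<forall>u\<in>m'.\<kappa>. \<gamma> u = u ^ m'.N"
    have hom: "hom_on M \<gamma>" by (rule hom_on_subset[OF m'.GalD(1)[OF \<gamma>(1)] m'.M_le_L])
    have s: "\<gamma> s = s" by (rule m'.GalD(2)[OF \<gamma>(1) m'.s_in_K])
    have const: "\<gamma> u = u ^ N" if u: "u \<in> M" "j \<ge> 1" "u ^ (q ^ j) = u" for u j
    proof -
      have "u \<in> m'.\<kappa>" unfolding m'.const_iff using u m'.M_le_L by blast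
      then show ?thesis using \<gamma>(2) period[OF u] by simp
    qed
    obtain g where g: "g \<in> carrier (Gal L K)" "\<And>x. x \<in> M \<Longrightarrow> g x = \<gamma> x" "\<And>u. u \<in> \<kappa> \<Longrightarrow> g u = u ^ N"
      by (rule extend_to_Gal_by_Frobenius[OF hom s const]) blast+
    have "{v \<in> V. \<gamma> v = v} = {v \<in> V. g v = v}" using g(2) V_subset_M by auto
    moreover have "card {v \<in> V. g v = v} \<le> q"
      using scat g(1,3) by (auto simp: Frobenius_coset_scattered_def)
    ultimately show "card {v \<in> V. \<gamma> v = v} \<le> q" by simp
  qed
qed

lemma const_closed_power: "u \<in> \<kappa> \<Longrightarrow> u ^ k \<in> \<kappa>"
  unfolding const_iff
  by (metis mult.commute power_mult subring_power[OF subfield_subring[OF L]])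

text \<open>The conditions are linked in a cycle: scattered gives the rank bound by the hypothesis
  applied to \<open>h \<circ> \<gamma>\<close>; taking \<open>h = id\<close> gives the coset
  condition; this gives scattered.\<close>

lemma scattered_iff:
  assumes Chebotarev: "\<And>\<gamma>. \<gamma> \<in> carrier (G_arith q n m s M) \<Longrightarrow> induces_Frobenius q n m s M \<gamma> \<Longrightarrow>
    Frobenius_of_rational_place q n m s M \<gamma>"
  shows "scattered q n m t l \<longleftrightarrow> Frobenius_coset_scattered"
    and "scattered q n m t l \<longleftrightarrow>
      (\<forall>\<gamma> \<in> carrier (G_arith q n m s M). induces_Frobenius q n m s M \<gamma> \<longrightarrow>
        (\<forall>h \<in> carrier (G_geom q n m s M).
           rk q V (\<lambda>v. (h \<otimes>\<^bsub>G_arith q n m s M\<^esub> \<gamma>) v - v) \<ge> max r t - 1))" (is "_ \<longleftrightarrow> ?rank")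
proof -
  have mult: "h \<otimes>\<^bsub>Gal L K\<^esub> \<gamma> = h \<circ> \<gamma>" for h \<gamma> :: "'a \<Rightarrow> 'a" by (simp add: Gal_def)
  have "?rank" if scat: "scattered q n m t l"
  proof (intro ballI impI)
    fix \<gamma> h assume \<gamma>: "\<gamma> \<in> carrier (G_arith q n m s M)" "induces_Frobenius q n m s M \<gamma>"
      and h: "h \<in> carrier (G_geom q n m s M)"
    have h\<gamma>: "h \<circ> \<gamma> \<in> carrier (Gal L K)"
      using G_geomD(1)[OF h] \<gamma>(1) unfolding G_arith_eq by (rule comp_in_Gal)
    have "(h \<circ> \<gamma>) u = u ^ N" if "u \<in> \<kappa>" for u
      using \<gamma>(2) that G_geomD(2)[OF h const_closed_power[OF that]] by (simp add: induces_Frobenius_iff)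
    then have "Frobenius_of_rational_place q n m s M (h \<circ> \<gamma>)"
      using Chebotarev[of "h \<circ> \<gamma>"] h\<gamma> by (simp add: G_arith_eq induces_Frobenius_iff)
    from rank_of_Frobenius[OF scat h\<gamma> this]
    show "rk q V (\<lambda>v. (h \<otimes>\<^bsub>G_arith q n m s M\<^esub> \<gamma>) v - v) \<ge> max r t - 1"
      by (simp add: G_arith_eq mult)
  qed
  moreover have "Frobenius_coset_scattered" if ?rank
    unfolding Frobenius_coset_scattered_def
  proof (intro ballI impI)
    fix \<gamma> assume \<gamma>: "\<gamma> \<in> carrier (Gal L K)" "\<forall>u\<in>\<kappa>. \<gamma> u = u ^ N"
    have "rk q V (\<lambda>v. (id \<otimes>\<^bsub>G_arith q n m s M\<^esub> \<gamma>) v - v) \<ge> max r t - 1"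
      using that \<gamma> id_in_G_geom by (simp add: G_arith_eq induces_Frobenius_iff)
    then show "card {v \<in> V. \<gamma> v = v} \<le> q"
      using rank_ge_iff[OF \<gamma>(1)] by (simp add: G_arith_eq mult)
  qed
  ultimately show "scattered q n m t l \<longleftrightarrow> Frobenius_coset_scattered" "scattered q n m t l \<longleftrightarrow> ?rank"
    using scattered_if_Frobenius_coset_scattered by blast+
qed

end

text \<open>A Frobenius element over the point \<open>s = 0\<close> has finite order, which bounds the constants of \<open>M\<close>.\<close>

lemma (in pencil_setup) constants_period:
  obtains c where "c \<ge> 1" "\<And>u j. u \<in> M \<Longrightarrow> j \<ge> 1 \<Longrightarrow> u ^ (q ^ j) = u \<Longrightarrow> u ^ (q ^ (n * c)) = u"
proof -
  \<comment> \<open>At level 1 the exponent \<open>N\<close> is \<open>q ^ n\<close>, so the period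
    comes out in the form \<open>n * c\<close>.\<close>
  interpret pencil_level q n t r l s 1 by unfold_locales simp
  have zero: "(0 :: 'a) \<in> GF N" by (rule subring_zero[OF subring_GF[OF N]])
  obtain \<O> where \<O>: "valuation_subring L \<O>" "GF N \<subseteq> \<O>" "s \<in> \<O>"
    "s - 0 \<in> valuation_subring.nonunits \<O>"
    by (rule exists_valuation_at[OF zero])
  obtain \<gamma> where \<gamma>: "\<gamma> \<in> carrier (Gal L K)" "\<And>u. u \<in> \<kappa> \<Longrightarrow> \<gamma> u = u ^ N"
    using exists_Frobenius[OF \<O>(1-3) zero \<O>(4)] by blast
  have pow_Gal: "(\<gamma> ^^ i) \<in> carrier (Gal L K)" for i
    by (induction i) (simp_all only: funpow.simps id_in_Gal comp_in_Gal[OF \<gamma>(1)])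
  have pow: "(\<gamma> ^^ i) u = u ^ (N ^ i)" if "u \<in> \<kappa>" for i u
  proof (induction i)
    case (Suc i)
    then show ?case
      using \<gamma>(2)[OF const_closed_power[OF that]] by (simp flip: power_mult add: mult.commute)
  qed simp
  have "\<not> inj (\<lambda>i. \<gamma> ^^ i)"
    using finite_Gal pow_Gal finite_imageD infinite_UNIV_nat finite_subset
    by (metis (no_types, lifting) image_subset_iff)
  then obtain i j where ij: "i < j" "\<gamma> ^^ i = \<gamma> ^^ j" unfolding inj_def by (metis nat_neq_iff)
  show ?thesis
  proof (rule that[of "j - i"])
    show "j - i \<ge> 1" using ij(1) by simp
    fix u k assume u: "u \<in> M" "k \<ge> 1" "u ^ (q ^ k) = u"
    have "u \<in> L" using u(1) M_le_L by blast
    then have u\<kappa>: "u \<in> \<kappa>" unfolding const_iff using u by blast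
    have "(u ^ (k ^ (j - i))) ^ (k ^ i) = u ^ (k ^ j)" for k :: nat
      using ij(1) by (simp flip: power_mult power_add)
    then have "(u ^ (N ^ (j - i))) ^ (N ^ i) = u ^ (N ^ i)"
      using pow[OF u\<kappa>, of i] pow[OF u\<kappa>, of j] ij(2) by metis
    moreover have "x = y" if "x ^ (N ^ i) = y ^ (N ^ i)" for x y :: 'a
    proof (cases "i = 0")
      case False
      then show ?thesis using char_power_inj[OF char_power_power[OF N, of i]] that by simp
    qed (use that in simp)
    ultimately have "u ^ (N ^ (j - i)) = u" by blast
    then show "u ^ (q ^ (n * (j - i))) = u" by (simp add: power_mult)
  qed
qed

theorem theorem2p6:
  fixes p e q n t r d :: nat
    and l :: "'a::alg_closed_field poly" and s :: 'a and M V :: "'a set" and C :: real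
  assumes "prime p" and "CHAR('a) = p" and "e \<ge> 1" and "q = p ^ e"
    and "n \<ge> 1" and "t \<ge> 1"
    and "\<forall>i. Polynomial.coeff l i \<in> GF (q ^ n)"
    and "linearized_of_degree q r l" and "t_normalized q t l"
    and "d = max r t"
    and "ring.transcendental \<Omega> (GF q) s"
    and "M = splitting_field (rational_function_field (q ^ n) s) (pencil q t l s)"
    and "V = {x \<in> M. poly (pencil q t l s) x = 0}"
    and "is_uniformizing_constant q n s M C"
  shows "(\<forall>m\<ge>1. real (q ^ (m * n)) > C \<longrightarrow>
            (scattered q n m t l \<longleftrightarrow>
              (\<forall>\<gamma> \<in> carrier (G_arith q n m s M). induces_Frobenius q n m s M \<gamma> \<longrightarrow>
                (\<forall>h \<in> carrier (G_geom q n m s M).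
                   rk q V (\<lambda>v. (h \<otimes>\<^bsub>G_arith q n m s M\<^esub> \<gamma>) v - v) \<ge> d - 1))))
       \<and> (exceptional_scattered q n t l \<longleftrightarrow>
            (\<exists>m\<ge>1. real (q ^ (n * m)) > C \<and> scattered q n m t l))"
proof -
  have q: "char_power TYPE('a) q" using assms(1-4) by (auto simp: char_power_def)
  interpret S: pencil_setup q n t r l s
    using q assms(5-9) transcendental_nonzero[OF assms(11)] by unfold_locales auto
  have M: "M = S.M" by (simp add: assms(12) S.M_def)
  have level: "pencil_level q n t r l s m" if "m \<ge> 1" for m
    by unfold_locales (rule that)
  have V: "V = separable_splitting.V (pencil q t l s)"
  proof -
    interpret pencil_level q n t r l s 1 by (rule level) simp
    show ?thesis using V_subset_M by (auto simp: assms(13) M V_iff)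
  qed
  have Chebotarev: "Frobenius_of_rational_place q n m s M \<gamma>"
    if m: "m \<ge> 1" "real (q ^ (n * m)) > C" and \<gamma>: "\<gamma> \<in> carrier (G_arith q n m s M)"
      "induces_Frobenius q n m s M \<gamma>" for m \<gamma>
  proof -
    \<comment> \<open>If every positive real is admissible, the infimum 0 is not. But any value
      above the infimum exceeds some admissible constant, whose property then applies.\<close>
    have "{C'. admissible_constant q n s M C'} \<noteq> {}"
      and "Inf {C'. admissible_constant q n s M C'} < real (q ^ (n * m))"
      using assms(14) m(2) unfolding is_uniformizing_constant_def by blast+
    from cInf_lessD[OF this] obtain C' where "admissible_constant q n s M C'" "C' < real (q ^ (n * m))"
      by blast
    then show ?thesis using m(1) \<gamma> by (auto simp: admissible_constant_def)
  qed
  show ?thesis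
  proof (intro conjI iffI, intro allI impI)
    fix m assume lv: "m \<ge> 1" "real (q ^ (m * n)) > C"
    interpret pencil_level q n t r l s m by (rule level[OF lv(1)])
    have "real (q ^ (n * m)) > C" using lv(2) by (simp add: mult.commute)
    note scattered_iff(2)[OF Chebotarev[OF lv(1) this, unfolded M]]
    then show "scattered q n m t l \<longleftrightarrow>
        (\<forall>\<gamma> \<in> carrier (G_arith q n m s M). induces_Frobenius q n m s M \<gamma> \<longrightarrow>
          (\<forall>h \<in> carrier (G_geom q n m s M).
             rk q V (\<lambda>v. (h \<otimes>\<^bsub>G_arith q n m s M\<^esub> \<gamma>) v - v) \<ge> d - 1))"
      unfolding M V assms(10) .
  next
    assume "exceptional_scattered q n t l"
    then have inf: "infinite {m. m \<ge> 1 \<and> scattered q n m t l}" by (simp add: exceptional_scattered_def)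
    obtain k :: nat where k: "C < real k" using reals_Archimedean2 by blast
    from inf obtain m where m: "m > k" "m \<ge> 1" "scattered q n m t l"
      unfolding infinite_nat_iff_unbounded by blast
    \<comment> \<open>An infinite set of levels has members beyond any bound, and
      \<open>q ^ (n * m)\<close> exceeds \<open>m\<close>.\<close>
    have "m < q ^ m" using S.q_gt_1 by (intro power_gt_expt) simp
    also have "\<dots> \<le> q ^ (n * m)" using S.q_gt_1 assms(5) by (intro power_increasing) auto
    finally have "real k < real (q ^ (n * m))" using m(1) by linarith
    then have "real (q ^ (n * m)) > C" using k by linarith
    then show "\<exists>m\<ge>1. real (q ^ (n * m)) > C \<and> scattered q n m t l" using m by blast
  next
    assume "\<exists>m\<ge>1. real (q ^ (n * m)) > C \<and> scattered q n m t l"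
    then obtain m where lv: "m \<ge> 1" "real (q ^ (n * m)) > C" "scattered q n m t l" by blast
    interpret pencil_level q n t r l s m by (rule level[OF lv(1)])
    have scat: "Frobenius_coset_scattered"
      using scattered_iff(1)[OF Chebotarev[OF lv(1,2), unfolded M]] lv(3) by simp
    obtain c where c: "c \<ge> 1" "\<And>u j. u \<in> S.M \<Longrightarrow> j \<ge> 1 \<Longrightarrow> u ^ (q ^ j) = u \<Longrightarrow> u ^ (q ^ (n * c)) = u"
      by (rule S.constants_period) blast
    \<comment> \<open>Raising the level by a multiple of the period \<open>c\<close> leaves the
      power map on the constants of \<open>M\<close> unchanged.\<close>
    have "scattered q n (m + i * c) t l" for i
    proof -
      have m': "m + i * c \<ge> 1" using lv(1) by simp
      have "u ^ (q ^ (n * (m + i * c))) = u ^ N" if "u \<in> S.M" "j \<ge> 1" "u ^ (q ^ j) = u" for u j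
      proof -
        have "u ^ ((q ^ (n * c)) ^ i) = u" by (rule iterated_power_fixed[OF c(2)[OF that]])
        moreover have "q ^ (n * (m + i * c)) = (q ^ (n * c)) ^ i * N"
          by (simp add: distrib_left power_add power_mult[symmetric] mult_ac)
        ultimately show ?thesis by (simp add: power_mult)
      qed
      from Frobenius_coset_scattered_transfer[OF scat m' this]
      show ?thesis by (rule pencil_level.scattered_if_Frobenius_coset_scattered[OF level[OF m']])
    qed
    then have "range (\<lambda>i. m + i * c) \<subseteq> {m. m \<ge> 1 \<and> scattered q n m t l}" using lv(1) by auto
    moreover have "inj (\<lambda>i. m + i * c)" using c(1) by (auto simp: inj_def)
    then have "infinite (range (\<lambda>i. m + i * c))" using finite_imageD infinite_UNIV_nat by blast
    ultimately show "exceptional_scattered q n t l"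
      unfolding exceptional_scattered_def using finite_subset by blast
  qed
qed

end
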